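(* Let $k$ be a field of prime characteristic $p$, let $S=k[[x_1,\ldots,x_n]]$, let $I\subsetneq S$ be a square-free monomial ideal, and let $R=S/I$ be its Stanley-Reisner ring. Let $\{c_e\}_{e\ge 0}$ be the complexity sequence of the Frobenius algebra $\mathcal{F}(E_R)$, and let $\mu:=\mu_S(J_p)$ be the minimal number of generators of the ideal $J_p$. Then $$\{c_e\}_{e\ge 0}=\{0,\mu+1,\mu,\mu,\mu,\ldots\},$$ that is, $c_0=0$, $c_1=\mu+1$ and $c_e=\mu$ for all $e\ge 2$.
   Context: Frobenius algebra. For a complete local ring $(R,\mathfrak m,k)$ of prime characteristic $p$, let $E_R$ be the injective hull of $k$ over $R$. For $e\ge 0$, $\mathcal{F}^e(E_R)$ is the $R$-module of additive maps $\phi:E_R\to E_R$ with $\phi(rz)=r^{p^e}\phi(z)$ for all $r\in R$, $z\in E_R$, and $\mathcal{F}(E_R)=\bigoplus_{e\ge 0}\mathcal{F}^e(E_R)$, an $\mathbb N$-graded (noncommutative) ring under composition, with $\mathcal{F}^0(E_R)=R$. Complexity sequence. For $e\ge 0$, let $G_e$ be the subring of $\mathcal{F}(E_R)$ generated by elements of degree at most $e$, let $k_e$ be the minimal number of homogeneous generators of $G_e$ as a subring of $\mathcal{F}(E_R)$ over $\mathcal{F}^0(E_R)=R$, and put $k_{-1}=0$ (note $k_0=0$). The complexity sequence is $c_e=k_e-k_{e-1}$; so $c_0=0$. For $e\ge 1$, $c_e$ equals the minimal number of generators of the $R$-module $\mathcal{F}^e(E_R)/(G_{e-1})_e$, where $(G_{e-1})_e$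 is the degree $e$ part of $G_{e-1}$ (known result of Enescu and Yao). The ideal $J_p$. Write the minimal primary decomposition $I=I_{\alpha_1}\cap\cdots\cap I_{\alpha_r}$, where $\alpha_1,\dots,\alpha_r\in\{0,1\}^n$ are distinct and $I_{\alpha}=(x_i:\alpha_i=1)$. After renumbering the variables, $I_{\alpha_1}+\cdots+I_{\alpha_r}=(x_1,\ldots,x_m)$ for some $m\le n$. For $q=p^e$, let $I^{[q]}$ be the ideal generated by the $q$-th powers of elements of $I$. Then $J_q$ denotes the ideal generated by the unique minimal (with respect to inclusion) monomial ideal such that $$(I^{[q]}:I)=I^{[q]}+J_q+\big((x_1\cdots x_m)^{q-1}\big)$$ (an empty product being $1$). One may compute $J_q$ in $k[[x_1,\ldots,x_m]]$ or in $S$; the minimal number of generators is the same. $\mu_S(\cdot)$ denotes minimal number of generators over $S$. *)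

theory Defs
  imports "HOL-Algebra.Algebra" "HOL-Library.Extended_Nat" "HOL-Library.Indicator_Function"
begin

section \<open>Power series in n variables over a field\<close>

text \<open>The variables are indexed by \<open>0, \<dots>, n - 1\<close>. An exponent vector is a function on
  \<open>nat\<close> that vanishes from \<open>n\<close> on, and a power series is its family of coefficients.\<close>

type_synonym 'k mvps = "(nat \<Rightarrow> nat) \<Rightarrow> 'k"

definition exps :: "nat \<Rightarrow> (nat \<Rightarrow> nat) set" where
  "exps n = {a. \<forall>i\<ge>n. a i = 0}"

definition mvps_monom :: "(nat \<Rightarrow> nat) \<Rightarrow> 'k::field mvps" where
  "mvps_monom a = (\<lambda>b. if b = a then 1 else 0)"

text \<open>In the product, \<open>b \<le> a\<close> is the componentwise order. For \<open>a \<in> exps n\<close> there are finitely many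
  such \<open>b\<close>; for any other \<open>a\<close> the sum is \<open>0\<close> when \<open>f\<close> and \<open>g\<close> lie in the carrier.\<close>

definition mvps_ring :: "nat \<Rightarrow> 'k::field mvps ring" where
  "mvps_ring n = \<lparr>
     carrier = {f. \<forall>a. a \<notin> exps n \<longrightarrow> f a = 0},
     monoid.mult = (\<lambda>f g a. \<Sum>b\<in>{b. b \<le> a}. f b * g (\<lambda>i. a i - b i)),
     one = mvps_monom (\<lambda>_. 0),
     ring.zero = (\<lambda>_. 0),
     ring.add = (\<lambda>f g a. f a + g a)\<rparr>"

definition monomial_ideal :: "nat \<Rightarrow> 'k::field mvps set \<Rightarrow> bool" where
  "monomial_ideal n I \<longleftrightarrow> (\<exists>A\<subseteq>exps n. I = Idl\<^bsub>mvps_ring n\<^esub> (mvps_monom ` A))"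

definition squarefree_monomial_ideal :: "nat \<Rightarrow> 'k::field mvps set \<Rightarrow> bool" where
  "squarefree_monomial_ideal n I \<longleftrightarrow>
     (\<exists>\<A>\<subseteq>Pow {..<n}. I = Idl\<^bsub>mvps_ring n\<^esub> ((\<lambda>A. mvps_monom (indicator A)) ` \<A>))"


section \<open>Ideals\<close>

definition bracket_power :: "('a, 'm) ring_scheme \<Rightarrow> 'a set \<Rightarrow> nat \<Rightarrow> 'a set" where
  "bracket_power R I q = Idl\<^bsub>R\<^esub> ((\<lambda>f. f [^]\<^bsub>R\<^esub> q) ` I)"

definition ideal_colon :: "('a, 'm) ring_scheme \<Rightarrow> 'a set \<Rightarrow> 'a set \<Rightarrow> 'a set" where
  "ideal_colon R I J = {f \<in> carrier R. \<forall>g\<in>J. f \<otimes>\<^bsub>R\<^esub> g \<in> I}"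

text \<open>The infimum of the empty set is \<open>\<infinity>\<close>, the value for ideals that are not finitely generated.\<close>

definition min_num_gens :: "('a, 'm) ring_scheme \<Rightarrow> 'a set \<Rightarrow> enat" where
  "min_num_gens R J =
     (INF A\<in>{A. finite A \<and> A \<subseteq> carrier R \<and> Idl\<^bsub>R\<^esub> A = J}. enat (card A))"


section \<open>The ideal \<open>J\<^sub>q\<close>\<close>

text \<open>A vector \<open>\<alpha> \<in> {0,1}\<^sup>n\<close> is represented by the set \<open>F = {i. \<alpha>\<^sub>i = 1}\<close>, and
  \<open>var_ideal n F\<close> is \<open>I\<^sub>\<alpha>\<close>.\<close>

definition var_ideal :: "nat \<Rightarrow> nat set \<Rightarrow> 'k::field mvps set" where
  "var_ideal n F = Idl\<^bsub>mvps_ring n\<^esub> ((\<lambda>i. mvps_monom (indicator {i})) ` F)"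

definition minimal_primary_decomposition :: "nat \<Rightarrow> 'k::field mvps set \<Rightarrow> nat set set \<Rightarrow> bool" where
  "minimal_primary_decomposition n I \<F> \<longleftrightarrow>
     \<F> \<subseteq> Pow {..<n} \<and>
     I = carrier (mvps_ring n) \<inter> (\<Inter>F\<in>\<F>. var_ideal n F) \<and>
     (\<forall>F\<in>\<F>. I \<noteq> carrier (mvps_ring n) \<inter> (\<Inter>G\<in>\<F> - {F}. var_ideal n G))"

text \<open>The variables (by index) that lie in the sum of the components of the decomposition. These are
  the variables numbered \<open>x\<^sub>1, \<dots>, x\<^sub>m\<close> after renumbering.\<close>

definition decomposition_vars :: "nat \<Rightarrow> 'k::field mvps set \<Rightarrow> nat set" where
  "decomposition_vars n I =
     {i \<in> {..<n}. (mvps_monom (indicator {i}) :: 'k mvps) \<in>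
        Idl\<^bsub>mvps_ring n\<^esub> (\<Union>F\<in>(THE \<F>. minimal_primary_decomposition n I \<F>). var_ideal n F)}"

definition J_equation :: "nat \<Rightarrow> 'k::field mvps set \<Rightarrow> nat \<Rightarrow> 'k mvps set \<Rightarrow> bool" where
  "J_equation n I q J \<longleftrightarrow>
     ideal_colon (mvps_ring n) (bracket_power (mvps_ring n) I q) I =
       bracket_power (mvps_ring n) I q <+>\<^bsub>mvps_ring n\<^esub> J <+>\<^bsub>mvps_ring n\<^esub>
       Idl\<^bsub>mvps_ring n\<^esub> {mvps_monom (\<lambda>i. if i \<in> decomposition_vars n I then q - 1 else 0)}"

definition J_ideal :: "nat \<Rightarrow> 'k::field mvps set \<Rightarrow> nat \<Rightarrow> 'k mvps set" where
  "J_ideal n I q = (THE J. monomial_ideal n J \<and> J_equation n I q J \<and>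
     (\<forall>J'. monomial_ideal n J' \<and> J_equation n I q J' \<and> J' \<subseteq> J \<longrightarrow> J' = J))"


section \<open>Injective hulls\<close>

definition mod_homs ::
  "('r, 'm) ring_scheme \<Rightarrow> ('r, 'a, 'n) module_scheme \<Rightarrow> ('r, 'b, 'o) module_scheme \<Rightarrow> ('a \<Rightarrow> 'b) set"
  where
  "mod_homs R M N = {f \<in> carrier M \<rightarrow> carrier N.
     (\<forall>x\<in>carrier M. \<forall>y\<in>carrier M. f (x \<oplus>\<^bsub>M\<^esub> y) = f x \<oplus>\<^bsub>N\<^esub> f y) \<and>
     (\<forall>r\<in>carrier R. \<forall>x\<in>carrier M. f (r \<odot>\<^bsub>M\<^esub> x) = r \<odot>\<^bsub>N\<^esub> f x)}"

text \<open>Lifting against all monomorphisms \<open>M \<rightarrow> N\<close> of \<open>R\<close>-modules. A quantifier has to fix the types of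
  the carriers of \<open>M\<close> and \<open>N\<close>; here it is the element type of \<open>R\<close>. The inclusions of ideals into
  \<open>R\<close> are among these monomorphisms, so by Baer's criterion no generality is lost.\<close>

definition injective_module :: "('r, 'm) ring_scheme \<Rightarrow> ('r, 'e, 'n) module_scheme \<Rightarrow> bool" where
  "injective_module R E \<longleftrightarrow> module R E \<and>
     (\<forall>(M :: ('r, 'r) module) (N :: ('r, 'r) module) i f.
        module R M \<and> module R N \<and> i \<in> mod_homs R M N \<and> inj_on i (carrier M) \<and> f \<in> mod_homs R M E \<longrightarrow>
        (\<exists>g \<in> mod_homs R N E. \<forall>x\<in>carrier M. g (i x) = f x))"

text \<open>\<open>E\<close> is injective and contains a copy of \<open>M\<close> over which it is essential.\<close>

definition injective_hull ::
  "('r, 'm) ring_scheme \<Rightarrow> ('r, 'a, 'n) module_scheme \<Rightarrow> ('r, 'e, 'o) module_scheme \<Rightarrow> bool" where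
  "injective_hull R M E \<longleftrightarrow> injective_module R E \<and>
     (\<exists>i \<in> mod_homs R M E. inj_on i (carrier M) \<and>
        (\<forall>N. submodule N R E \<and> N \<noteq> {\<zero>\<^bsub>E\<^esub>} \<longrightarrow> N \<inter> i ` carrier M \<noteq> {\<zero>\<^bsub>E\<^esub>}))"

definition quotient_module :: "('r, 'm) ring_scheme \<Rightarrow> 'r set \<Rightarrow> ('r, 'r set) module" where
  "quotient_module R \<mm> = \<lparr>
     carrier = carrier (R Quot \<mm>),
     monoid.mult = monoid.mult (R Quot \<mm>),
     one = one (R Quot \<mm>),
     ring.zero = ring.zero (R Quot \<mm>),
     ring.add = ring.add (R Quot \<mm>),
     smult = (\<lambda>r c. (\<mm> +>\<^bsub>R\<^esub> r) \<otimes>\<^bsub>R Quot \<mm>\<^esub> c)\<rparr>"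

text \<open>Meant for a local ring, where the maximal ideal is unique.\<close>

definition residue_field_module :: "('r, 'm) ring_scheme \<Rightarrow> ('r, 'r set) module" where
  "residue_field_module R = quotient_module R (THE \<mm>. maximalideal \<mm> R)"


section \<open>The Frobenius algebra and its complexity sequence\<close>

definition frobenius_maps ::
  "nat \<Rightarrow> ('r, 'm) ring_scheme \<Rightarrow> ('r, 'e, 'n) module_scheme \<Rightarrow> nat \<Rightarrow> ('e \<Rightarrow> 'e) set" where
  "frobenius_maps p R E e = {\<phi> \<in> carrier E \<rightarrow>\<^sub>E carrier E.
     (\<forall>x\<in>carrier E. \<forall>y\<in>carrier E. \<phi> (x \<oplus>\<^bsub>E\<^esub> y) = \<phi> x \<oplus>\<^bsub>E\<^esub> \<phi> y) \<and>
     (\<forall>r\<in>carrier R. \<forall>z\<in>carrier E. \<phi> (r \<odot>\<^bsub>E\<^esub> z) = (r [^]\<^bsub>R\<^esub> (p ^ e)) \<odot>\<^bsub>E\<^esub> \<phi> z)}"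

text \<open>An element of the direct sum is its sequence of homogeneous components. The sum is external:
  one map may be \<open>p\<^sup>e\<close>-linear for several \<open>e\<close>.\<close>

definition frobenius_algebra ::
  "nat \<Rightarrow> ('r, 'm) ring_scheme \<Rightarrow> ('r, 'e, 'n) module_scheme \<Rightarrow> (nat \<Rightarrow> 'e \<Rightarrow> 'e) ring" where
  "frobenius_algebra p R E = \<lparr>
     carrier = {\<Phi>. (\<forall>e. \<Phi> e \<in> frobenius_maps p R E e) \<and>
                    finite {e. \<Phi> e \<noteq> (\<lambda>z\<in>carrier E. \<zero>\<^bsub>E\<^esub>)}},
     monoid.mult = (\<lambda>\<Phi> \<Psi> e. \<lambda>z\<in>carrier E. \<Oplus>\<^bsub>E\<^esub>i\<in>{..e}. \<Phi> i (\<Psi> (e - i) z)),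
     one = (\<lambda>e. \<lambda>z\<in>carrier E. if e = 0 then z else \<zero>\<^bsub>E\<^esub>),
     ring.zero = (\<lambda>e. \<lambda>z\<in>carrier E. \<zero>\<^bsub>E\<^esub>),
     ring.add = (\<lambda>\<Phi> \<Psi> e. \<lambda>z\<in>carrier E. \<Phi> e z \<oplus>\<^bsub>E\<^esub> \<Psi> e z)\<rparr>"

definition frobenius_degree ::
  "nat \<Rightarrow> ('r, 'm) ring_scheme \<Rightarrow> ('r, 'e, 'n) module_scheme \<Rightarrow> nat \<Rightarrow> (nat \<Rightarrow> 'e \<Rightarrow> 'e) set" where
  "frobenius_degree p R E d =
     {\<Phi> \<in> carrier (frobenius_algebra p R E). \<forall>e. e \<noteq> d \<longrightarrow> \<Phi> e = (\<lambda>z\<in>carrier E. \<zero>\<^bsub>E\<^esub>)}"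

definition frobenius_G ::
  "nat \<Rightarrow> ('r, 'm) ring_scheme \<Rightarrow> ('r, 'e, 'n) module_scheme \<Rightarrow> nat \<Rightarrow> (nat \<Rightarrow> 'e \<Rightarrow> 'e) set" where
  "frobenius_G p R E e =
     generate_ring (frobenius_algebra p R E) (\<Union>d\<le>e. frobenius_degree p R E d)"

text \<open>Generators are counted over the degree zero part; the value is \<open>\<infinity>\<close> if finitely many do not
  suffice.\<close>

definition frobenius_k ::
  "nat \<Rightarrow> ('r, 'm) ring_scheme \<Rightarrow> ('r, 'e, 'n) module_scheme \<Rightarrow> nat \<Rightarrow> enat" where
  "frobenius_k p R E e =
     (INF A\<in>{A. finite A \<and> A \<subseteq> (\<Union>d. frobenius_degree p R E d) \<and>
               generate_ring (frobenius_algebra p R E) (frobenius_degree p R E 0 \<union> A) =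
                 frobenius_G p R E e}.
        enat (card A))"

text \<open>Truncation in the subtraction never occurs: the members of degree at most \<open>e - 1\<close> of a
  homogeneous generating set of \<open>G\<^sub>e\<close> generate \<open>G\<^sub>e\<^sub>-\<^sub>1\<close>, so \<open>k\<close> is nondecreasing.\<close>

definition complexity ::
  "nat \<Rightarrow> ('r, 'm) ring_scheme \<Rightarrow> ('r, 'e, 'n) module_scheme \<Rightarrow> nat \<Rightarrow> enat" where
  "complexity p R E e = frobenius_k p R E e - (if e = 0 then 0 else frobenius_k p R E (e - 1))"

end

theory Submission
  imports Defs "HOL-Library.Function_Algebras" "HOL-Computational_Algebra.Primes"
begin

text \<open>Write \<open>R = S / I\<close> and let \<open>N\<close> be the set of exponents of the monomials outside \<open>I\<close>. The injective
  hull \<open>E\<close> of the residue field is the module of finitely supported functions on \<open>N\<close>, on which power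
  series act by contraction: the lifting property of \<open>E\<close> embeds this module over the socle, and
  essentiality forces surjectivity, because a homomorphism from an ideal of \<open>S\<close> into the module kills
  all elements of high order (division by a standard basis) and hence extends to \<open>S\<close> by finite
  dimensional linear algebra.

  With this model of \<open>E\<close>, every \<open>p\<^sup>e\<close>-linear map is a power series times the natural Frobenius action,
  and the maps of degree \<open>e\<close> correspond to the power series supported on the exponents of monomials in
  \<open>(I\<^bsup>[q]\<^esup> : I)\<close> but not in \<open>I\<^bsup>[q]\<^esup>\<close>, \<open>q = p\<^sup>e\<close>. The minimal such exponents have entries in
  \<open>{0, q - 1, q}\<close>, and their pattern does not depend on \<open>q\<close>; the pattern without entries \<open>q\<close> belongs to
  \<open>(x\<^sub>1 \<cdots> x\<^sub>m)\<^bsup>q-1\<^esup>\<close>, and the others are the minimal generators of \<open>J\<^sub>q\<close>. For \<open>e \<ge> 2\<close> the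
  former is a product of elements of lower degree, while no decomposable element involves any of the
  latter. Hence one needs \<open>\<mu> + 1\<close> generators in degree \<open>1\<close> and \<open>\<mu>\<close> in each higher degree.\<close>

text \<open>Whether a monomial lies in \<open>(I^[q] : I)\<close> is decided at each minimal prime
  by comparing exponents with \<open>q - 1\<close> and \<open>q\<close> only. Hence the entries
  \<open>0, q - 1, q\<close>; for \<open>q = 2\<close> these are \<open>0, 1, 2\<close>, so the
  exponents found at \<open>q = 2\<close> serve as patterns. In a product of degrees
  \<open>i, j \<ge> 1\<close> exponents combine as \<open>u + p^i v\<close>. If the result is a
  minimal exponent, minimality forces its pattern already on \<open>v\<close>. Then every entry of
  \<open>u\<close> is below \<open>p^i\<close>, so \<open>u\<close> is at least
  \<open>p^i - 1\<close> at all variables of all minimal primes, and the result lies above the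
  exponent of \<open>(x_1 ... x_m)^(q-1)\<close>. Among the minimal exponents only that one can be
  decomposable. Generators are counted through coefficients at minimal exponents. There, elements of
  degree zero act through constant terms, on the right through \<open>p^d\<close>-th powers of
  these; both are scalars, so linear spans over \<open>k\<close> are preserved from either side. A
  homomorphism kills elements of high order because a standard basis is finite, the images of its
  members have finite support, and high order passes to the quotients of the division.\<close>

section \<open>Linear algebra for counting generators\<close>

lemma sum_fun_apply: "sum F A x = (\<Sum>a\<in>A. F a x)"
  for F :: "'a \<Rightarrow> 'b \<Rightarrow> 'c::comm_monoid_add"
  by (induction A rule: infinite_finite_induct) auto

text \<open>The unit vectors on \<open>W\<close> are independent and lie in the span of the images
  of \<open>A\<close>. Both lower bounds on numbers of generators are reduced to this by reading off
  coefficients at finitely many exponents.\<close>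

lemma card_le_of_spanning:
  fixes v :: "'b \<Rightarrow> 'w \<Rightarrow> 'k::field"
  assumes "finite A" "finite W"
    and span: "\<And>w0. w0 \<in> W \<Longrightarrow> \<exists>c. \<forall>w\<in>W. (if w = w0 then 1 else 0) = (\<Sum>x\<in>A. c x * v x w)"
  shows "card W \<le> card A"
proof -
  interpret vs: vector_space "\<lambda>c (f :: 'w \<Rightarrow> 'k) w. c * f w"
    by unfold_locales (auto simp: fun_eq_iff algebra_simps)
  define d where "d = (\<lambda>(w0::'w) w. if w = w0 then 1 else 0 :: 'k)"
  \<comment> \<open>The hypothesis only concerns points of \<open>W\<close>; cutting off makes it an
    identity of functions.\<close>
  define u where "u = (\<lambda>x w. if w \<in> W then v x w else 0)"
  have inj: "inj_on d W" by (auto simp: inj_on_def d_def fun_eq_iff split: if_splits)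
  have "vs.independent (d ` W)"
  proof (rule vs.independent_if_scalars_zero)
    fix f g assume *: "(\<Sum>x\<in>d ` W. (\<lambda>w. f x * x w)) = 0" "g \<in> d ` W"
    then obtain w0 where w0: "w0 \<in> W" "g = d w0" by auto
    have "0 = (\<Sum>x\<in>d ` W. (\<lambda>w. f x * x w)) w0" using *(1) by simp
    also have "\<dots> = (\<Sum>w\<in>W. f (d w) * d w w0)"
      by (simp add: sum_fun_apply sum.reindex[OF inj])
    also have "\<dots> = (\<Sum>w\<in>W. if w = w0 then f (d w0) else 0)"
      by (intro sum.cong) (auto simp: d_def)
    also have "\<dots> = f g" using w0 assms(2) by simp
    finally show "f g = 0" by simp
  qed (use assms in auto)
  moreover have "d ` W \<subseteq> vs.span (u ` A)"
  proof
    fix g assume "g \<in> d ` W"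
    then obtain w0 where w0: "w0 \<in> W" "g = d w0" by auto
    obtain c where c: "\<forall>w\<in>W. (if w = w0 then 1 else 0) = (\<Sum>x\<in>A. c x * v x w)" using span w0 by blast
    have "g = (\<Sum>x\<in>A. (\<lambda>w. c x * u x w))"
    proof
      fix w show "g w = (\<Sum>x\<in>A. (\<lambda>w. c x * u x w)) w"
        using c w0 by (cases "w \<in> W") (auto simp: sum_fun_apply d_def u_def)
    qed
    also have "\<dots> \<in> vs.span (u ` A)"
      by (intro vs.span_sum vs.span_scale vs.span_base) auto
    finally show "g \<in> vs.span (u ` A)" .
  qed
  ultimately have "card (d ` W) \<le> card (u ` A)"
    using vs.independent_span_bound[of "u ` A" "d ` W"] assms(1) by auto
  then show ?thesis using card_image[OF inj] card_image_le[OF assms(1), of u] by simp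
qed

section \<open>Arithmetic of power series\<close>

definition pmul :: "'k::comm_ring mvps \<Rightarrow> 'k mvps \<Rightarrow> 'k mvps" where
  "pmul f g a = (\<Sum>b\<in>{b. b \<le> a}. f b * g (a - b))"

lemma add_eq_iff_le_diff: "b + c = a \<longleftrightarrow> b \<le> a \<and> c = a - b" for a b c :: "nat \<Rightarrow> nat"
proof
  assume "b + c = a"
  then have "a i = b i + c i" for i by auto
  then show "b \<le> a \<and> c = a - b" by (auto simp: le_fun_def fun_eq_iff)
qed (auto simp: le_fun_def fun_eq_iff)

lemma finite_le_exp:
  assumes "a \<in> exps n"
  shows "finite {b. b \<le> a}"
proof -
  have "{b. b \<le> a} \<subseteq> {f. \<forall>i. (i \<in> {..<n} \<longrightarrow> f i \<in> {..Max (a ` {..<n})}) \<and> (i \<notin> {..<n} \<longrightarrow> f i = 0)}"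
  proof (intro subsetI CollectI allI conjI impI, goal_cases)
    case (1 b i)
    then have "b i \<le> a i" by (simp add: le_fun_def)
    also have "a i \<le> Max (a ` {..<n})" using 1 by simp
    finally show ?case by simp
  next
    case (2 b i)
    then have "b i \<le> a i" by (simp add: le_fun_def)
    also have "a i = 0" using 2 assms by (auto simp: exps_def)
    finally show ?case by simp
  qed
  then show ?thesis
    by (rule finite_subset) (rule finite_set_of_finite_funs; simp)
qed

text \<open>In this symmetric form commutativity and associativity are reindexings.\<close>

lemma pmul_eq_sum_pairs: "pmul f g a = (\<Sum>(b, c)\<in>{(b, c). b + c = a}. f b * g c)"
proof -
  have "(\<Sum>(b, c)\<in>{(b, c). b + c = a}. f b * g c) = (\<Sum>b\<in>{b. b \<le> a}. f b * g (a - b))"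
    by (rule sum.reindex_bij_witness[where i = "\<lambda>b. (b, a - b)" and j = fst])
       (auto simp: add_eq_iff_le_diff)
  then show ?thesis by (simp add: pmul_def)
qed

lemma pmul_commute: "pmul f g = pmul g f"
proof
  fix a
  show "pmul f g a = pmul g f a"
    unfolding pmul_eq_sum_pairs
    by (rule sum.reindex_bij_witness[where i = prod.swap and j = prod.swap]) (auto simp: ac_simps)
qed

lemma finite_sum_pairs:
  assumes "finite {b. b \<le> a}"
  shows "finite {(b, c). b + c = (a :: nat \<Rightarrow> nat)}"
  by (rule finite_subset[OF _ finite_imageI[OF assms, of "\<lambda>b. (b, a - b)"]])
     (auto simp: add_eq_iff_le_diff)

lemma pmul_assoc: "pmul (pmul f g) h = pmul f (pmul g h)"
proof
  fix a
  show "pmul (pmul f g) h a = pmul f (pmul g h) a"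
  \<comment> \<open>With infinitely many exponents below \<open>a\<close> both sides are sums over
    an infinite set, hence \<open>0\<close>.\<close>
  proof (cases "finite {b. b \<le> a}")
    case False
    then show ?thesis by (simp add: pmul_def)
  next
    case True
    have fin: "finite {b. b \<le> c}" if "c \<le> a" for c
      using that by (intro finite_subset[OF _ True]) auto
    have fin1: "finite {(c, d). c + d = b}" if "b + e = a" for b e
      using that by (intro finite_sum_pairs fin) (auto simp: add_eq_iff_le_diff)
    have fin2: "finite {(c, d). c + d = b}" if "e + b = a" for b e
      using that by (intro fin1[of b e]) (simp add: add.commute)
    have "pmul (pmul f g) h a =
        (\<Sum>x\<in>{(b, e). b + e = a}. \<Sum>y\<in>{(c, d). c + d = fst x}. f (fst y) * g (snd y) * h (snd x))"
      unfolding pmul_eq_sum_pairs by (simp add: sum_distrib_right case_prod_beta)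
    also have "\<dots> = (\<Sum>(x, y)\<in>(SIGMA x:{(b, e). b + e = a}. {(c, d). c + d = fst x}).
        f (fst y) * g (snd y) * h (snd x))"
      using finite_sum_pairs[OF True] fin1 by (subst sum.Sigma) auto
    also have "\<dots> = (\<Sum>(x, y)\<in>(SIGMA x:{(b, e). b + e = a}. {(c, d). c + d = snd x}).
        f (fst x) * (g (fst y) * h (snd y)))"
      by (rule sum.reindex_bij_witness[where
            i = "\<lambda>((b, e), (c, d)). ((b + c, d), (b, c))" and
            j = "\<lambda>((b, e), (c, d)). ((c, d + e), (d, e))"]) (auto simp: ac_simps)
    also have "\<dots> = (\<Sum>x\<in>{(b, e). b + e = a}. \<Sum>y\<in>{(c, d). c + d = snd x}. f (fst x) * (g (fst y) * h (snd y)))"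
      using finite_sum_pairs[OF True] fin2 by (subst sum.Sigma) auto
    also have "\<dots> = pmul f (pmul g h) a"
      unfolding pmul_eq_sum_pairs by (simp add: sum_distrib_left case_prod_beta)
    finally show ?thesis .
  qed
qed

lemma pmul_add_left: "pmul (f + g) h = pmul f h + pmul g h"
  by (rule ext) (simp add: pmul_def sum.distrib distrib_right)

lemma pmul_zero_left [simp]: "pmul 0 h = 0"
  by (rule ext) (simp add: pmul_def)

lemma pmul_zero_right [simp]: "pmul h 0 = 0"
  by (rule ext) (simp add: pmul_def)

definition pterm :: "(nat \<Rightarrow> nat) \<Rightarrow> 'k::comm_ring \<Rightarrow> 'k mvps" where
  "pterm a c = (\<lambda>b. if b = a then c else 0)"

lemma mvps_monom_eq: "mvps_monom a = pterm a 1"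
  by (simp add: mvps_monom_def pterm_def)

lemma exps_mono:
  assumes "a \<in> exps n" "b \<le> a"
  shows "b \<in> exps n"
  unfolding exps_def
proof (safe)
  fix i assume "n \<le> i"
  then have "a i = 0" using assms(1) by (simp add: exps_def)
  with le_funD[OF assms(2), of i] show "b i = 0" by simp
qed

lemma exps_add: "a + b \<in> exps n \<longleftrightarrow> a \<in> exps n \<and> b \<in> exps n"
  by (auto simp: exps_def)

lemma zero_in_exps [simp]: "0 \<in> exps n"
  by (simp add: exps_def)

lemma pmul_pterm:
  assumes "c \<in> exps n"
  shows "pmul (pterm a t) f c = (if a \<le> c then t * f (c - a) else 0)"
proof -
  have "pmul (pterm a t) f c = (\<Sum>b\<in>{b. b \<le> c}. if b = a then t * f (c - a) else 0)"
    unfolding pmul_def pterm_def by (intro sum.cong) auto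
  then show ?thesis using finite_le_exp[OF assms] by simp
qed

lemma pmul_pterm_pterm:
  assumes "a \<in> exps n" "b \<in> exps n"
  shows "pmul (pterm a s) (pterm b t) = pterm (a + b) (s * t)"
proof
  fix c
  show "pmul (pterm a s) (pterm b t) c = pterm (a + b) (s * t) c"
  proof (cases "c \<in> exps n")
    case True
    have "c = a + b \<longleftrightarrow> a \<le> c \<and> c - a = b"
      using add_eq_iff_le_diff[of a b c] by auto
    with True show ?thesis
      by (simp add: pmul_pterm) (simp add: pterm_def)
  next
    case False
    then have "c \<noteq> a + b" using assms by (auto simp: exps_add)
    moreover have "pmul (pterm a s) (pterm b t) c = 0"
      unfolding pmul_eq_sum_pairs
      by (rule sum.neutral) (use False assms in \<open>auto simp: pterm_def exps_add\<close>)
    ultimately show ?thesis by (simp add: pterm_def)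
  qed
qed

definition pser :: "nat \<Rightarrow> 'k::zero mvps set" where
  "pser n = {f. \<forall>a. a \<notin> exps n \<longrightarrow> f a = 0}"

lemma pserD: "f \<in> pser n \<Longrightarrow> f a \<noteq> 0 \<Longrightarrow> a \<in> exps n"
  by (auto simp: pser_def)

lemma pser_pterm [intro]: "a \<in> exps n \<Longrightarrow> pterm a t \<in> pser n"
  by (auto simp: pser_def pterm_def)

lemma pser_add [intro]: "f \<in> pser n \<Longrightarrow> g \<in> pser n \<Longrightarrow> f + g \<in> pser n"
  for f g :: "'k::comm_ring mvps"
  by (auto simp: pser_def)

lemma pser_diff [intro]: "f \<in> pser n \<Longrightarrow> g \<in> pser n \<Longrightarrow> f - g \<in> pser n"
  for f g :: "'k::comm_ring mvps"
  by (auto simp: pser_def fun_diff_def)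

lemma pser_minus [intro]: "f \<in> pser n \<Longrightarrow> - f \<in> pser n"
  for f :: "'k::comm_ring mvps"
  by (auto simp: pser_def)

lemma pser_zero [intro, simp]: "0 \<in> pser n"
  by (auto simp: pser_def)

lemma pmul_nonzeroD:
  assumes "pmul f g a \<noteq> 0"
  shows "\<exists>b c. b + c = a \<and> f b \<noteq> 0 \<and> g c \<noteq> 0"
proof (rule ccontr)
  assume "\<not> ?thesis"
  then have "pmul f g a = 0"
    unfolding pmul_eq_sum_pairs by (intro sum.neutral) (auto, metis mult_zero_left mult_zero_right)
  with assms show False by simp
qed

lemma pser_pmul [intro]: "f \<in> pser n \<Longrightarrow> g \<in> pser n \<Longrightarrow> pmul f g \<in> pser n"
  unfolding pser_def mem_Collect_eq by (metis pmul_nonzeroD exps_add)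

lemma pmul_one [simp]: "f \<in> pser n \<Longrightarrow> pmul (pterm 0 1) f = f" for f :: "'k::comm_ring_1 mvps"
proof
  fix a assume f: "f \<in> pser n"
  have "pmul (pterm 0 1) f \<in> pser n" by (intro pser_pmul pser_pterm f zero_in_exps)
  then show "pmul (pterm 0 1) f a = f a"
    using f by (cases "a \<in> exps n") (auto simp: pmul_pterm pser_def le_fun_def fun_diff_def)
qed

lemma mvps_ring_simps:
  "carrier (mvps_ring n) = pser n"
  "monoid.mult (mvps_ring n) = pmul"
  "ring.add (mvps_ring n) = (+)"
  "ring.zero (mvps_ring n) = 0"
  "one (mvps_ring n) = pterm 0 1"
  by (simp_all add: mvps_ring_def pser_def mvps_monom_eq fun_eq_iff pmul_def pterm_def fun_diff_def)

lemma cring_mvps: "cring (mvps_ring n)"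
proof (rule cringI)
  show "abelian_group (mvps_ring n :: 'a mvps ring)"
  proof (rule abelian_groupI)
    fix x :: "'a mvps" assume "x \<in> carrier (mvps_ring n)"
    then show "\<exists>y\<in>carrier (mvps_ring n). y \<oplus>\<^bsub>mvps_ring n\<^esub> x = \<zero>\<^bsub>mvps_ring n\<^esub>"
      by (intro bexI[of _ "- x"]) (auto simp: mvps_ring_simps)
  qed (auto simp: mvps_ring_simps add.assoc add.commute)
  show "comm_monoid (mvps_ring n :: 'a mvps ring)"
    by (rule comm_monoidI)
       (simp_all add: mvps_ring_simps pser_pmul pser_pterm pmul_assoc, simp add: pmul_commute)
qed (simp add: mvps_ring_simps pmul_add_left)

text \<open>The arithmetic of power series, with the number of variables unspecified, as a type: this makes
  the binomial theorem for commutative semirings applicable to them.\<close>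

typedef (overloaded) 'k pseries = "{f :: 'k::comm_ring_1 mvps. \<forall>a. (\<forall>n. a \<notin> exps n) \<longrightarrow> f a = 0}"
  by (rule exI[of _ "\<lambda>_. 0"]) simp

lemma pseries_pmul:
  assumes "\<forall>a. (\<forall>n. a \<notin> exps n) \<longrightarrow> f a = 0" "\<forall>a. (\<forall>n. a \<notin> exps n) \<longrightarrow> g a = 0"
  shows "\<forall>a. (\<forall>n. a \<notin> exps n) \<longrightarrow> pmul f g a = 0"
proof (intro allI impI, rule ccontr)
  fix a assume a: "\<forall>n. a \<notin> exps n" "pmul f g a \<noteq> 0"
  then obtain b c where bc: "b + c = a" "f b \<noteq> 0" "g c \<noteq> 0" using pmul_nonzeroD by metis
  with assms obtain k l where "b \<in> exps k" "c \<in> exps l" by blast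
  then have "b + c \<in> exps (max k l)" by (simp add: exps_def)
  with a bc show False by blast
qed

instantiation pseries :: (comm_ring_1) comm_ring_1
begin

definition "0 = Abs_pseries 0"
definition "1 = Abs_pseries (pterm 0 1)"
definition "f + g = Abs_pseries (Rep_pseries f + Rep_pseries g)"
definition "f - g = Abs_pseries (Rep_pseries f - Rep_pseries g)"
definition "- f = Abs_pseries (- Rep_pseries f)"
definition "f * g = Abs_pseries (pmul (Rep_pseries f) (Rep_pseries g))"

lemma Rep_pseries_simps:
  "Rep_pseries 0 = 0"
  "Rep_pseries 1 = pterm 0 1"
  "Rep_pseries (f + g) = Rep_pseries f + Rep_pseries g"
  "Rep_pseries (f - g) = Rep_pseries f - Rep_pseries g"
  "Rep_pseries (- f) = - Rep_pseries f"
  "Rep_pseries (f * g) = pmul (Rep_pseries f) (Rep_pseries g)"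
  using Rep_pseries[of f] Rep_pseries[of g] pseries_pmul[of "Rep_pseries f" "Rep_pseries g"]
  by (auto simp: zero_pseries_def one_pseries_def plus_pseries_def minus_pseries_def
      uminus_pseries_def times_pseries_def fun_diff_def pterm_def
      intro!: Abs_pseries_inverse)

instance
proof
  fix a b c :: "'a pseries"
  show "1 * a = a"
  proof (rule Rep_pseries_inject[THEN iffD1], rule ext)
    fix x
    show "Rep_pseries (1 * a) x = Rep_pseries a x"
    proof (cases "\<exists>n. x \<in> exps n")
      case True
      then show ?thesis
        by (auto simp: Rep_pseries_simps pmul_pterm le_fun_def fun_diff_def)
    next
      case False
      then show ?thesis using Rep_pseries[of a] Rep_pseries[of "1 * a"] by auto
    qed
  qed
  show "(0 :: 'a pseries) \<noteq> 1"
    by (simp add: Rep_pseries_inject[symmetric] Rep_pseries_simps)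
       (simp add: fun_eq_iff pterm_def exI[of _ 0])
qed (simp_all add: Rep_pseries_inject[symmetric] Rep_pseries_simps pmul_assoc pmul_add_left,
     simp_all add: pmul_commute algebra_simps)

end

section \<open>Powers with exponent a power of the characteristic\<close>

lemma Rep_pseries_of_nat: "Rep_pseries (of_nat k) = pterm 0 (of_nat k)"
  by (induction k) (auto simp: Rep_pseries_simps pterm_def fun_eq_iff)

text \<open>Constants embed into the power series, so freshman's dream holds there with the
  characteristic of the coefficients.\<close>

lemma CHAR_pseries: "CHAR('k::comm_ring_1 pseries) = CHAR('k)"
proof (rule CHAR_eqI)
  have "pterm 0 c = (0 :: 'k mvps) \<longleftrightarrow> c = 0" for c
    by (auto simp: pterm_def fun_eq_iff)
  then have *: "of_nat k = (0 :: 'k pseries) \<longleftrightarrow> of_nat k = (0 :: 'k)" for k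
    by (simp add: Rep_pseries_inject[symmetric] Rep_pseries_simps Rep_pseries_of_nat)
  show "of_nat CHAR('k) = (0 :: 'k pseries)" by (simp add: *)
  show "CHAR('k) dvd k" if "of_nat k = (0 :: 'k pseries)" for k
    using that by (simp add: * of_nat_eq_0_iff_char_dvd)
qed

lemma Rep_pseries_sum: "finite A \<Longrightarrow> Rep_pseries (sum F A) = (\<Sum>x\<in>A. Rep_pseries (F x))"
  by (induction A rule: finite_induct) (auto simp: Rep_pseries_simps)

lemma pser_pow_eq:
  fixes f :: "'k::field mvps"
  assumes "f \<in> pser n"
  shows "f [^]\<^bsub>mvps_ring n\<^esub> (m::nat) = Rep_pseries (Abs_pseries f ^ m)"
proof -
  have "Rep_pseries (Abs_pseries f) = f"
    using assms by (intro Abs_pseries_inverse) (auto simp: pser_def)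
  then show ?thesis
    by (induction m) (simp_all add: mvps_ring_simps Rep_pseries_simps nat_pow_def pmul_commute)
qed

text \<open>\<open>pfrob q f\<close> is \<open>f\<^sup>q\<close> when \<open>q\<close> is a power of the characteristic.\<close>

definition pfrob :: "nat \<Rightarrow> 'k::field mvps \<Rightarrow> 'k mvps" where
  "pfrob q f a = (if \<forall>i. q dvd a i then f (\<lambda>i. a i div q) ^ q else 0)"

text \<open>The coefficient at \<open>c\<close> sees only finitely many terms of \<open>f\<close>:
  \<open>G\<close> collects those with exponent at most \<open>c\<close>, \<open>H\<close> the
  others. The Frobenius power is additive on the finite sum \<open>G\<close> and on
  \<open>G + H\<close>, and no multiple of \<open>H\<close> has a coefficient at
  \<open>c\<close>.\<close>

lemma pser_pow_char_power:
  fixes f :: "'k::field mvps"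
  assumes p: "Factorial_Ring.prime CHAR('k)" and f: "f \<in> pser n"
  shows "f [^]\<^bsub>mvps_ring n\<^esub> (CHAR('k) ^ e) = pfrob (CHAR('k) ^ e) f"
proof
  fix c
  define q where "q = CHAR('k) ^ e"
  have q: "q > 0" using p by (simp add: q_def prime_gt_0_nat)
  have pow: "f [^]\<^bsub>mvps_ring n\<^esub> q \<in> pser n"
    using monoid.nat_pow_closed[OF cring.axioms(1)[OF cring_mvps, THEN ring.axioms(2)], of f] f
    by (simp add: mvps_ring_simps)
  show "(f [^]\<^bsub>mvps_ring n\<^esub> (CHAR('k) ^ e)) c = pfrob (CHAR('k) ^ e) f c"
    unfolding q_def[symmetric]
  proof (cases "c \<in> exps n")
    case False
    then have "\<exists>i\<ge>n. c i \<noteq> 0" by (auto simp: exps_def)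
    then have "pfrob q f c = 0"
    proof (cases "\<forall>i. q dvd c i")
      case True
      with \<open>\<exists>i\<ge>n. c i \<noteq> 0\<close> have "(\<lambda>i. c i div q) \<notin> exps n"
        by (auto simp: exps_def dvd_div_eq_0_iff)
      with f q show ?thesis by (simp add: pfrob_def pser_def)
    qed (auto simp: pfrob_def)
    with False pow show "(f [^]\<^bsub>mvps_ring n\<^esub> q) c = pfrob q f c" by (simp add: pser_def)
  next
    case True
    note fin = finite_le_exp[OF True]
    define G where "G = (\<Sum>b\<in>{b. b \<le> c}. Abs_pseries (pterm b (f b)))"
    define H where "H = Abs_pseries f - G"
    have Rt: "Rep_pseries (Abs_pseries (pterm b t)) = pterm b t" if "b \<le> c" for b t
      using exps_mono[OF True that] by (intro Abs_pseries_inverse) (auto simp: pterm_def)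
    have Rf: "Rep_pseries (Abs_pseries f) = f"
      using f by (intro Abs_pseries_inverse) (auto simp: pser_def)
    have H: "Rep_pseries H b = 0" if "b \<le> c" for b
    proof -
      have "Rep_pseries G b = (\<Sum>b'\<in>{b. b \<le> c}. pterm b' (f b') b)"
        unfolding G_def Rep_pseries_sum[OF fin] sum_fun_apply by (intro sum.cong) (auto simp: Rt)
      also have "\<dots> = f b" using that fin by (simp add: pterm_def)
      finally show ?thesis by (simp add: H_def Rep_pseries_simps Rf)
    qed
    have Hq: "Rep_pseries (H ^ q) c = 0"
    proof -
      have "Rep_pseries (H * H ^ (q - 1)) c = 0"
      proof (rule ccontr)
        assume "\<not> ?thesis"
        then obtain b d where "b + d = c" "Rep_pseries H b \<noteq> 0"
          using pmul_nonzeroD by (metis Rep_pseries_simps(6))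
        with H[of b] show False by (auto simp: add_eq_iff_le_diff)
      qed
      then show ?thesis using q by (simp add: power_eq_if)
    qed
    have pw: "Rep_pseries (Abs_pseries (pterm b t) ^ m) = pterm (\<lambda>i. m * b i) (t ^ m)" if "b \<le> c" for b t m
    proof (induction m)
      case 0
      show ?case by (simp add: Rep_pseries_simps zero_fun_def)
    next
      case (Suc m)
      have "b \<in> exps n" using exps_mono[OF True that] .
      then show ?case
        by (simp add: Rep_pseries_simps Suc Rt[OF that])
           (subst pmul_pterm_pterm[where n = n], auto simp: exps_def plus_fun_def)
    qed
    have "(f [^]\<^bsub>mvps_ring n\<^esub> q) c = Rep_pseries ((G + H) ^ q) c"
      by (simp add: pser_pow_eq[OF f] H_def)
    also have "(G + H) ^ q = G ^ q + H ^ q"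
      using freshmans_dream'[where ?'a = "'k pseries" and x = G and y = H and m = q and n = e] p
      by (simp add: CHAR_pseries q_def)
    also have "Rep_pseries \<dots> c = Rep_pseries (G ^ q) c"
      by (simp add: Rep_pseries_simps Hq)
    also have "G ^ q = (\<Sum>b\<in>{b. b \<le> c}. Abs_pseries (pterm b (f b)) ^ q)"
      using freshmans_dream_sum'[where ?'a = "'k pseries" and m = q and n = e and A = "{b. b \<le> c}"
          and f = "\<lambda>b. Abs_pseries (pterm b (f b))"] p
      by (simp add: CHAR_pseries q_def G_def)
    also have "Rep_pseries \<dots> c = (\<Sum>b\<in>{b. b \<le> c}. pterm (\<lambda>i. q * b i) (f b ^ q) c)"
      unfolding Rep_pseries_sum[OF fin] sum_fun_apply by (intro sum.cong) (auto simp: pw)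
    also have "\<dots> = pfrob q f c"
    proof (cases "\<forall>i. q dvd c i")
      case True
      define d where "d = (\<lambda>i. c i div q)"
      have d: "d \<le> c" by (simp add: d_def le_fun_def)
      have "pterm (\<lambda>i. q * b i) (f b ^ q) c = (if b = d then f d ^ q else 0)" for b
        using True q by (auto simp: pterm_def d_def fun_eq_iff)
      then show ?thesis using True d fin by (simp add: pfrob_def d_def)
    next
      case False
      then have "pterm (\<lambda>i. q * b i) (f b ^ q) c = 0" for b
        by (auto simp: pterm_def)
      then show ?thesis using False by (auto simp: pfrob_def)
    qed
    finally show "(f [^]\<^bsub>mvps_ring n\<^esub> q) c = pfrob q f c" .
  qed
qed

section \<open>Leading exponents and standard bases\<close>

text \<open>Exponents are compared through \<open>\<Prod> p\<^sub>i\<^bsup>a\<^sub>i\<^esup>\<close>, with \<open>p\<^sub>i\<close> the \<open>i\<close>-th prime: a monomial order of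
  type \<open>\<omega>\<close>, so that recursion and induction along it are those on natural numbers.\<close>

definition ev :: "nat \<Rightarrow> (nat \<Rightarrow> nat) \<Rightarrow> nat" where
  "ev n a = (\<Prod>i<n. enumerate {p. Factorial_Ring.prime p} i ^ a i)"

lemma prime_enumerate: "Factorial_Ring.prime (enumerate {p :: nat. Factorial_Ring.prime p} i)"
  using enumerate_in_set[OF primes_infinite] by auto

lemma ev_pos: "ev n a > 0"
  unfolding ev_def by (intro prod_pos) (simp add: prime_gt_0_nat prime_enumerate)

lemma ev_add: "ev n (a + b) = ev n a * ev n b"
  by (simp add: ev_def power_add prod.distrib)

text \<open>Unique factorization gives back the exponents, which makes \<open>ev\<close> injective
  on \<open>exps n\<close>.\<close>

lemma multiplicity_ev:
  assumes "i < n"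
  shows "multiplicity (enumerate {p. Factorial_Ring.prime p} i) (ev n a) = a i"
proof -
  let ?P = "enumerate {p :: nat. Factorial_Ring.prime p}"
  have inj: "inj ?P"
    using strict_mono_enumerate[OF primes_infinite] by (simp add: strict_mono_imp_inj_on)
  have "ev n a = (\<Prod>p\<in>?P ` {..<n}. p ^ a (inv_into UNIV ?P p))"
    unfolding ev_def by (subst prod.reindex) (auto intro: inj_on_subset[OF inj] simp: inv_f_f[OF inj])
  also have "multiplicity (?P i) \<dots> = (if ?P i \<in> ?P ` {..<n} then a (inv_into UNIV ?P (?P i)) else 0)"
    by (intro multiplicity_prod_prime_powers) (auto simp: prime_enumerate)
  finally show ?thesis using assms by (simp add: inv_f_f[OF inj])
qed

lemma ev_inj:
  assumes "a \<in> exps n" "b \<in> exps n" "ev n a = ev n b"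
  shows "a = b"
proof
  fix i show "a i = b i"
    using assms multiplicity_ev[of i n a] multiplicity_ev[of i n b] by (cases "i < n") (auto simp: exps_def)
qed

lemma finite_ev_less: "finite {a \<in> exps n. ev n a < K}"
  by (rule inj_on_finite[of "ev n" _ "{..<K}"]) (auto intro!: inj_onI ev_inj)

lemma ev_mono: "a \<le> b \<Longrightarrow> ev n a \<le> ev n b"
  using ev_add[of n a "b - a"] ev_pos[of n "b - a"] add_eq_iff_le_diff[of a "b - a" b] by auto

section \<open>Dickson's lemma\<close>

text \<open>A monotone subsequence is extracted one coordinate at a time. A nonincreasing sequence
  of naturals is constant once it reaches its least value, so after a shift it counts as
  nondecreasing.\<close>

lemma dickson_sequence:
  fixes f :: "nat \<Rightarrow> nat \<Rightarrow> nat"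
  assumes "\<And>k. f k \<in> exps n"
  shows "\<exists>r. strict_mono (r :: nat \<Rightarrow> nat) \<and> (\<forall>i. mono (\<lambda>k. f (r k) i))"
proof -
  have "\<exists>r. strict_mono (r :: nat \<Rightarrow> nat) \<and> (\<forall>i<m. mono (\<lambda>k. f (r k) i))" for m
  proof (induction m)
    case 0
    then show ?case by (auto intro!: exI[of _ id] simp: strict_mono_def)
  next
    case (Suc m)
    then obtain r :: "nat \<Rightarrow> nat" where r: "strict_mono r" "\<And>i. i < m \<Longrightarrow> mono (\<lambda>k. f (r k) i)" by blast
    obtain g :: "nat \<Rightarrow> nat" where g: "strict_mono g" "monoseq (\<lambda>k. f (r (g k)) m)"
      using seq_monosub[of "\<lambda>k. f (r k) m"] by auto
    have "\<exists>h. strict_mono (h :: nat \<Rightarrow> nat) \<and> mono (\<lambda>k. f (r (g (h k))) m)"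
      using g(2) unfolding monoseq_def
    proof
      assume "\<forall>a. \<forall>b\<ge>a. f (r (g a)) m \<le> f (r (g b)) m"
      then show ?thesis by (intro exI[of _ id]) (auto simp: strict_mono_def mono_def)
    next
      assume dec: "\<forall>a. \<forall>b\<ge>a. f (r (g b)) m \<le> f (r (g a)) m"
      define v where "v = (LEAST x. x \<in> range (\<lambda>k. f (r (g k)) m))"
      have "v \<in> range (\<lambda>k. f (r (g k)) m)" unfolding v_def by (rule LeastI) auto
      then obtain k0 where k0: "v = f (r (g k0)) m" by auto
      have "f (r (g k)) m = v" if "k \<ge> k0" for k
      proof (rule antisym)
        show "f (r (g k)) m \<le> v" using dec that k0 by auto
        show "v \<le> f (r (g k)) m" unfolding v_def by (rule Least_le) auto
      qed
      then show ?thesis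
        by (intro exI[of _ "\<lambda>k. k + k0"]) (auto simp: strict_mono_def mono_def)
    qed
    then obtain h :: "nat \<Rightarrow> nat" where h: "strict_mono h" "mono (\<lambda>k. f (r (g (h k))) m)" by blast
    have "mono (\<lambda>k. f (r (g (h k))) i)" if "i < m" for i
    proof (rule monoI)
      fix x y :: nat assume "x \<le> y"
      then have "g (h x) \<le> g (h y)" using g(1) h(1) by (simp add: strict_mono_less_eq)
      then show "f (r (g (h x))) i \<le> f (r (g (h y))) i" using r(2)[OF that] by (simp add: mono_def)
    qed
    then have "strict_mono (\<lambda>k. r (g (h k))) \<and> (\<forall>i<Suc m. mono (\<lambda>k. f (r (g (h k))) i))"
      using r(1) g(1) h by (auto simp: strict_mono_def less_Suc_eq)
    then show ?case by blast
  qed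
  from this[of n] obtain r :: "nat \<Rightarrow> nat" where r: "strict_mono r" "\<And>i. i < n \<Longrightarrow> mono (\<lambda>k. f (r k) i)" by blast
  have "mono (\<lambda>k. f (r k) i)" if "\<not> i < n" for i
    using assms that by (auto simp: exps_def mono_def)
  with r show ?thesis by blast
qed

text \<open>Minimal elements suffice, as descent along \<open>ev\<close> ends in one. An infinite
  set of them would contain a sequence with a nondecreasing subsequence, hence two distinct
  comparable elements.\<close>

lemma dickson:
  assumes "L \<subseteq> exps n"
  shows "\<exists>L0. finite L0 \<and> L0 \<subseteq> L \<and> (\<forall>a\<in>L. \<exists>l\<in>L0. l \<le> a)"
proof -
  define M where "M = {a \<in> L. \<forall>b\<in>L. b \<le> a \<longrightarrow> b = a}"
  have "\<exists>l\<in>M. l \<le> a" if "a \<in> L" for a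
    using that
  proof (induction "ev n a" arbitrary: a rule: less_induct)
    case less
    show ?case
    proof (cases "a \<in> M")
      case False
      then obtain b where b: "b \<in> L" "b \<le> a" "b \<noteq> a" using less.prems by (auto simp: M_def)
      have "ev n b \<noteq> ev n a" using ev_inj b less.prems assms by blast
      with ev_mono[OF b(2)] have "ev n b < ev n a" by (simp add: le_neq_implies_less)
      then show ?thesis using less.hyps[of b] b by (meson order_trans)
    qed auto
  qed
  moreover have "finite M"
  proof (rule ccontr)
    assume "infinite M"
    then obtain f :: "nat \<Rightarrow> nat \<Rightarrow> nat" where f: "inj f" "range f \<subseteq> M"
      using infinite_countable_subset by blast
    have "f k \<in> exps n" for k using f(2) assms by (auto simp: M_def)
    then obtain r :: "nat \<Rightarrow> nat" where r: "strict_mono r" "\<And>i. mono (\<lambda>k. f (r k) i)"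
      using dickson_sequence[of f n] by blast
    have "f (r 0) \<le> f (r 1)" using r(2) by (auto simp: le_fun_def mono_def)
    then have "f (r 0) = f (r 1)" using f(2) unfolding M_def by blast
    then have "r 0 = r 1" using f(1) by (simp add: inj_eq)
    then show False using r(1) by (simp add: strict_mono_eq)
  qed
  ultimately show ?thesis by (intro exI[of _ M]) (auto simp: M_def)
qed

text \<open>\<open>least_exp\<close> is the leading exponent in the sense of standard bases.\<close>

definition least_exp :: "nat \<Rightarrow> 'k::zero mvps \<Rightarrow> nat \<Rightarrow> nat" where
  "least_exp n f = (ARG_MIN (ev n) a. f a \<noteq> 0)"

lemma least_exp:
  assumes "f a \<noteq> 0"
  shows "f (least_exp n f) \<noteq> 0" "ev n (least_exp n f) \<le> ev n a"
  unfolding least_exp_def using arg_min_nat_lemma[of "\<lambda>a. f a \<noteq> 0" a "ev n"] assms by auto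

text \<open>The cut-off to smaller \<open>ev\<close> is written into the equation, so it is solvable
  for every \<open>G\<close>; division finds its quotients by such an equation.\<close>

lemma wf_recursion_ev: "\<exists>c. \<forall>a. c a = G a (\<lambda>a'. if ev n a' < ev n a then c a' else 0)"
  for G :: "(nat \<Rightarrow> nat) \<Rightarrow> ((nat \<Rightarrow> nat) \<Rightarrow> 'k::zero) \<Rightarrow> 'k"
proof -
  define H where "H = (\<lambda>c a. G a (\<lambda>a'. if ev n a' < ev n a then c a' else 0))"
  define c where "c = wfrec (measure (ev n)) H"
  have "c a = H (cut c (measure (ev n)) a) a" for a
    unfolding c_def by (rule wfrec) simp
  also have "H (cut c (measure (ev n)) a) a = G a (\<lambda>a'. if ev n a' < ev n a then c a' else 0)" for a
    unfolding H_def by (rule arg_cong[of _ _ "G a"]) (auto simp: cut_def fun_eq_iff)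
  finally show ?thesis by blast
qed

section \<open>Ideals of power series and their standard bases\<close>

locale ps_ideal =
  fixes n :: nat and A :: "'k::field mvps set"
  assumes ideal: "ideal A (mvps_ring n)"
begin

lemma A_pser: "A \<subseteq> pser n"
  using additive_subgroup.a_subset[OF ideal.axioms(1)[OF ideal]] by (simp add: mvps_ring_simps)

lemma A_zero: "0 \<in> A"
  using additive_subgroup.zero_closed[OF ideal.axioms(1)[OF ideal]] by (simp add: mvps_ring_simps)

lemma A_add: "f \<in> A \<Longrightarrow> g \<in> A \<Longrightarrow> f + g \<in> A"
  using additive_subgroup.a_closed[OF ideal.axioms(1)[OF ideal], of f g] by (simp add: mvps_ring_simps)

lemma A_mult: "f \<in> A \<Longrightarrow> g \<in> pser n \<Longrightarrow> pmul g f \<in> A"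
  using ideal.I_l_closed[OF ideal, of f g] by (simp add: mvps_ring_simps)

lemma A_scale: "f \<in> A \<Longrightarrow> (\<lambda>a. c * f a) \<in> A"
proof -
  assume f: "f \<in> A"
  have "pmul (pterm 0 c) f = (\<lambda>a. c * f a)"
  proof
    fix a show "pmul (pterm 0 c) f a = c * f a"
    proof (cases "a \<in> exps n")
      case False
      then have "pmul (pterm 0 c) f a = 0" "f a = 0"
        using pser_pmul[OF pser_pterm[OF zero_in_exps], of f n c] f A_pser by (auto simp: pser_def)
      then show ?thesis by simp
    qed (auto simp: pmul_pterm le_fun_def fun_diff_def)
  qed
  with A_mult[OF f pser_pterm[OF zero_in_exps]] show ?thesis by metis
qed

lemma A_diff: "f \<in> A \<Longrightarrow> g \<in> A \<Longrightarrow> f - g \<in> A"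
  using A_add[OF _ A_scale[of g "-1"]] by (simp add: fun_diff_def plus_fun_def)

lemma A_sum: "finite W \<Longrightarrow> (\<And>x. x \<in> W \<Longrightarrow> h x \<in> A) \<Longrightarrow> (\<Sum>x\<in>W. h x) \<in> A"
  by (induction W rule: finite_induct) (auto simp: A_zero A_add)

definition lead :: "(nat \<Rightarrow> nat) set" where
  "lead = least_exp n ` (A - {0})"

lemma lead_exps: "lead \<subseteq> exps n"
proof
  fix a assume "a \<in> lead"
  then obtain f where f: "f \<in> A" "f \<noteq> 0" "a = least_exp n f" by (auto simp: lead_def)
  from f(2) obtain b where "f b \<noteq> 0" by (auto simp: fun_eq_iff)
  from least_exp(1)[of f b n, OF this] f A_pser show "a \<in> exps n" by (auto simp: pser_def)
qed

lemma lead_elem: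
  assumes "a \<in> lead"
  shows "\<exists>f\<in>A. f a = 1 \<and> (\<forall>b. f b \<noteq> 0 \<longrightarrow> b = a \<or> ev n a < ev n b)"
proof -
  obtain f where f: "f \<in> A" "f \<noteq> 0" "a = least_exp n f" using assms by (auto simp: lead_def)
  from f(2) obtain b where b: "f b \<noteq> 0" by (auto simp: fun_eq_iff)
  have a: "f a \<noteq> 0" using least_exp(1)[of f b n, OF b] f by simp
  let ?g = "\<lambda>b. inverse (f a) * f b"
  have "ev n a < ev n b" if "?g b \<noteq> 0" "b \<noteq> a" for b
  proof -
    have "ev n a \<le> ev n b" using least_exp(2)[of f b n] that f by simp
    moreover have "ev n a \<noteq> ev n b" using ev_inj[of a n b] that A_pser f a by (auto simp: pser_def)
    ultimately show ?thesis by simp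
  qed
  with a show ?thesis by (intro bexI[of _ ?g] A_scale f) auto
qed

text \<open>Division by a standard basis. The quotients are found coefficient by coefficient in the
  order of \<open>ev\<close>; the remainder has no leading exponent left, so it is zero if it lies in the ideal.\<close>

lemma division:
  "\<exists>L F. finite L \<and> L \<subseteq> lead \<and> F ` L \<subseteq> A \<and>
     (\<forall>f\<in>pser n. \<forall>K. (\<forall>a. ev n a < K \<longrightarrow> f a = 0) \<longrightarrow>
       (\<exists>g. (\<forall>l. g l \<in> pser n) \<and> (\<forall>b\<in>lead. f b = (\<Sum>l\<in>L. pmul (g l) (F l)) b) \<and>
         (\<forall>l\<in>L. \<forall>b. g l b \<noteq> 0 \<longrightarrow> K \<le> ev n b * ev n l)))"
proof -
  obtain L where L: "finite L" "L \<subseteq> lead" "\<And>a. a \<in> lead \<Longrightarrow> \<exists>l\<in>L. l \<le> a"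
    using dickson[OF lead_exps] by blast
  have "\<forall>l\<in>L. \<exists>f. f \<in> A \<and> f l = 1 \<and> (\<forall>b. f b \<noteq> 0 \<longrightarrow> b = l \<or> ev n l < ev n b)"
    using lead_elem L(2) by blast
  from bchoice[OF this] obtain F where F: "\<And>l. l \<in> L \<Longrightarrow> F l \<in> A" "\<And>l. l \<in> L \<Longrightarrow> F l l = 1"
     "\<And>l b. l \<in> L \<Longrightarrow> F l b \<noteq> 0 \<Longrightarrow> b = l \<or> ev n l < ev n b" by blast
  obtain J where J: "\<And>a. a \<in> lead \<Longrightarrow> J a \<in> L" "\<And>a. a \<in> lead \<Longrightarrow> J a \<le> a"
    using L(3) by metis
  \<comment> \<open>\<open>e a b\<close> is the coefficient at \<open>b\<close> of the basis element
    for \<open>J a\<close>, shifted by \<open>a - J a\<close> so as to lead at \<open>a\<close>;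
    moving \<open>J a\<close> to the other side spares a nested truncated difference.\<close>
  define e where "e = (\<lambda>a b. if a \<le> b + J a then F (J a) (b + J a - a) else 0)"
  have e_eq: "e a b = pmul (pterm (a - J a) 1) (F (J a)) b" if "a \<in> lead" "b \<in> exps n" for a b
  proof -
    have "J a i \<le> a i" for i using J(2)[OF that(1)] by (simp add: le_fun_def)
    then have "a - J a \<le> b \<longleftrightarrow> a \<le> b + J a" "b - (a - J a) = b + J a - a"
      by (auto simp: le_fun_def fun_eq_iff le_diff_conv)
    then show ?thesis using that by (simp add: pmul_pterm e_def)
  qed
  show ?thesis
  proof (rule exI[of _ L], rule exI[of _ F], intro conjI ballI allI impI)
    show "finite L" "L \<subseteq> lead" "F ` L \<subseteq> A" using L F by auto
    fix f :: "'k mvps" and K assume f: "f \<in> pser n" and K: "\<forall>a. ev n a < K \<longrightarrow> f a = 0"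
    define W where "W = (\<lambda>a. {a' \<in> lead. ev n a' < ev n a})"
    have finX: "finite (W a)" for a
      using lead_exps by (intro finite_subset[OF _ finite_ev_less[of n "ev n a"]]) (auto simp: W_def)
    \<comment> \<open>A triangular system: \<open>e a a = 1\<close>, and another \<open>a'\<close>
      contributes at \<open>a\<close> only if \<open>ev n a' < ev n a\<close>, so \<open>c a\<close>
      is what the smaller exponents leave of \<open>f a\<close>.\<close>
    obtain c where c: "\<And>a. c a = (if a \<in> lead then f a -
        (\<Sum>a'\<in>W a. (if ev n a' < ev n a then c a' else 0) * e a' a) else 0)"
      using wf_recursion_ev[of "\<lambda>a c. if a \<in> lead then f a - (\<Sum>a'\<in>W a. c a' * e a' a) else 0" n] by blast
    have c1: "c a = f a - (\<Sum>a'\<in>W a. c a' * e a' a)" if "a \<in> lead" for a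
      by (subst c) (auto simp: that W_def intro!: sum.cong)
    have c0: "c a = 0" if "a \<notin> lead" for a
      by (subst c) (simp add: that)
    have cK: "c a = 0" if "ev n a < K" for a
      using that
    proof (induction "ev n a" arbitrary: a rule: less_induct)
      case less
      then show ?case using c1[of a] c0[of a] K
        by (cases "a \<in> lead") (auto simp: W_def intro!: sum.neutral)
    qed
    \<comment> \<open>The coefficients \<open>c a\<close> sorted by the basis element
      \<open>J a\<close> that they multiply.\<close>
    define g where "g = (\<lambda>l b. if b + l \<in> lead \<and> J (b + l) = l then c (b + l) else 0)"
    have g: "g l \<in> pser n" for l
      using lead_exps by (auto simp: g_def pser_def exps_add)
    have gF: "pmul (g l) (F l) b = (\<Sum>a\<in>{a \<in> lead. ev n a \<le> ev n b \<and> J a = l}. c a * e a b)"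
      if "b \<in> exps n" "l \<in> L" for l b
    proof -
      have fin: "finite {a \<in> lead. ev n a \<le> ev n b \<and> J a = l}"
        using lead_exps by (intro finite_subset[OF _ finite_ev_less[of n "Suc (ev n b)"]]) auto
      have *: "l \<le> a" if "a \<in> lead" "J a = l" for a using J(2) that by auto
      have "pmul (g l) (F l) b = (\<Sum>x\<in>{x. x \<le> b}. g l x * F l (b - x))" by (simp add: pmul_def)
      \<comment> \<open>Terms with \<open>ev n (x + l) > ev n b\<close> vanish because
        \<open>F l\<close> has no term before \<open>l\<close> in the order of
        \<open>ev\<close>.\<close>
      also have "\<dots> = (\<Sum>x\<in>{x. x \<le> b \<and> x + l \<in> lead \<and> J (x + l) = l \<and> ev n (x + l) \<le> ev n b}. g l x * F l (b - x))"
      proof (rule sum.mono_neutral_right[OF finite_le_exp[OF that(1)]]; safe)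
        fix x assume x: "x \<le> b"
        have F0: "F l (b - x) = 0" if "\<not> ev n (x + l) \<le> ev n b"
        proof (rule ccontr)
          assume "F l (b - x) \<noteq> 0"
          then have "ev n l \<le> ev n (b - x)" using F(3)[of l "b - x"] \<open>l \<in> L\<close> by auto
          moreover have "ev n b = ev n x * ev n (b - x)"
            using x ev_add[of n x "b - x"] add_eq_iff_le_diff[of x "b - x" b] by auto
          ultimately show False using that ev_pos[of n x] by (simp add: ev_add)
        qed
        assume "g l x * F l (b - x) \<noteq> 0"
        then have "g l x \<noteq> 0" "F l (b - x) \<noteq> 0" by auto
        then show "x + l \<in> lead" "J (x + l) = l" "ev n (x + l) \<le> ev n b"
          using F0 by (auto simp: g_def split: if_splits)
      qed
      also have "\<dots> = (\<Sum>a\<in>{a \<in> lead. ev n a \<le> ev n b \<and> J a = l \<and> a \<le> b + l}. c a * e a b)"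
      proof (rule sum.reindex_bij_witness[where i = "\<lambda>a. a - l" and j = "\<lambda>x. x + l"])
        fix a assume a: "a \<in> {a \<in> lead. ev n a \<le> ev n b \<and> J a = l \<and> a \<le> b + l}"
        then have la: "a - l + l = a" using * by (auto simp: le_fun_def fun_eq_iff)
        then show "a - l + l = a" .
        have "a - l \<le> b" using a by (auto simp: le_fun_def le_diff_conv)
        with a la show "a - l \<in> {x. x \<le> b \<and> x + l \<in> lead \<and> J (x + l) = l \<and> ev n (x + l) \<le> ev n b}" by simp
      next
        fix x assume x: "x \<in> {x. x \<le> b \<and> x + l \<in> lead \<and> J (x + l) = l \<and> ev n (x + l) \<le> ev n b}"
        show "x + l - l = x" by (simp add: fun_eq_iff)
        show "x + l \<in> {a \<in> lead. ev n a \<le> ev n b \<and> J a = l \<and> a \<le> b + l}"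
          using x by (auto simp: le_fun_def)
        have "b + l - (x + l) = b - x" by (simp add: fun_eq_iff)
        moreover have "x + l \<le> b + l" using x by (auto simp: le_fun_def)
        ultimately show "c (x + l) * e (x + l) b = g l x * F l (b - x)"
          using x by (simp add: g_def e_def)
      qed
      also have "\<dots> = (\<Sum>a\<in>{a \<in> lead. ev n a \<le> ev n b \<and> J a = l}. c a * e a b)"
        using fin by (intro sum.mono_neutral_left) (auto simp: e_def)
      finally show ?thesis .
    qed
    have "f b = (\<Sum>l\<in>L. pmul (g l) (F l)) b" if "b \<in> lead" for b
    proof -
      have b: "b \<in> exps n" using that lead_exps by auto
      have e1: "\<forall>l\<in>L. finite {a \<in> lead. ev n a \<le> ev n b \<and> J a = l}"
        using lead_exps by (intro ballI finite_subset[OF _ finite_ev_less[of n "Suc (ev n b)"]]) auto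
      have e2: "\<forall>l\<in>L. \<forall>l'\<in>L. l \<noteq> l' \<longrightarrow>
          {a \<in> lead. ev n a \<le> ev n b \<and> J a = l} \<inter> {a \<in> lead. ev n a \<le> ev n b \<and> J a = l'} = {}"
        by auto
      have "(\<Sum>l\<in>L. pmul (g l) (F l)) b = (\<Sum>l\<in>L. \<Sum>a\<in>{a \<in> lead. ev n a \<le> ev n b \<and> J a = l}. c a * e a b)"
        unfolding sum_fun_apply by (intro sum.cong gF b refl) auto
      also have "\<dots> = (\<Sum>a\<in>(\<Union>l\<in>L. {a \<in> lead. ev n a \<le> ev n b \<and> J a = l}). c a * e a b)"
        using e1 e2 by (intro sum.UNION_disjoint[symmetric] L(1))
      also have "(\<Union>l\<in>L. {a \<in> lead. ev n a \<le> ev n b \<and> J a = l}) = insert b (W b)"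
        using J that ev_inj[OF _ b] lead_exps by (auto simp: W_def order_le_less)
      also have "(\<Sum>a\<in>insert b (W b). c a * e a b) = c b * e b b + (\<Sum>a\<in>W b. c a * e a b)"
        using finX by (subst sum.insert) (auto simp: W_def)
      also have "e b b = 1"
      proof -
        have "b + J b - b = J b" by (simp add: fun_eq_iff)
        moreover have "b \<le> b + J b" by (simp add: le_fun_def)
        ultimately show ?thesis using F(2) J(1) that by (simp add: e_def)
      qed
      finally show ?thesis using c1[OF that] by simp
    qed
    moreover have "K \<le> ev n b * ev n l" if "l \<in> L" "g l b \<noteq> 0" for l b
      using cK[of "b + l"] that by (auto simp: g_def ev_add not_less[symmetric] split: if_splits)
    ultimately show "\<exists>g. (\<forall>l. g l \<in> pser n) \<and> (\<forall>b\<in>lead. f b = (\<Sum>l\<in>L. pmul (g l) (F l)) b) \<and>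
         (\<forall>l\<in>L. \<forall>b. g l b \<noteq> 0 \<longrightarrow> K \<le> ev n b * ev n l)"
      using g by (intro exI[of _ g]) auto
  qed
qed

lemma eq_zero_if_lead:
  assumes "f \<in> A" "\<And>b. b \<in> lead \<Longrightarrow> f b = 0"
  shows "f = 0"
proof (rule ccontr)
  assume "f \<noteq> 0"
  then obtain b where "f b \<noteq> 0" by (auto simp: fun_eq_iff)
  from least_exp(1)[of f b n, OF this] assms(2)[of "least_exp n f"] assms(1) \<open>f \<noteq> 0\<close> show False
    by (auto simp: lead_def)
qed

text \<open>The bound on \<open>g\<close> is the point: members of high order have quotients of high
  order. It later shows that a homomorphism from the ideal into the module of functionals kills
  everything of sufficiently high order.\<close>

lemma standard_basis:
  "\<exists>L F. finite L \<and> F ` L \<subseteq> A \<and>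
     (\<forall>f\<in>A. \<forall>K. (\<forall>a. ev n a < K \<longrightarrow> f a = 0) \<longrightarrow>
       (\<exists>g. (\<forall>l. g l \<in> pser n) \<and> f = (\<Sum>l\<in>L. pmul (g l) (F l)) \<and>
         (\<forall>l\<in>L. \<forall>b. g l b \<noteq> 0 \<longrightarrow> K \<le> ev n b * ev n l)))"
proof -
  obtain L F where LF: "finite L" "L \<subseteq> lead" "F ` L \<subseteq> A" and
    div: "\<forall>f\<in>pser n. \<forall>K. (\<forall>a. ev n a < K \<longrightarrow> f a = 0) \<longrightarrow>
       (\<exists>g. (\<forall>l. g l \<in> pser n) \<and> (\<forall>b\<in>lead. f b = (\<Sum>l\<in>L. pmul (g l) (F l)) b) \<and>
         (\<forall>l\<in>L. \<forall>b. g l b \<noteq> 0 \<longrightarrow> K \<le> ev n b * ev n l))"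
    using division by (elim exE conjE) (rule that)
  have "\<exists>g. (\<forall>l. g l \<in> pser n) \<and> f = (\<Sum>l\<in>L. pmul (g l) (F l)) \<and>
         (\<forall>l\<in>L. \<forall>b. g l b \<noteq> 0 \<longrightarrow> K \<le> ev n b * ev n l)"
    if f: "f \<in> A" "\<forall>a. ev n a < K \<longrightarrow> f a = 0" for f K
  proof -
    obtain g where g: "\<forall>l. g l \<in> pser n" "\<forall>b\<in>lead. f b = (\<Sum>l\<in>L. pmul (g l) (F l)) b"
        "\<forall>l\<in>L. \<forall>b. g l b \<noteq> 0 \<longrightarrow> K \<le> ev n b * ev n l"
      using div[rule_format, OF subsetD[OF A_pser f(1)], of K] f(2) by blast
    have "f - (\<Sum>l\<in>L. pmul (g l) (F l)) = 0"
      using g LF f by (intro eq_zero_if_lead A_diff A_sum A_mult) auto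
    with g show ?thesis by (intro exI[of _ g]) auto
  qed
  note main = this
  show ?thesis
    by (rule exI[of _ L], rule exI[of _ F], intro conjI ballI allI impI LF(1,3)) (rule main)
qed

text \<open>Multiplying \<open>f\<close> by monomials makes every exponent a leading one, and
  division by the standard basis then leaves no remainder. This gives locality of the ring.\<close>

lemma const_term_nonzero:
  assumes "f \<in> A" "f 0 \<noteq> 0"
  shows "A = pser n"
proof
  obtain L F where LF: "finite L" "L \<subseteq> lead" "F ` L \<subseteq> A" and
    div: "\<forall>f\<in>pser n. \<forall>K. (\<forall>a. ev n a < K \<longrightarrow> f a = 0) \<longrightarrow>
       (\<exists>g. (\<forall>l. g l \<in> pser n) \<and> (\<forall>b\<in>lead. f b = (\<Sum>l\<in>L. pmul (g l) (F l)) b) \<and>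
         (\<forall>l\<in>L. \<forall>b. g l b \<noteq> 0 \<longrightarrow> K \<le> ev n b * ev n l))"
    using division by (elim exE conjE) (rule that)
  have lead: "a \<in> lead" if a: "a \<in> exps n" for a
  proof -
    let ?h = "pmul (pterm a 1) f"
    have h: "?h \<in> A" using assms(1) a by (intro A_mult) auto
    have ha: "?h a \<noteq> 0" using a assms(2) by (simp add: pmul_pterm)
    have ne: "?h (least_exp n ?h) \<noteq> 0" using least_exp(1)[of ?h a n, OF ha] .
    then have le: "least_exp n ?h \<in> exps n" using h A_pser by (auto simp: pser_def)
    then have "a \<le> least_exp n ?h"
      using ne by (rule_tac ccontr) (simp add: pmul_pterm)
    moreover note le
    moreover have "ev n (least_exp n ?h) \<le> ev n a" by (rule least_exp(2)[of ?h, OF ha])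
    ultimately have "least_exp n ?h = a"
      using ev_mono[of a "least_exp n ?h" n] a by (intro ev_inj[of _ n]) auto
    then show ?thesis using h ha by (force simp: lead_def)
  qed
  show "pser n \<subseteq> A"
  proof
    fix h :: "'k mvps" assume h: "h \<in> pser n"
    then obtain g where g: "\<forall>l. g l \<in> pser n" "\<forall>b\<in>lead. h b = (\<Sum>l\<in>L. pmul (g l) (F l)) b"
      using div[rule_format, OF h, of 0] by auto
    have s: "(\<Sum>l\<in>L. pmul (g l) (F l)) \<in> A" using g LF by (intro A_sum A_mult) auto
    have "h = (\<Sum>l\<in>L. pmul (g l) (F l))"
    proof
      fix b show "h b = (\<Sum>l\<in>L. pmul (g l) (F l)) b"
        using h s g(2) lead[of b] A_pser by (cases "b \<in> exps n") (auto simp: pser_def)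
    qed
    with s show "h \<in> A" by simp
  qed
qed (rule A_pser)

end

section \<open>Exponents in the colon ideals\<close>

text \<open>\<open>FF\<close> plays the role of the set of minimal primes, each given by its set of variables;
  \<open>NN\<close> consists of the exponents of the monomials outside \<open>I\<close>, \<open>CC q\<close> of those in \<open>(I\<^bsup>[q]\<^esup> : I)\<close>, and
  \<open>TT q\<close> of those in \<open>(I\<^bsup>[q]\<^esup> : I)\<close> but not in \<open>I\<^bsup>[q]\<^esup>\<close>.\<close>

locale antichain =
  fixes n :: nat and FF :: "nat set set"
  assumes FF_sub: "FF \<subseteq> Pow {..<n}" and FF_ne: "FF \<noteq> {}"
    and FF_anti: "F \<in> FF \<Longrightarrow> G \<in> FF \<Longrightarrow> F \<subseteq> G \<Longrightarrow> F = G"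
begin

definition NN :: "(nat \<Rightarrow> nat) set" where
  "NN = {a \<in> exps n. \<exists>F\<in>FF. \<forall>i\<in>F. a i = 0}"

text \<open>For a prime \<open>P\<close> generated by variables, \<open>(P^[q] : P)\<close> is
  \<open>P^[q]\<close> plus the ideal of the \<open>(q-1)\<close>-st power of the product of these
  variables; the two alternatives are membership in the two summands. Incomparability of the primes
  makes \<open>(I^[q] : I)\<close> the intersection over them.\<close>

definition CC :: "nat \<Rightarrow> (nat \<Rightarrow> nat) set" where
  "CC q = {c \<in> exps n. \<forall>F\<in>FF. (\<exists>i\<in>F. q \<le> c i) \<or> (\<forall>i\<in>F. q - 1 \<le> c i)}"

definition TT :: "nat \<Rightarrow> (nat \<Rightarrow> nat) set" where
  "TT q = {c \<in> CC q. \<exists>F\<in>FF. \<forall>i\<in>F. c i < q}"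

text \<open>On the variables, \<open>- tw q a - 1 = q * (- a - 1)\<close>: this comes from the
  \<open>q\<close>-th power of the inverse monomial with exponent \<open>- a - 1\<close>.\<close>

definition tw :: "nat \<Rightarrow> (nat \<Rightarrow> nat) \<Rightarrow> nat \<Rightarrow> nat" where
  "tw q a i = (if i < n then q * a i + (q - 1) else 0)"

text \<open>The minimal monomials of \<open>(I\<^bsup>[q]\<^esup> : I)\<close> outside \<open>I\<^bsup>[q]\<^esup>\<close> have exponents in \<open>{0, q - 1, q}\<close>;
  \<open>scl q\<close> recovers them from patterns with entries \<open>0, 1, 2\<close>, which do not depend on \<open>q\<close>.\<close>

definition PP :: "(nat \<Rightarrow> nat) set" where
  "PP = {s \<in> CC 2. \<forall>i. s i \<le> 2}"

definition MS :: "(nat \<Rightarrow> nat) set" where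
  "MS = {s \<in> PP. (\<forall>t\<in>PP. t \<le> s \<longrightarrow> t = s) \<and> (\<exists>F\<in>FF. \<forall>i\<in>F. s i < 2)}"

text \<open>The pattern of \<open>(x_1 ... x_m)^(q-1)\<close>.\<close>

definition mm :: "nat \<Rightarrow> nat" where
  "mm i = (if i \<in> \<Union>FF then 1 else 0)"

definition scl :: "nat \<Rightarrow> (nat \<Rightarrow> nat) \<Rightarrow> nat \<Rightarrow> nat" where
  "scl q s i = (if s i = 0 then 0 else if s i = 1 then q - 1 else q)"

text \<open>For \<open>q \<ge> 2\<close> the largest pattern \<open>s\<close> with
  \<open>scl q s \<le> c\<close>.\<close>

definition shape :: "nat \<Rightarrow> (nat \<Rightarrow> nat) \<Rightarrow> nat \<Rightarrow> nat" where
  "shape q c i = (if q \<le> c i then 2 else if q - 1 \<le> c i then 1 else 0)"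

lemma FF_less: "F \<in> FF \<Longrightarrow> i \<in> F \<Longrightarrow> i < n"
  using FF_sub by auto

lemma NN_exps: "NN \<subseteq> exps n" and CC_exps: "CC q \<subseteq> exps n" and TT_CC: "TT q \<subseteq> CC q"
  by (auto simp: NN_def CC_def TT_def)

lemma zero_NN: "0 \<in> NN"
  using FF_ne by (auto simp: NN_def)

lemma NN_down:
  assumes "a \<in> NN" "b \<le> a"
  shows "b \<in> NN"
proof -
  from assms(1) obtain F where F: "F \<in> FF" "\<forall>i\<in>F. a i = 0" by (auto simp: NN_def)
  have "b i = 0" if "i \<in> F" for i using le_funD[OF assms(2), of i] F that by simp
  with F exps_mono[OF _ assms(2)] assms(1) show ?thesis by (auto simp: NN_def)
qed

lemma CC_up:
  assumes "c \<in> CC q" "c \<le> d" "d \<in> exps n"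
  shows "d \<in> CC q"
proof -
  have *: "k \<le> d i" if "k \<le> c i" for k i using le_funD[OF assms(2), of i] that by simp
  have "(\<exists>i\<in>F. q \<le> d i) \<or> (\<forall>i\<in>F. q - 1 \<le> d i)" if "F \<in> FF" for F
    using assms(1) that * by (simp add: CC_def) blast
  with assms(3) show ?thesis by (simp add: CC_def)
qed

text \<open>The case of degree zero: multipliers supported on \<open>NN\<close> are normal forms of
  the elements of \<open>R\<close>.\<close>

lemma TT_1: "TT 1 = NN"
  by (auto simp: TT_def CC_def NN_def)

lemma tw_exps: "tw q a \<in> exps n"
  by (auto simp: tw_def exps_def)

text \<open>\<open>x^c\<close> times the Frobenius action moves \<open>a\<close> to
  \<open>tw q a - c\<close>. Where \<open>c\<close> stays below \<open>q\<close> on a member of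
  \<open>FF\<close>, membership in \<open>CC q\<close> forces it to be \<open>q - 1\<close> there,
  so zeros of \<open>a\<close> on a member of \<open>FF\<close> survive in \<open>b\<close>. The two
  parts say that \<open>x^c\<close> acts nontrivially and that it preserves the module.\<close>

lemma TT_decompose:
  assumes q: "q > 0" and c: "c \<in> TT q"
  shows "\<exists>a\<in>NN. \<exists>b\<in>NN. c + b = tw q a"
    and "\<And>a b. a \<in> NN \<Longrightarrow> c + b = tw q a \<Longrightarrow> b \<in> NN"
proof -
  from c obtain F where F: "F \<in> FF" "\<forall>i\<in>F. c i < q" by (auto simp: TT_def)
  have cF: "c i = q - 1" if "i \<in> F'" "F' \<in> FF" "\<forall>i\<in>F'. c i < q" for i F'
    using c that by (force simp: TT_def CC_def)
  have cn: "c i = 0" if "\<not> i < n" for i using c that by (auto simp: TT_def CC_def exps_def)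
  \<comment> \<open>On \<open>F\<close> both \<open>c\<close> and \<open>tw q a\<close> are
    \<open>q - 1\<close>; elsewhere the value \<open>c i\<close> is large enough for
    \<open>c \<le> tw q a\<close>.\<close>
  define a where "a = (\<lambda>i. if i \<in> F \<or> \<not> i < n then 0 else c i)"
  have le: "c i \<le> tw q a i" for i
  proof -
    have "c i \<le> q * c i + (q - 1)" using q by (cases q) simp_all
    then show ?thesis using cF[OF _ F, of i] cn[of i] by (simp add: a_def tw_def)
  qed
  have "a \<in> NN" using F(1) by (auto simp: NN_def a_def exps_def)
  moreover have "tw q a - c \<in> NN"
    using F(1) cF[OF _ F] by (auto simp: NN_def exps_def tw_def a_def intro!: bexI[of _ F])
  moreover have "c + (tw q a - c) = tw q a"
    using le by (auto simp: fun_eq_iff)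
  ultimately show "\<exists>a\<in>NN. \<exists>b\<in>NN. c + b = tw q a" by blast
  fix a b assume a: "a \<in> NN" and eq: "c + b = tw q a"
  from a obtain G where G: "G \<in> FF" "\<forall>i\<in>G. a i = 0" by (auto simp: NN_def)
  have eqi: "c i + b i = tw q a i" for i using eq by (auto simp: fun_eq_iff)
  have "c i < q" if "i \<in> G" for i
    using eqi[of i] G that FF_less[of G i] q by (auto simp: tw_def)
  then have "c i = q - 1" if "i \<in> G" for i using cF[of i G] that G by auto
  then have "b i = 0" if "i \<in> G" for i
    using eqi[of i] G that FF_less[of G i] by (auto simp: tw_def)
  moreover have "b \<in> exps n" using tw_exps[of q a] eq by (metis exps_add)
  ultimately show "b \<in> NN" using G by (auto simp: NN_def)
qed

text \<open>Converse of the preceding lemma. If the condition failed at \<open>G\<close>, the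
  exponent \<open>a'\<close> that vanishes on \<open>G\<close> and is positive at the other
  variables would be moved to one that is positive off \<open>G\<close> and at some
  \<open>j \<in> G\<close>. Its zeros contain no member of \<open>FF\<close>, since such a member
  would be a proper subset of \<open>G\<close>.\<close>

lemma TT_I:
  assumes q: "q > 0" and ab: "a \<in> NN" "c + b = tw q a"
    and all: "\<And>a b. a \<in> NN \<Longrightarrow> c + b = tw q a \<Longrightarrow> b \<in> NN"
  shows "c \<in> TT q"
proof -
  have cx: "c \<in> exps n" using tw_exps[of q a] ab by (metis exps_add)
  from ab obtain F where F: "F \<in> FF" "\<forall>i\<in>F. a i = 0" by (auto simp: NN_def)
  have eqi: "c i + b i = tw q a i" for i using ab(2) by (auto simp: fun_eq_iff)
  have less: "c i < q" if "i \<in> F" for i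
    using eqi[of i] F that FF_less[of F i] q by (auto simp: tw_def)
  have "(\<exists>i\<in>G. q \<le> c i) \<or> (\<forall>i\<in>G. q - 1 \<le> c i)" if G: "G \<in> FF" for G
  proof (rule disjCI, rule ccontr)
    assume "\<not> (\<forall>i\<in>G. q - 1 \<le> c i)"
    then obtain j where j: "j \<in> G" "c j < q - 1" by auto
    assume small: "\<not> (\<exists>i\<in>G. q \<le> c i)"
    define a' where "a' = (\<lambda>i. if i \<in> G \<or> \<not> i < n then 0 else Suc (c i))"
    have cn: "c i = 0" if "\<not> i < n" for i using cx that by (auto simp: exps_def)
    have less: "c i \<le> tw q a' i" for i
    proof -
      have "c i \<le> q * c i + (q + (q - 1))" using q by (cases q) simp_all
      moreover have "c i \<le> q - 1" if "i \<in> G" using small that q by fastforce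
      ultimately show ?thesis using cn[of i] by (simp add: tw_def a'_def algebra_simps)
    qed
    have a': "a' \<in> NN" using G by (auto simp: NN_def a'_def exps_def)
    have "c + (tw q a' - c) = tw q a'" using less by (auto simp: fun_eq_iff)
    from all[OF a' this] obtain H where H: "H \<in> FF" "\<And>i. i \<in> H \<Longrightarrow> tw q a' i - c i = 0"
      by (auto simp: NN_def)
    have pos: "c i < tw q a' i" if "i < n" "i \<notin> G" for i
    proof -
      have "c i < q * Suc (c i)" using q by (cases q) simp_all
      then show ?thesis using that by (simp add: tw_def a'_def)
    qed
    have "H \<subseteq> G" using H pos FF_less by fastforce
    with H G have "H = G" using FF_anti by blast
    with H(2)[of j] j less[of j] FF_less[OF G j(1)] show False by (auto simp: tw_def a'_def)
  qed
  with cx F less show ?thesis unfolding TT_def CC_def by blast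
qed

section \<open>Minimal patterns\<close>

lemma finite_PP: "finite PP"
proof (rule finite_subset)
  show "PP \<subseteq> {f. \<forall>i. (i \<in> {..<n} \<longrightarrow> f i \<in> {..2}) \<and> (i \<notin> {..<n} \<longrightarrow> f i = 0)}"
    by (auto simp: PP_def CC_def exps_def)
qed (rule finite_set_of_finite_funs; simp)

lemma finite_MS: "finite MS"
  by (rule finite_subset[OF _ finite_PP]) (auto simp: MS_def)

lemma mm_PP: "mm \<in> PP"
  using FF_less by (auto simp: PP_def CC_def mm_def exps_def not_less[symmetric])

text \<open>Below \<open>mm\<close> no entry reaches \<open>2\<close>, so every member of
  \<open>FF\<close> must satisfy the second alternative of \<open>CC 2\<close>, and this forces
  \<open>mm\<close> itself.\<close>

lemma mm_MS: "mm \<in> MS"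
proof -
  have "t = mm" if t: "t \<in> PP" "t \<le> mm" for t
  proof
    fix i
    have le: "t i \<le> mm i" for i using t by (simp add: le_fun_def)
    have le1: "t i \<le> 1" for i using le_funD[OF t(2), of i] by (simp add: mm_def split: if_splits)
    show "t i = mm i"
    proof (cases "i \<in> \<Union>FF")
      case True
      then obtain F where F: "F \<in> FF" "i \<in> F" by auto
      have "\<not> (\<exists>i\<in>F. 2 \<le> t i)" using le1 by (metis not_less_eq_eq numeral_2_eq_2 One_nat_def)
      then have "1 \<le> t i" using t F by (auto simp: PP_def CC_def)
      with le1[of i] True show ?thesis by (simp add: mm_def)
    qed (use le[of i] in \<open>auto simp: mm_def\<close>)
  qed
  with mm_PP FF_ne show ?thesis by (auto simp: MS_def mm_def)
qed

text \<open>For \<open>q = 1\<close> the entries \<open>0\<close> and \<open>q - 1\<close> would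
  collapse.\<close>

lemma scl_le_iff:
  assumes "q \<ge> 2" "\<forall>i. s i \<le> 2" "\<forall>i. t i \<le> 2"
  shows "scl q s \<le> scl q t \<longleftrightarrow> s \<le> t"
proof -
  have "scl q s i \<le> scl q t i \<longleftrightarrow> s i \<le> t i" for i
  proof -
    have "s i = 0 \<or> s i = 1 \<or> s i = 2" "t i = 0 \<or> t i = 1 \<or> t i = 2"
      using assms(2,3)[rule_format, of i] by auto
    then show ?thesis using assms(1) by (auto simp: scl_def)
  qed
  then show ?thesis by (simp add: le_fun_def)
qed

lemma scl_inj:
  assumes "q \<ge> 2"
  shows "inj_on (scl q) PP"
proof (rule inj_onI)
  fix s t assume "s \<in> PP" "t \<in> PP" "scl q s = scl q t"
  then show "s = t"
    using scl_le_iff[OF assms, of s t] scl_le_iff[OF assms, of t s] by (auto simp: PP_def)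
qed

lemma scl_exps: "s \<in> exps n \<Longrightarrow> scl q s \<in> exps n"
  by (auto simp: exps_def scl_def)

lemma scl_CC:
  assumes "q \<ge> 2" "s \<in> PP"
  shows "scl q s \<in> CC q"
proof -
  have s2: "s i = 0 \<or> s i = 1 \<or> s i = 2" for i
  proof -
    have "s i \<le> 2" using assms(2) by (auto simp: PP_def)
    then show ?thesis by auto
  qed
  have "(\<exists>i\<in>F. q \<le> scl q s i) \<or> (\<forall>i\<in>F. q - 1 \<le> scl q s i)" if "F \<in> FF" for F
  proof -
    have "(\<exists>i\<in>F. 2 \<le> s i) \<or> (\<forall>i\<in>F. 1 \<le> s i)" using assms(2) that by (auto simp: PP_def CC_def)
    then show ?thesis
    proof
      assume "\<exists>i\<in>F. 2 \<le> s i"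
      then obtain i where "i \<in> F" "2 \<le> s i" by blast
      then show ?thesis by (intro disjI1 bexI[of _ i]) (auto simp: scl_def)
    next
      assume "\<forall>i\<in>F. 1 \<le> s i"
      then show ?thesis by (auto simp: scl_def intro!: disjI2)
    qed
  qed
  then show ?thesis using assms(2) scl_exps by (auto simp: CC_def PP_def)
qed

text \<open>\<open>CC q\<close> only compares entries with \<open>q - 1\<close> and
  \<open>q\<close>, so it depends on the shape alone.\<close>

lemma shape_PP:
  assumes "q \<ge> 2" "c \<in> CC q"
  shows "shape q c \<in> PP" "scl q (shape q c) \<le> c"
proof -
  have "(\<exists>i\<in>F. 2 \<le> shape q c i) \<or> (\<forall>i\<in>F. 1 \<le> shape q c i)" if "F \<in> FF" for F
  proof -
    have "(\<exists>i\<in>F. q \<le> c i) \<or> (\<forall>i\<in>F. q - 1 \<le> c i)" using assms(2) that by (auto simp: CC_def)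
    then show ?thesis
    proof
      assume "\<exists>i\<in>F. q \<le> c i"
      then show ?thesis by (auto simp: shape_def intro!: disjI1)
    next
      assume "\<forall>i\<in>F. q - 1 \<le> c i"
      then show ?thesis by (auto simp: shape_def intro!: disjI2)
    qed
  qed
  then show "shape q c \<in> PP"
    using assms by (auto simp: PP_def CC_def exps_def shape_def)
  show "scl q (shape q c) \<le> c" by (auto simp: le_fun_def scl_def shape_def)
qed

lemma scl_MS_minimal:
  assumes "q \<ge> 2" "s \<in> MS" "c \<in> CC q" "c \<le> scl q s"
  shows "c = scl q s"
proof -
  note sh = shape_PP[OF assms(1,3)]
  have "scl q (shape q c) \<le> scl q s" using sh(2) assms(4) by (rule order_trans)
  then have "shape q c \<le> s" using scl_le_iff[OF assms(1)] sh(1) assms(2) by (auto simp: PP_def MS_def)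
  then have "shape q c = s" using assms(2) sh(1) by (auto simp: MS_def)
  with sh(2) assms(4) show ?thesis by (intro antisym) auto
qed

lemma scl_MS_TT:
  assumes "q \<ge> 2" "s \<in> MS"
  shows "scl q s \<in> TT q"
proof -
  obtain F where F: "F \<in> FF" "\<forall>i\<in>F. s i < 2" using assms by (auto simp: MS_def)
  then have "\<forall>i\<in>F. scl q s i < q" using assms(1) by (auto simp: scl_def less_2_cases_iff)
  then show ?thesis using scl_CC[OF assms(1), of s] F assms(2) by (auto simp: TT_def MS_def)
qed

lemma TT_ge_MS:
  assumes "q \<ge> 2" "c \<in> TT q"
  shows "\<exists>s\<in>MS. scl q s \<le> c"
proof -
  have cc: "c \<in> CC q" using assms TT_CC by auto
  note sh = shape_PP[OF assms(1) cc]
  from finite_has_minimal2[OF finite_PP sh(1)]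
  obtain s where "s \<in> PP" "s \<le> shape q c" "\<forall>t\<in>PP. t \<le> s \<longrightarrow> s = t" by (elim bexE conjE)
  then have s: "s \<in> PP" "s \<le> shape q c" "\<forall>t\<in>PP. t \<le> s \<longrightarrow> t = s" by auto
  have "scl q s \<le> scl q (shape q c)"
    using s sh scl_le_iff[OF assms(1)] by (auto simp: PP_def)
  with sh(2) have le: "scl q s \<le> c" by (rule order_trans[rotated])
  obtain F where F: "F \<in> FF" "\<forall>i\<in>F. c i < q" using assms(2) by (auto simp: TT_def)
  have "s i < 2" if "i \<in> F" for i
  proof -
    have "scl q s i < q" using le_funD[OF le, of i] F(2) that by fastforce
    then show ?thesis by (auto simp: scl_def split: if_splits)
  qed
  with s F(1) have "s \<in> MS" unfolding MS_def by auto
  with le show ?thesis by (intro bexI[of _ s])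
qed

text \<open>On an \<open>F\<close> where \<open>c\<close> stays below \<open>q\<close>, both
  \<open>c\<close> and \<open>scl q s\<close> are forced to be \<open>q - 1\<close>. Hence the
  cofactor of a generator is again a normal form of degree zero.\<close>

lemma TT_diff_scl:
  assumes "q \<ge> 2" "c \<in> TT q" "s \<in> PP" "scl q s \<le> c"
  shows "c - scl q s \<in> NN"
proof -
  obtain F where F: "F \<in> FF" "\<forall>i\<in>F. c i < q" using assms(2) by (auto simp: TT_def)
  have le: "scl q s i \<le> c i" for i using assms(4) by (rule le_funD)
  have "(\<exists>i\<in>F. q \<le> scl q s i) \<or> (\<forall>i\<in>F. q - 1 \<le> scl q s i)"
    using scl_CC[OF assms(1,3)] F(1) by (simp add: CC_def)
  moreover have "\<not> q \<le> scl q s i" if "i \<in> F" for i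
    using le[of i] bspec[OF F(2) that] by linarith
  ultimately have *: "\<forall>i\<in>F. q - 1 \<le> scl q s i" by auto
  have "(c - scl q s) i = 0" if "i \<in> F" for i
    using bspec[OF * that] bspec[OF F(2) that] by simp
  moreover have "c - scl q s \<in> exps n"
  proof (rule exps_mono)
    show "c \<in> exps n" using assms(2) TT_CC CC_exps by blast
  qed (simp add: le_fun_def)
  ultimately show ?thesis unfolding NN_def using F(1) by blast
qed

text \<open>The left side is the exponent of a product: the second factor passes the Frobenius
  action of the first and is raised to the power \<open>qa\<close>.\<close>

lemma scl_not_product:
  assumes q: "qa \<ge> 2" "qb \<ge> 2" and uv: "u \<in> CC qa" "v \<in> CC qb" and s: "s \<in> MS" "s \<noteq> mm"
  shows "u + (\<lambda>i. qa * v i) \<noteq> scl (qa * qb) s"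
proof
  assume eq: "u + (\<lambda>i. qa * v i) = scl (qa * qb) s"
  have eqi: "u i + qa * v i = scl (qa * qb) s i" for i using eq by (auto simp: fun_eq_iff)
  have sP: "s \<in> PP" using s by (auto simp: MS_def)
  have q4: "qa * qb \<ge> 2" using mult_le_mono[OF q] by linarith
  note sh = shape_PP[OF q(2) uv(2)]
  \<comment> \<open>A positive entry of \<open>v\<close> makes the entry of \<open>s\<close>
    nonzero, and an entry of at least \<open>qb\<close> makes it \<open>2\<close>. So the pattern of
    \<open>v\<close> lies below \<open>s\<close> and equals it by minimality.\<close>
  have "scl (qa * qb) (shape qb v) i \<le> scl (qa * qb) s i" for i
  proof -
    consider "qb \<le> v i" | "v i < qb" "qb - 1 \<le> v i" | "v i < qb - 1" by linarith
    then show ?thesis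
    proof cases
      case 1
      then have "qa * qb \<le> scl (qa * qb) s i" using eqi[of i] mult_le_mono2[OF 1, of qa] by linarith
      moreover have "scl (qa * qb) (shape qb v) i \<le> qa * qb" by (simp add: scl_def)
      ultimately show ?thesis by simp
    next
      case 2
      then have "v i > 0" using q by linarith
      then have "scl (qa * qb) s i > 0" using eqi[of i, symmetric] q by simp
      then have "qa * qb - 1 \<le> scl (qa * qb) s i" by (auto simp: scl_def split: if_splits)
      moreover have "shape qb v i = 1" using 2 by (simp add: shape_def)
      ultimately show ?thesis by (simp add: scl_def)
    qed (auto simp: scl_def shape_def)
  qed
  then have "shape qb v \<le> s"
    using scl_le_iff[OF q4, of "shape qb v" s] sh(1) sP by (auto simp: PP_def le_fun_def)
  then have sv: "shape qb v = s" using s sh(1) by (auto simp: MS_def)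
  \<comment> \<open>No room is left: \<open>qa + qa * (qb - 1)\<close> already exceeds the entry
    \<open>qa * qb - 1\<close>, and \<open>qa + qa * qb\<close> exceeds the entry
    \<open>qa * qb\<close>.\<close>
  have small: "u i < qa" for i
  proof (rule ccontr)
    assume "\<not> u i < qa"
    then have big: "qa + qa * v i \<le> scl (qa * qb) s i" using eqi[of i] by linarith
    have si: "s i = shape qb v i" by (simp add: sv)
    consider "qb \<le> v i" | "v i < qb" "qb - 1 \<le> v i" | "v i < qb - 1" by linarith
    then show False
    proof cases
      case 1
      then have "qa + qa * qb \<le> scl (qa * qb) s i" using big mult_le_mono2[OF 1, of qa] by linarith
      with q show False by (auto simp: scl_def split: if_splits)
    next
      case 2
      then have "qa * qb \<le> qa + qa * v i"
        using mult_le_mono2[of qb "Suc (v i)" qa] by simp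
      moreover have "scl (qa * qb) s i = qa * qb - 1" using si 2 by (simp add: shape_def scl_def)
      ultimately show False using big q4 by linarith
    next
      case 3
      then have "scl (qa * qb) s i = 0" using si by (simp add: shape_def scl_def)
      then show False using big q by simp
    qed
  qed
  \<comment> \<open>\<open>u\<close> now falls under the second alternative at every member of
    \<open>FF\<close>, so it is positive at all their variables.\<close>
  have "mm i \<le> s i" for i
  proof (cases "i \<in> \<Union>FF")
    case True
    then obtain F where F: "F \<in> FF" "i \<in> F" by auto
    then have "qa - 1 \<le> u i" using uv(1) small by (auto simp: CC_def not_le[symmetric])
    then have "scl (qa * qb) s i > 0" using eqi[of i] q by linarith
    then show ?thesis by (auto simp: mm_def scl_def split: if_splits)
  qed (simp add: mm_def)
  then have "mm \<le> s" by (simp add: le_fun_def)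
  with mm_PP s show False by (auto simp: MS_def)
qed

end

section \<open>Monomial ideals\<close>

text \<open>Closure under negation comes from multiplication by the constant
  \<open>- 1\<close>.\<close>

lemma ideal_mvpsI:
  assumes "W \<subseteq> pser n" "0 \<in> W" "\<And>f g. f \<in> W \<Longrightarrow> g \<in> W \<Longrightarrow> f + g \<in> W"
    "\<And>f g. f \<in> W \<Longrightarrow> g \<in> pser n \<Longrightarrow> pmul g f \<in> W"
  shows "ideal (W :: 'k::field mvps set) (mvps_ring n)"
proof -
  interpret cring "mvps_ring n :: 'k mvps ring" by (rule cring_mvps)
  show ?thesis
  proof (rule idealI)
    show "subgroup W (add_monoid (mvps_ring n))"
    proof (rule add.subgroupI)
      fix f assume f: "f \<in> W"
      then have fp: "f \<in> carrier (mvps_ring n)" using assms(1) by (auto simp: mvps_ring_simps)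
      have pm: "pterm 0 (- 1) \<in> (pser n :: 'k mvps set)" by (intro pser_pterm zero_in_exps)
      have "pmul (pterm 0 (- 1)) f + f = pmul (pterm 0 (- 1)) f + pmul (pterm 0 1) f"
        using pmul_one[of f n] fp by (simp add: mvps_ring_simps)
      also have "\<dots> = pmul (pterm 0 (- 1) + pterm 0 1) f" by (rule pmul_add_left[symmetric])
      also have "pterm 0 (- 1) + pterm 0 1 = (0 :: 'k mvps)" by (auto simp: pterm_def fun_eq_iff)
      finally have z: "pmul (pterm 0 (- 1)) f + f = 0" by (simp only: pmul_zero_left)
      have "\<ominus>\<^bsub>mvps_ring n\<^esub> f = pmul (pterm 0 (- 1)) f"
        using z fp pser_pmul[OF pm, of f] by (intro minus_equality) (auto simp: mvps_ring_simps)
      then show "\<ominus>\<^bsub>mvps_ring n\<^esub> f \<in> W"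
        using assms(4)[OF f pm] by simp
    qed (use assms in \<open>auto simp: mvps_ring_simps\<close>)
  qed (use assms in \<open>auto simp: mvps_ring_simps pmul_commute\<close>, rule ring_axioms)
qed

text \<open>Monomial ideals are exactly these sets for up-closed \<open>U\<close>, by
  \<open>monomial_ideal_iff\<close>; sums, colons and bracket powers thereby become operations on
  sets of exponents.\<close>

definition MI :: "nat \<Rightarrow> (nat \<Rightarrow> nat) set \<Rightarrow> 'k::field mvps set" where
  "MI n U = {f \<in> pser n. \<forall>a. f a \<noteq> 0 \<longrightarrow> a \<in> U}"

definition upset :: "nat \<Rightarrow> (nat \<Rightarrow> nat) set \<Rightarrow> (nat \<Rightarrow> nat) set" where
  "upset n A = {c \<in> exps n. \<exists>a\<in>A. a \<le> c}"

definition upclosed :: "nat \<Rightarrow> (nat \<Rightarrow> nat) set \<Rightarrow> bool" where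
  "upclosed n U \<longleftrightarrow> U \<subseteq> exps n \<and> (\<forall>a\<in>U. \<forall>b\<in>exps n. a + b \<in> U)"

lemma upclosed_le:
  assumes "upclosed n U" "a \<in> U" "a \<le> c" "c \<in> exps n"
  shows "c \<in> U"
proof -
  have eq: "a + (c - a) = c" by (rule ext) (use le_funD[OF assms(3)] in simp)
  have "c - a \<in> exps n" using assms(4) by (rule exps_mono) (simp add: le_fun_def)
  with assms(1,2) have "a + (c - a) \<in> U" unfolding upclosed_def by simp
  then show ?thesis by (simp only: eq)
qed

lemma upclosedI:
  assumes "U \<subseteq> exps n" "\<And>a c. a \<in> U \<Longrightarrow> a \<le> c \<Longrightarrow> c \<in> exps n \<Longrightarrow> c \<in> U"
  shows "upclosed n U"
  unfolding upclosed_def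
proof (intro conjI ballI assms(1))
  fix a b assume "a \<in> U" "b \<in> exps n"
  moreover from this have "a + b \<in> exps n" using assms(1) by (auto simp: exps_add)
  ultimately show "a + b \<in> U" using assms(2)[of a "a + b"] by (simp add: le_fun_def)
qed

lemma upclosed_upset: "upclosed n (upset n A)"
proof (rule upclosedI)
  fix a c assume "a \<in> upset n A" "a \<le> c" "c \<in> exps n"
  moreover from this obtain b where "b \<in> A" "b \<le> a" by (auto simp: upset_def)
  ultimately show "c \<in> upset n A"
    unfolding upset_def by (intro CollectI conjI bexI[of _ b] order_trans[of b a c])
qed (auto simp: upset_def)

lemma MI_ideal:
  assumes "upclosed n U"
  shows "ideal (MI n U) (mvps_ring n)"
proof (rule ideal_mvpsI)
  fix f g :: "'a mvps" assume f: "f \<in> MI n U"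
  show "pmul g f \<in> MI n U" if g: "g \<in> pser n"
    unfolding MI_def
  proof (intro CollectI conjI allI impI)
    show "pmul g f \<in> pser n" using f g by (auto simp: MI_def)
    fix a assume "pmul g f a \<noteq> 0"
    then obtain b c where "b + c = a" "g b \<noteq> 0" "f c \<noteq> 0" using pmul_nonzeroD[of g f a] by auto
    then have "c + b \<in> U" using assms f pserD[OF g] by (simp add: MI_def upclosed_def)
    with \<open>b + c = a\<close> show "a \<in> U" by (simp add: add.commute)
  qed
  show "f + g \<in> MI n U" if g: "g \<in> MI n U"
  proof -
    have "a \<in> U" if "f a + g a \<noteq> 0" for a
      using f g that by (cases "f a = 0") (auto simp: MI_def)
    then show ?thesis using f g by (auto simp: MI_def)
  qed
qed (auto simp: MI_def)

lemma MI_monom: "mvps_monom a \<in> MI n U \<longleftrightarrow> a \<in> U \<and> a \<in> exps n"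
  by (auto simp: MI_def mvps_monom_eq pterm_def pser_def)

lemma MI_eq_iff:
  assumes "U \<subseteq> exps n" "V \<subseteq> exps n"
  shows "(MI n U :: 'k::field mvps set) = MI n V \<longleftrightarrow> U = V"
proof
  assume *: "(MI n U :: 'k mvps set) = MI n V"
  have "a \<in> U \<longleftrightarrow> a \<in> V" for a
    using assms MI_monom[of a n U, where ?'a = 'k] MI_monom[of a n V, where ?'a = 'k] * by auto
  then show "U = V" by auto
qed simp

lemma MI_mono: "U \<subseteq> V \<Longrightarrow> MI n U \<subseteq> MI n V"
  by (auto simp: MI_def)

text \<open>Dickson's lemma leaves finitely many generators, among which the terms of a series can
  be distributed; so infinite series are reached by finite combinations.\<close>

lemma Idl_monoms:
  assumes A: "A \<subseteq> exps n"
  shows "Idl\<^bsub>mvps_ring n\<^esub> (mvps_monom ` A) = (MI n (upset n A) :: 'k::field mvps set)" (is "?I = _")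
proof
  interpret cring "mvps_ring n :: 'k mvps ring" by (rule cring_mvps)
  have car: "mvps_monom ` A \<subseteq> carrier (mvps_ring n :: 'k mvps ring)"
    using A by (auto simp: mvps_ring_simps mvps_monom_eq)
  show "?I \<subseteq> MI n (upset n A)"
    using A by (intro genideal_minimal MI_ideal upclosed_upset) (auto simp: MI_monom upset_def)
  interpret ps_ideal n ?I
    by (rule ps_ideal.intro) (rule genideal_ideal[OF car])
  have monom: "mvps_monom a \<in> ?I" if "a \<in> A" for a
    using genideal_self[OF car] that by auto
  show "MI n (upset n A) \<subseteq> ?I"
  proof
    fix f :: "'k mvps" assume f: "f \<in> MI n (upset n A)"
    obtain L where L: "finite L" "L \<subseteq> A" "\<forall>a\<in>A. \<exists>l\<in>L. l \<le> a" using dickson[OF A] by auto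
    have "\<forall>a\<in>upset n A. \<exists>l. l \<in> L \<and> l \<le> a"
    proof
      fix a assume "a \<in> upset n A"
      then obtain a' where "a' \<in> A" "a' \<le> a" by (auto simp: upset_def)
      moreover from this(1) L(3) obtain l where "l \<in> L" "l \<le> a'" by auto
      ultimately show "\<exists>l. l \<in> L \<and> l \<le> a" by (intro exI[of _ l]) auto
    qed
    from bchoice[OF this] obtain J where J: "\<And>a. a \<in> upset n A \<Longrightarrow> J a \<in> L \<and> J a \<le> a" by auto
    define g where "g = (\<lambda>l b. if b + l \<in> upset n A \<and> J (b + l) = l then f (b + l) else 0)"
    have g: "g l \<in> pser n" for l
      by (auto simp: g_def pser_def upset_def exps_add)
    have "f = (\<Sum>l\<in>L. pmul (g l) (mvps_monom l))"
    proof
      fix a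
      show "f a = (\<Sum>l\<in>L. pmul (g l) (mvps_monom l)) a"
      proof (cases "a \<in> upset n A")
        case True
        then have ax: "a \<in> exps n" by (simp add: upset_def)
        have "(\<Sum>l\<in>L. pmul (g l) (mvps_monom l)) a = (\<Sum>l\<in>L. if l = J a then f a else 0)"
          unfolding sum_fun_apply
        proof (rule sum.cong[OF refl])
          fix l assume "l \<in> L"
          have "pmul (g l) (mvps_monom l) a = (if l \<le> a then g l (a - l) else 0)"
            using ax by (subst pmul_commute) (simp add: mvps_monom_eq pmul_pterm)
          moreover have "a - l + l = a" if "l \<le> a" using that by (auto simp: fun_eq_iff le_fun_def)
          ultimately show "pmul (g l) (mvps_monom l) a = (if l = J a then f a else 0)"
            using J[OF True] True by (auto simp: g_def)
        qed
        then show ?thesis using J[OF True] L(1) by simp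
      next
        case False
        then have "f a = 0" using f by (auto simp: MI_def)
        moreover have "pmul (g l) (mvps_monom l) a = 0" for l
        proof (rule ccontr)
          assume "pmul (g l) (mvps_monom l) a \<noteq> 0"
          from pmul_nonzeroD[OF this] obtain b c where "b + c = a" "g l b \<noteq> 0" "mvps_monom l c \<noteq> (0 :: 'k)" by auto
          then show False using False by (auto simp: g_def mvps_monom_def split: if_splits)
        qed
        ultimately show ?thesis by (simp add: sum_fun_apply)
      qed
    qed
    also have "\<dots> \<in> ?I" using L g monom by (intro A_sum A_mult) auto
    finally show "f \<in> ?I" .
  qed
qed

lemma monomial_ideal_iff: "monomial_ideal n I \<longleftrightarrow> (\<exists>U. upclosed n U \<and> I = MI n U)"
proof
  assume "monomial_ideal n I"
  then show "\<exists>U. upclosed n U \<and> I = MI n U"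
    unfolding monomial_ideal_def using Idl_monoms upclosed_upset by blast
next
  assume "\<exists>U. upclosed n U \<and> I = MI n U"
  then obtain U where U: "upclosed n U" "I = MI n U" by auto
  have "upset n U = U"
  proof
    show "upset n U \<subseteq> U" using upclosed_le[OF U(1)] by (auto simp: upset_def)
    show "U \<subseteq> upset n U" using U(1) by (auto simp: upset_def upclosed_def)
  qed
  with U Idl_monoms[of U n, where ?'k = 'a] show "monomial_ideal n I"
    unfolding monomial_ideal_def by (intro exI[of _ U]) (auto simp: upclosed_def)
qed

lemma MI_set_add:
  "(MI n U :: 'k::field mvps set) <+>\<^bsub>mvps_ring n\<^esub> MI n V = MI n (U \<union> V)"
proof -
  have "(MI n U :: 'k mvps set) <+>\<^bsub>mvps_ring n\<^esub> MI n V = {f + g | f g. f \<in> MI n U \<and> g \<in> MI n V}"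
    by (auto simp: set_add_def set_mult_def mvps_ring_simps)
  also have "\<dots> = MI n (U \<union> V)"
  proof (intro equalityI subsetI)
    fix h :: "'k mvps" assume "h \<in> {f + g | f g. f \<in> MI n U \<and> g \<in> MI n V}"
    then obtain f g where h: "h = f + g" "f \<in> MI n U" "g \<in> MI n V" by auto
    have "a \<in> U \<or> a \<in> V" if "f a + g a \<noteq> 0" for a
      using h that by (cases "f a = 0") (auto simp: MI_def)
    with h show "h \<in> MI n (U \<union> V)" by (auto simp: MI_def)
  next
    fix h :: "'k mvps" assume h: "h \<in> MI n (U \<union> V)"
    define f where "f = (\<lambda>a. if a \<in> U then h a else 0)"
    define g where "g = (\<lambda>a. if a \<in> U then 0 else h a)"
    have "f \<in> MI n U" "g \<in> MI n V" using h by (auto simp: f_def g_def MI_def pser_def)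
    moreover have "h = f + g" by (auto simp: f_def g_def fun_eq_iff)
    ultimately show "h \<in> {f + g | f g. f \<in> MI n U \<and> g \<in> MI n V}" by blast
  qed
  finally show ?thesis .
qed

lemma MI_colon:
  assumes "upclosed n U" "upclosed n V"
  shows "ideal_colon (mvps_ring n) (MI n U :: 'k::field mvps set) (MI n V) = MI n {c \<in> exps n. \<forall>v\<in>V. c + v \<in> U}"
proof (intro equalityI subsetI)
  fix f :: "'k mvps" assume f: "f \<in> ideal_colon (mvps_ring n) (MI n U) (MI n V)"
  then have fp: "f \<in> pser n" by (simp add: ideal_colon_def mvps_ring_simps)
  show "f \<in> MI n {c \<in> exps n. \<forall>v\<in>V. c + v \<in> U}"
    unfolding MI_def
  proof (intro CollectI conjI allI impI ballI fp)
    fix c assume c: "f c \<noteq> 0"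
    then show cx: "c \<in> exps n" using pserD fp by auto
    fix v assume v: "v \<in> V"
    then have vx: "v \<in> exps n" using assms(2) by (auto simp: upclosed_def)
    then have "(mvps_monom v :: 'k mvps) \<in> MI n V" using v by (simp add: MI_monom)
    then have "pmul f (mvps_monom v) \<in> MI n U" using f by (auto simp: ideal_colon_def mvps_ring_simps)
    moreover have "pmul f (mvps_monom v) (c + v) = f c"
    proof -
      have "c + v - v = c" "v \<le> c + v" by (auto simp: fun_eq_iff le_fun_def)
      then show ?thesis using cx vx by (subst pmul_commute) (simp add: mvps_monom_eq pmul_pterm exps_add)
    qed
    ultimately show "c + v \<in> U" using c by (auto simp: MI_def)
  qed
next
  fix f :: "'k mvps" assume f: "f \<in> MI n {c \<in> exps n. \<forall>v\<in>V. c + v \<in> U}"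
  have "pmul f g \<in> MI n U" if g: "g \<in> MI n V" for g
    unfolding MI_def
  proof (intro CollectI conjI allI impI)
    show "pmul f g \<in> pser n" using f g by (auto simp: MI_def)
    fix a assume "pmul f g a \<noteq> 0"
    from pmul_nonzeroD[OF this] obtain b c where "b + c = a" "f b \<noteq> 0" "g c \<noteq> 0" by auto
    then show "a \<in> U" using f g by (auto simp: MI_def)
  qed
  with f show "f \<in> ideal_colon (mvps_ring n) (MI n U) (MI n V)"
    by (auto simp: ideal_colon_def mvps_ring_simps MI_def)
qed

lemma pfrob_monom: "q > 0 \<Longrightarrow> pfrob q (mvps_monom v) = mvps_monom (\<lambda>i. q * v i)"
proof
  fix a assume q: "q > 0"
  show "pfrob q (mvps_monom v :: 'a mvps) a = mvps_monom (\<lambda>i. q * v i) a"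
  proof (cases "\<forall>i. q dvd a i")
    case True
    then have eq: "(\<lambda>i. q * (a i div q)) = a" by (intro ext) simp
    have "(\<lambda>i. a i div q) = v \<longleftrightarrow> a = (\<lambda>i. q * v i)"
    proof
      assume "(\<lambda>i. a i div q) = v"
      then show "a = (\<lambda>i. q * v i)" by (subst eq[symmetric]) auto
    qed (use q in simp)
    with True q show ?thesis by (auto simp: pfrob_def mvps_monom_def)
  next
    case False
    then show ?thesis by (auto simp: pfrob_def mvps_monom_def)
  qed
qed

text \<open>Powers with the characteristic as exponent are taken term by term, so those of the
  monomials of the ideal suffice as generators.\<close>

lemma MI_bracket_power:
  assumes U: "upclosed n U" and p: "Factorial_Ring.prime CHAR('k::field)"
  shows "bracket_power (mvps_ring n) (MI n U :: 'k mvps set) CHAR('k) = MI n (upset n ((\<lambda>v i. CHAR('k) * v i) ` U))"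
    (is "?B = MI n ?V")
proof
  interpret cring "mvps_ring n :: 'k mvps ring" by (rule cring_mvps)
  let ?p = "CHAR('k)"
  have p0: "?p > 0" using p by (simp add: prime_gt_0_nat)
  have pow: "f [^]\<^bsub>mvps_ring n\<^esub> ?p = pfrob ?p f" if "f \<in> pser n" for f :: "'k mvps"
    using pser_pow_char_power[OF p that, of 1] by (simp only: power_one_right)
  have pc: "f [^]\<^bsub>mvps_ring n\<^esub> ?p \<in> pser n" if "f \<in> pser n" for f :: "'k mvps"
    using nat_pow_closed[of f ?p] that by (simp only: mvps_ring_simps(1))
  have car: "(\<lambda>f. f [^]\<^bsub>mvps_ring n\<^esub> ?p) ` MI n U \<subseteq> carrier (mvps_ring n :: 'k mvps ring)"
    by (rule image_subsetI) (simp only: MI_def mem_Collect_eq mvps_ring_simps(1) pc)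
  show "?B \<subseteq> MI n ?V"
    unfolding bracket_power_def
  proof (rule genideal_minimal[OF MI_ideal[OF upclosed_upset]], rule image_subsetI)
    fix f :: "'k mvps" assume f: "f \<in> MI n U"
    then have fp: "f \<in> pser n" and fU: "\<And>a. f a \<noteq> 0 \<Longrightarrow> a \<in> U" by (simp_all add: MI_def)
    have frp: "pfrob ?p f \<in> pser n" using pc[OF fp] by (simp only: pow[OF fp])
    show "f [^]\<^bsub>mvps_ring n\<^esub> ?p \<in> MI n ?V"
      unfolding pow[OF fp] MI_def
    proof (intro CollectI conjI allI impI frp)
      fix a assume a: "pfrob ?p f a \<noteq> 0"
      have d: "\<forall>i. ?p dvd a i"
        by (rule ccontr) (use a in \<open>simp only: pfrob_def if_False simp_thms\<close>)
      have "f (\<lambda>i. a i div ?p) ^ ?p \<noteq> 0" using a d by (simp only: pfrob_def if_True simp_thms)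
      then have "f (\<lambda>i. a i div ?p) \<noteq> 0" using p0 by (cases "f (\<lambda>i. a i div ?p) = 0") simp_all
      then have "(\<lambda>i. a i div ?p) \<in> U" by (rule fU)
      then have "(\<lambda>i. ?p * (a i div ?p)) \<in> (\<lambda>v i. ?p * v i) ` U" by (rule imageI)
      moreover have "(\<lambda>i. ?p * (a i div ?p)) = a" by (rule ext) (simp add: dvd_mult_div_cancel[OF d[rule_format]])
      ultimately have aU: "a \<in> (\<lambda>v i. ?p * v i) ` U" by (simp only:)
      show "a \<in> ?V" unfolding upset_def
        by (rule CollectI, rule conjI, rule pserD[OF frp, of a, OF a], rule bexI[OF order_refl aU])
    qed
  qed
  show "MI n ?V \<subseteq> ?B"
  proof -
    have Ux: "U \<subseteq> exps n" using U by (simp add: upclosed_def)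
    then have sub: "(\<lambda>v i. ?p * v i) ` U \<subseteq> exps n" by (auto simp: exps_def)
    have "mvps_monom ` (\<lambda>v i. ?p * v i) ` U \<subseteq> ?B"
    proof (rule subsetI, elim imageE)
      fix x w v assume xw: "x = (mvps_monom w :: 'k mvps)" "w = (\<lambda>i. ?p * v i)" and v: "v \<in> U"
      have vx: "v \<in> exps n" using Ux v by (rule subsetD)
      then have vp: "(mvps_monom v :: 'k mvps) \<in> pser n" unfolding mvps_monom_eq by (rule pser_pterm)
      have "(mvps_monom v :: 'k mvps) \<in> MI n U" using v vx by (simp add: MI_monom)
      then have "(mvps_monom v :: 'k mvps) [^]\<^bsub>mvps_ring n\<^esub> ?p \<in> ?B"
        unfolding bracket_power_def by (intro subsetD[OF genideal_self[OF car]] imageI)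
      then show "x \<in> ?B" by (simp only: xw pow[OF vp] pfrob_monom[OF p0])
    qed
    then have "Idl\<^bsub>mvps_ring n\<^esub> (mvps_monom ` (\<lambda>v i. ?p * v i) ` U) \<subseteq> ?B"
      by (intro genideal_minimal) (simp_all only: bracket_power_def genideal_ideal[OF car])
    then show ?thesis unfolding Idl_monoms[OF sub] .
  qed
qed

section \<open>Minimal primes and the ideal \<open>J\<^sub>p\<close>\<close>

text \<open>By \<open>inter_var_ideals\<close>, the exponents of the monomials in the intersection
  of the primes \<open>var_ideal n F\<close>.\<close>

definition cov :: "nat \<Rightarrow> nat set set \<Rightarrow> (nat \<Rightarrow> nat) set" where
  "cov n \<F> = {a \<in> exps n. \<forall>F\<in>\<F>. \<exists>i\<in>F. a i \<noteq> 0}"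

lemma upclosed_cov: "upclosed n (cov n \<F>)"
  unfolding upclosed_def
proof (intro conjI ballI)
  fix a b assume a: "a \<in> cov n \<F>" and b: "b \<in> exps n"
  have "\<exists>i\<in>F. (a + b) i \<noteq> 0" if "F \<in> \<F>" for F
  proof -
    from a that obtain i where "i \<in> F" "a i \<noteq> 0" by (auto simp: cov_def)
    then show ?thesis by (intro bexI[of _ i]) auto
  qed
  with a b show "a + b \<in> cov n \<F>" by (simp add: cov_def exps_add)
qed (auto simp: cov_def)

lemma indicator_exps: "A \<subseteq> {..<n} \<Longrightarrow> (indicator A :: nat \<Rightarrow> nat) \<in> exps n"
  by (auto simp: exps_def indicator_def)

lemma indicator_le_iff: "indicator A \<le> a \<longleftrightarrow> (\<forall>i\<in>A. a i \<noteq> 0)" for a :: "nat \<Rightarrow> nat"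
  by (auto simp: le_fun_def indicator_def Suc_le_eq)

lemma var_ideal_eq:
  assumes "F \<subseteq> {..<n}"
  shows "(var_ideal n F :: 'k::field mvps set) = MI n (cov n {F})"
proof -
  have sub: "(\<lambda>i. indicator {i}) ` F \<subseteq> exps n"
    using assms by (intro image_subsetI indicator_exps) auto
  have "(\<lambda>i. mvps_monom (indicator {i}) :: 'k mvps) ` F = mvps_monom ` (\<lambda>i. indicator {i}) ` F"
    by (simp add: image_image)
  then have "(var_ideal n F :: 'k mvps set) = MI n (upset n ((\<lambda>i. indicator {i}) ` F))"
    unfolding var_ideal_def using sub by (simp only: Idl_monoms)
  also have "upset n ((\<lambda>i. indicator {i}) ` F) = cov n {F}"
    by (auto simp: upset_def cov_def indicator_le_iff)
  finally show ?thesis .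
qed

lemma inter_var_ideals:
  assumes "\<F> \<subseteq> Pow {..<n}"
  shows "carrier (mvps_ring n) \<inter> (\<Inter>F\<in>\<F>. var_ideal n F) = (MI n (cov n \<F>) :: 'k::field mvps set)"
proof -
  have "var_ideal n F = (MI n (cov n {F}) :: 'k mvps set)" if "F \<in> \<F>" for F
    using assms that by (intro var_ideal_eq) auto
  then have "carrier (mvps_ring n) \<inter> (\<Inter>F\<in>\<F>. var_ideal n F :: 'k mvps set) =
      pser n \<inter> (\<Inter>F\<in>\<F>. MI n (cov n {F}))"
    by (simp add: mvps_ring_simps(1))
  also have "\<dots> = MI n (cov n \<F>)"
    by (auto simp: MI_def cov_def dest: pserD)
  finally show ?thesis .
qed

text \<open>The product of the variables outside \<open>F\<close> is not in the prime of
  \<open>F\<close>, hence lies outside some prime of the other family.\<close>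

lemma cov_eq_imp_below:
  assumes sub: "\<F> \<subseteq> Pow {..<n}" "\<G> \<subseteq> Pow {..<n}" and eq: "cov n \<F> = cov n \<G>" and F: "F \<in> \<F>"
  shows "\<exists>G\<in>\<G>. G \<subseteq> F"
proof -
  let ?a = "indicator ({..<n} - F) :: nat \<Rightarrow> nat"
  have ax: "?a \<in> exps n" by (rule indicator_exps) auto
  have "?a \<notin> cov n \<F>" using F by (auto simp: cov_def indicator_def)
  then have "?a \<notin> cov n \<G>" by (simp add: eq)
  then obtain G where G: "G \<in> \<G>" "\<forall>i\<in>G. ?a i = 0" using ax by (auto simp: cov_def)
  have "G \<subseteq> F" using G sub(2) by (auto simp: indicator_def split: if_splits)
  with G show ?thesis by auto
qed

text \<open>The minimal primes are the minimal sets of variables that meet the support of every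
  generator. Properness keeps the supports nonempty, so the set of all variables qualifies. For
  \<open>I = 0\<close> the family consists of the empty set.\<close>

lemma squarefree_antichain:
  assumes "squarefree_monomial_ideal n I" "I \<noteq> carrier (mvps_ring n)"
  shows "\<exists>FF. antichain n FF \<and> I = (MI n (cov n FF) :: 'k::field mvps set)"
proof -
  obtain \<A> where A: "\<A> \<subseteq> Pow {..<n}" and "I = Idl\<^bsub>mvps_ring n\<^esub> ((\<lambda>A. mvps_monom (indicator A)) ` \<A>)"
    using assms(1) by (auto simp: squarefree_monomial_ideal_def)
  moreover have "(\<lambda>A. mvps_monom (indicator A) :: 'k mvps) ` \<A> = mvps_monom ` indicator ` \<A>"
    by (simp add: image_image)
  moreover have "indicator ` \<A> \<subseteq> exps n"
    using A by (intro image_subsetI indicator_exps) auto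
  ultimately have I: "I = MI n (upset n (indicator ` \<A>))"
    by (simp only: Idl_monoms)
  have ne: "{} \<notin> \<A>"
  proof
    assume "{} \<in> \<A>"
    then have "upset n (indicator ` \<A>) = exps n" by (auto simp: upset_def indicator_le_iff)
    then have "I = pser n" by (auto simp: I MI_def dest: pserD)
    with assms(2) show False by (simp add: mvps_ring_simps(1))
  qed
  define T where "T = {F. F \<subseteq> {..<n} \<and> (\<forall>A\<in>\<A>. F \<inter> A \<noteq> {})}"
  define FF where "FF = {F \<in> T. \<forall>G\<in>T. G \<subseteq> F \<longrightarrow> G = F}"
  have finT: "finite T" by (rule finite_subset[of _ "Pow {..<n}"]) (auto simp: T_def)
  have below: "\<exists>F\<in>FF. F \<subseteq> G" if "G \<in> T" for G
  proof -
    from finite_has_minimal2[OF finT that] obtain F where "F \<in> T" "F \<subseteq> G" "\<forall>b\<in>T. b \<subseteq> F \<longrightarrow> F = b"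
      by (elim bexE conjE)
    then show ?thesis by (intro bexI[of _ F]) (auto simp: FF_def)
  qed
  have "{..<n} \<in> T"
    unfolding T_def
  proof (intro CollectI conjI ballI order_refl)
    fix A' assume "A' \<in> \<A>"
    then have "A' \<subseteq> {..<n}" "A' \<noteq> {}" using A ne by auto
    then show "{..<n} \<inter> A' \<noteq> {}" by auto
  qed
  from below[OF this] have "FF \<noteq> {}" by auto
  then have "antichain n FF"
    by (intro antichain.intro) (auto simp: FF_def T_def)
  moreover have "upset n (indicator ` \<A>) = cov n FF"
  proof (intro equalityI subsetI)
    fix a :: "nat \<Rightarrow> nat" assume "a \<in> upset n (indicator ` \<A>)"
    then obtain A' where A1: "a \<in> exps n" "A' \<in> \<A>" "\<forall>i\<in>A'. a i \<noteq> 0"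
      by (auto simp: upset_def indicator_le_iff)
    have "\<exists>i\<in>F. a i \<noteq> 0" if "F \<in> FF" for F
    proof -
      have "F \<inter> A' \<noteq> {}" using that A1(2) by (simp add: FF_def T_def)
      then obtain i where "i \<in> F" "i \<in> A'" by auto
      with A1(3) show ?thesis by (intro bexI[of _ i]) auto
    qed
    with A1 show "a \<in> cov n FF" by (simp add: cov_def)
  next
    fix a :: "nat \<Rightarrow> nat" assume a: "a \<in> cov n FF"
    show "a \<in> upset n (indicator ` \<A>)"
    proof (rule ccontr)
      assume no: "\<not> ?thesis"
      have ax: "a \<in> exps n" using a by (simp add: cov_def)
      \<comment> \<open>The zeros of \<open>a\<close> meet every support because no generator
        divides the monomial.\<close>
      have "{i. i < n \<and> a i = 0} \<in> T"
      proof -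
        have "{i. i < n \<and> a i = 0} \<inter> A' \<noteq> {}" if "A' \<in> \<A>" for A'
        proof -
          have "\<not> (\<forall>i\<in>A'. a i \<noteq> 0)" using no ax that by (auto simp: upset_def indicator_le_iff)
          then show ?thesis using A that by auto
        qed
        then show ?thesis by (auto simp: T_def)
      qed
      from below[OF this] obtain F where F: "F \<in> FF" "F \<subseteq> {i. i < n \<and> a i = 0}" by auto
      then have "\<not> (\<exists>i\<in>F. a i \<noteq> 0)" by auto
      with a F(1) show False by (simp add: cov_def)
    qed
  qed
  ultimately show ?thesis using I by auto
qed

context antichain
begin

lemma cov_NN: "cov n FF = exps n - NN"
  by (auto simp: cov_def NN_def)

text \<open>Irredundancy makes the family an antichain, and antichains with the same intersection
  agree, since each member of one contains a member of the other. This evaluates the description in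
  \<open>decomposition_vars\<close>.\<close>

lemma MPD_iff: "minimal_primary_decomposition n (MI n (cov n FF) :: 'k::field mvps set) \<F> \<longleftrightarrow> \<F> = FF"
proof -
  have eq: "(MI n (cov n \<G>) :: 'k mvps set) = MI n (cov n \<H>) \<longleftrightarrow> cov n \<G> = cov n \<H>" for \<G> \<H>
    by (rule MI_eq_iff) (auto simp: cov_def)
  have iff: "minimal_primary_decomposition n (MI n (cov n FF) :: 'k mvps set) \<F> \<longleftrightarrow>
     \<F> \<subseteq> Pow {..<n} \<and> cov n FF = cov n \<F> \<and> (\<forall>F\<in>\<F>. cov n FF \<noteq> cov n (\<F> - {F}))"
  proof (cases "\<F> \<subseteq> Pow {..<n}")
    case True
    then have "\<F> - {F} \<subseteq> Pow {..<n}" for F by auto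
    with True show ?thesis
      unfolding minimal_primary_decomposition_def by (simp add: inter_var_ideals eq)
  qed (simp add: minimal_primary_decomposition_def)
  show ?thesis
  proof
    assume "minimal_primary_decomposition n (MI n (cov n FF) :: 'k mvps set) \<F>"
    with iff have F: "\<F> \<subseteq> Pow {..<n}" "cov n FF = cov n \<F>" "\<And>F. F \<in> \<F> \<Longrightarrow> cov n \<F> \<noteq> cov n (\<F> - {F})"
      by auto
    have anti: "F = G" if "F \<in> \<F>" "G \<in> \<F>" "F \<subseteq> G" for F G
    proof (rule ccontr)
      assume "F \<noteq> G"
      have "cov n \<F> = cov n (\<F> - {G})"
      proof
        show "cov n (\<F> - {G}) \<subseteq> cov n \<F>"
        proof
          fix a assume a: "a \<in> cov n (\<F> - {G})"
          have *: "\<exists>i\<in>H. a i \<noteq> 0" if "H \<in> \<F>" "H \<noteq> G" for H using a that by (simp add: cov_def)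
          have "\<exists>i\<in>G. a i \<noteq> 0" using *[OF that(1) \<open>F \<noteq> G\<close>] that(3) by auto
          with * have "\<exists>i\<in>H. a i \<noteq> 0" if "H \<in> \<F>" for H using that by (cases "H = G") auto
          then show "a \<in> cov n \<F>" using a by (simp add: cov_def)
        qed
      qed (auto simp: cov_def)
      with F(3)[OF that(2)] show False by simp
    qed
    show "\<F> = FF"
    proof (intro equalityI subsetI)
      fix F assume FF: "F \<in> \<F>"
      obtain G where G: "G \<in> FF" "G \<subseteq> F" using cov_eq_imp_below[OF F(1) FF_sub F(2)[symmetric] FF] by auto
      obtain H where H: "H \<in> \<F>" "H \<subseteq> G" using cov_eq_imp_below[OF FF_sub F(1) F(2) G(1)] by auto
      have "H = F" using anti[OF H(1) FF] H G by auto
      with H G show "F \<in> FF" by auto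
    next
      fix F assume FF: "F \<in> FF"
      obtain G where G: "G \<in> \<F>" "G \<subseteq> F" using cov_eq_imp_below[OF FF_sub F(1) F(2) FF] by auto
      obtain H where H: "H \<in> FF" "H \<subseteq> G" using cov_eq_imp_below[OF F(1) FF_sub F(2)[symmetric] G(1)] by auto
      have "H = F" using FF_anti[OF H(1) FF] H G by auto
      with H G show "F \<in> \<F>" by auto
    qed
  next
    assume "\<F> = FF"
    moreover have "cov n FF \<noteq> cov n (FF - {F})" if F: "F \<in> FF" for F
    proof
      assume eq: "cov n FF = cov n (FF - {F})"
      have sub: "FF - {F} \<subseteq> Pow {..<n}" using FF_sub by auto
      obtain G where "G \<in> FF - {F}" "G \<subseteq> F"
        using cov_eq_imp_below[OF FF_sub sub eq F] by auto
      then show False using FF_anti[of G F] F by auto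
    qed
    ultimately show "minimal_primary_decomposition n (MI n (cov n FF) :: 'k mvps set) \<F>"
      using iff FF_sub by auto
  qed
qed

lemma decomposition_vars_eq: "decomposition_vars n (MI n (cov n FF) :: 'k::field mvps set) = \<Union>FF"
proof -
  interpret cring "mvps_ring n :: 'k mvps ring" by (rule cring_mvps)
  have "(THE \<F>. minimal_primary_decomposition n (MI n (cov n FF) :: 'k mvps set) \<F>) = FF"
    by (simp add: MPD_iff)
  moreover have "Idl\<^bsub>mvps_ring n\<^esub> (\<Union>F\<in>FF. var_ideal n F) = (MI n (cov n {\<Union>FF}) :: 'k mvps set)"
  proof
    have var: "var_ideal n F = (MI n (cov n {F}) :: 'k mvps set)" if "F \<in> FF" for F
      using FF_sub that by (intro var_ideal_eq) auto
    have sub: "(\<Union>F\<in>FF. var_ideal n F) \<subseteq> (MI n (cov n {\<Union>FF}) :: 'k mvps set)"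
    proof (intro UN_least)
      fix F assume F: "F \<in> FF"
      have "cov n {F} \<subseteq> cov n {\<Union>FF}" using F by (auto simp: cov_def)
      then show "var_ideal n F \<subseteq> (MI n (cov n {\<Union>FF}) :: 'k mvps set)"
        unfolding var[OF F] by (rule MI_mono)
    qed
    then show "Idl\<^bsub>mvps_ring n\<^esub> (\<Union>F\<in>FF. var_ideal n F) \<subseteq> (MI n (cov n {\<Union>FF}) :: 'k mvps set)"
      by (intro genideal_minimal MI_ideal upclosed_cov)
    have car: "(\<Union>F\<in>FF. var_ideal n F) \<subseteq> carrier (mvps_ring n :: 'k mvps ring)"
      using var by (auto simp: MI_def mvps_ring_simps(1))
    have "MI n (cov n {\<Union>FF}) = (var_ideal n (\<Union>FF) :: 'k mvps set)"
      using FF_sub by (intro var_ideal_eq[symmetric]) auto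
    also have "\<dots> \<subseteq> Idl\<^bsub>mvps_ring n\<^esub> (\<Union>F\<in>FF. var_ideal n F)"
      unfolding var_ideal_def[of n "\<Union>FF"]
    proof (rule genideal_minimal[OF genideal_ideal[OF car]], rule image_subsetI)
      fix i assume "i \<in> \<Union>FF"
      then obtain F where F: "F \<in> FF" "i \<in> F" by auto
      then have "(mvps_monom (indicator {i}) :: 'k mvps) \<in> var_ideal n F"
        using FF_less[OF F] by (auto simp: var MI_monom cov_def indicator_exps indicator_def exps_def)
      then show "(mvps_monom (indicator {i}) :: 'k mvps) \<in> Idl\<^bsub>mvps_ring n\<^esub> (\<Union>F\<in>FF. var_ideal n F)"
        using genideal_self[OF car] F(1) by auto
    qed
    finally show "MI n (cov n {\<Union>FF}) \<subseteq> Idl\<^bsub>mvps_ring n\<^esub> (\<Union>F\<in>FF. var_ideal n F :: 'k mvps set)" .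
  qed
  moreover have "(mvps_monom (indicator {i}) :: 'k mvps) \<in> MI n (cov n {\<Union>FF}) \<longleftrightarrow> i \<in> \<Union>FF"
    if "i < n" for i
  proof -
    have "(indicator {i} :: nat \<Rightarrow> nat) \<in> exps n" using that by (intro indicator_exps) auto
    then show ?thesis by (auto simp: MI_monom cov_def indicator_def)
  qed
  ultimately show ?thesis
    unfolding decomposition_vars_def using FF_less by auto
qed

lemma upset_scaled_cov:
  assumes q: "q > 0"
  shows "w \<in> upset n ((\<lambda>v i. q * v i) ` cov n FF) \<longleftrightarrow> w \<in> exps n \<and> (\<forall>F\<in>FF. \<exists>i\<in>F. q \<le> w i)"
proof
  assume "w \<in> upset n ((\<lambda>v i. q * v i) ` cov n FF)"
  then obtain v where v: "w \<in> exps n" "v \<in> cov n FF" "(\<lambda>i. q * v i) \<le> w" by (auto simp: upset_def)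
  have "\<exists>i\<in>F. q \<le> w i" if F: "F \<in> FF" for F
  proof -
    from v(2) F obtain i where i: "i \<in> F" "v i \<noteq> 0" by (auto simp: cov_def)
    have "q \<le> q * v i" using i by simp
    also have "\<dots> \<le> w i" using le_funD[OF v(3), of i] .
    finally show ?thesis using i by auto
  qed
  with v show "w \<in> exps n \<and> (\<forall>F\<in>FF. \<exists>i\<in>F. q \<le> w i)" by auto
next
  assume w: "w \<in> exps n \<and> (\<forall>F\<in>FF. \<exists>i\<in>F. q \<le> w i)"
  have "(\<lambda>i. w i div q) \<in> cov n FF"
  proof -
    have "\<exists>i\<in>F. w i div q \<noteq> 0" if F: "F \<in> FF" for F
    proof -
      from w F obtain i where "i \<in> F" "q \<le> w i" by auto
      then show ?thesis using q by (intro bexI[of _ i]) (auto simp: div_eq_0_iff)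
    qed
    with w show ?thesis by (auto simp: cov_def exps_def)
  qed
  moreover have "(\<lambda>i. q * (w i div q)) \<le> w" by (simp add: le_fun_def)
  ultimately show "w \<in> upset n ((\<lambda>v i. q * v i) ` cov n FF)" using w by (auto simp: upset_def)
qed

text \<open>The test exponent is \<open>1\<close> outside \<open>F\<close> and at the given \<open>i \<in> F\<close>: by incomparability of the
  members of \<open>FF\<close> it is the exponent of a monomial of \<open>I\<close>.\<close>

lemma colon_exponents:
  "{c \<in> exps n. \<forall>v\<in>cov n FF. c + v \<in> upset n ((\<lambda>v i. q * v i) ` cov n FF)} = CC q" if q: "q > 0"
proof -
  note br = upset_scaled_cov[OF q]
  show ?thesis
  proof (intro equalityI subsetI)
    fix c assume c: "c \<in> {c \<in> exps n. \<forall>v\<in>cov n FF. c + v \<in> upset n ((\<lambda>v i. q * v i) ` cov n FF)}"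
    have "(\<exists>i\<in>F. q \<le> c i) \<or> (\<forall>i\<in>F. q - 1 \<le> c i)" if F: "F \<in> FF" for F
    proof (rule disjCI, rule ccontr)
      assume "\<not> (\<forall>i\<in>F. q - 1 \<le> c i)"
      then obtain j where j: "j \<in> F" "c j < q - 1" by auto
      assume small: "\<not> (\<exists>i\<in>F. q \<le> c i)"
      let ?v = "indicator (insert j ({..<n} - F)) :: nat \<Rightarrow> nat"
      have "\<exists>i\<in>G. ?v i \<noteq> 0" if G: "G \<in> FF" for G
      proof (rule ccontr)
        assume "\<not> ?thesis"
        then have "G \<subseteq> F - {j}" using FF_sub G by (auto simp: indicator_def split: if_splits)
        moreover from this have "G = F" using FF_anti[OF G F] by auto
        ultimately show False using j by auto
      qed
      then have "?v \<in> cov n FF"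
        using FF_less[OF F j(1)] by (auto simp: cov_def intro!: indicator_exps)
      then have "c + ?v \<in> upset n ((\<lambda>v i. q * v i) ` cov n FF)" using c by blast
      then obtain i where "i \<in> F" "q \<le> c i + ?v i" using F unfolding br by auto
      then show False using small j by (cases "i = j") (auto simp: indicator_def split: if_splits)
    qed
    with c show "c \<in> CC q" by (simp add: CC_def)
  next
    fix c assume c: "c \<in> CC q"
    have "c + v \<in> upset n ((\<lambda>v i. q * v i) ` cov n FF)" if v: "v \<in> cov n FF" for v
      unfolding br
    proof (intro conjI ballI)
      show "c + v \<in> exps n" using c v by (simp add: CC_def cov_def exps_add)
      fix F assume F: "F \<in> FF"
      then have "(\<exists>i\<in>F. q \<le> c i) \<or> (\<forall>i\<in>F. q - 1 \<le> c i)" using c by (simp add: CC_def)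
      then show "\<exists>i\<in>F. q \<le> (c + v) i"
      proof
        assume "\<exists>i\<in>F. q \<le> c i"
        then obtain i where "i \<in> F" "q \<le> c i" by auto
        then show ?thesis by (intro bexI[of _ i]) auto
      next
        assume *: "\<forall>i\<in>F. q - 1 \<le> c i"
        from v F obtain i where i: "i \<in> F" "v i \<noteq> 0" by (auto simp: cov_def)
        with * have "q - 1 \<le> c i" by auto
        with i show ?thesis by (intro bexI[of _ i]) auto
      qed
    qed
    with c show "c \<in> {c \<in> exps n. \<forall>v\<in>cov n FF. c + v \<in> upset n ((\<lambda>v i. q * v i) ` cov n FF)}"
      by (simp add: CC_def)
  qed
qed

section \<open>Exponents and number of generators of the ideal \<open>J_q\<close>\<close>

text \<open>The exponents of \<open>I^[q] + ((x_1 ... x_m)^(q-1))\<close>, the part of the colon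
  ideal that is covered without \<open>J_q\<close>.\<close>

definition BB :: "nat \<Rightarrow> (nat \<Rightarrow> nat) set" where
  "BB q = {c \<in> exps n. \<forall>F\<in>FF. \<exists>i\<in>F. q \<le> c i} \<union> {c \<in> exps n. \<forall>i\<in>\<Union>FF. q - 1 \<le> c i}"

definition QQ :: "(nat \<Rightarrow> nat) set" where
  "QQ = MS - {mm}"

text \<open>A scaled pattern from \<open>QQ\<close> lies in neither part of \<open>BB q\<close>:
  being in \<open>TT q\<close> it is outside \<open>I^[q]\<close>, and since its pattern is minimal
  and not \<open>mm\<close> it is not above \<open>scl q mm\<close>. Everything in
  \<open>CC q\<close> outside \<open>BB q\<close> is above one of them.\<close>

lemma CC_decompose:
  assumes q: "q \<ge> 2" and W: "upclosed n W"
  shows "CC q = BB q \<union> W \<longleftrightarrow> upset n (scl q ` QQ) \<subseteq> W \<and> W \<subseteq> CC q"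
proof
  have BB_CC: "BB q \<subseteq> CC q" by (auto simp: BB_def CC_def)
  have mm: "scl q mm \<le> c \<longleftrightarrow> (\<forall>i\<in>\<Union>FF. q - 1 \<le> c i)" for c
    by (auto simp: le_fun_def scl_def mm_def)
  {
    assume eq: "CC q = BB q \<union> W"
    have "scl q s \<in> W" if s: "s \<in> QQ" for s
    proof -
      have T: "scl q s \<in> TT q" and sP: "s \<in> PP" "s \<noteq> mm"
        using scl_MS_TT[OF q] s by (auto simp: QQ_def MS_def)
      have "\<not> scl q mm \<le> scl q s"
      proof
        assume "scl q mm \<le> scl q s"
        then have "mm \<le> s" using scl_le_iff[OF q] mm_PP sP(1) by (simp add: PP_def)
        then show False using s mm_PP by (auto simp: QQ_def MS_def)
      qed
      then have "scl q s \<notin> BB q" using T by (auto simp: BB_def TT_def mm not_le)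
      then show ?thesis using T TT_CC eq by auto
    qed
    then have "upset n (scl q ` QQ) \<subseteq> W"
      using upclosed_le[OF W] by (auto simp: upset_def)
    then show "upset n (scl q ` QQ) \<subseteq> W \<and> W \<subseteq> CC q" using eq by auto
  next
    assume *: "upset n (scl q ` QQ) \<subseteq> W \<and> W \<subseteq> CC q"
    have "c \<in> BB q \<union> W" if c: "c \<in> CC q" for c
    proof (cases "c \<in> BB q")
      case False
      have cx: "c \<in> exps n" using c CC_exps by auto
      have "c \<in> TT q" using c False cx by (auto simp: TT_def BB_def not_le)
      from TT_ge_MS[OF q this] obtain s where s: "s \<in> MS" "scl q s \<le> c" by auto
      have "s \<noteq> mm" using False cx s(2) mm by (auto simp: BB_def)
      with s have "c \<in> upset n (scl q ` QQ)" using cx by (auto simp: upset_def QQ_def)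
      then show ?thesis using * by auto
    qed auto
    with * BB_CC show "CC q = BB q \<union> W" by auto
  }
qed

lemma J_equation_iff:
  assumes p: "Factorial_Ring.prime CHAR('k::field)" and W: "upclosed n W"
  shows "J_equation n (MI n (cov n FF) :: 'k mvps set) CHAR('k) (MI n W) \<longleftrightarrow>
    upset n (scl CHAR('k) ` QQ) \<subseteq> W \<and> W \<subseteq> CC CHAR('k)"
proof -
  let ?p = "CHAR('k)" and ?R = "mvps_ring n :: 'k mvps ring"
  let ?U = "upset n ((\<lambda>v i. ?p * v i) ` cov n FF)"
  have p2: "?p \<ge> 2" using p by (rule prime_ge_2_nat)
  then have p0: "?p > 0" by simp
  let ?m = "\<lambda>i. if i \<in> \<Union>FF then ?p - 1 else 0"
  have m: "?m \<in> exps n" using FF_less by (auto simp: exps_def not_less[symmetric])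
  have br: "bracket_power ?R (MI n (cov n FF)) ?p = MI n ?U"
    by (rule MI_bracket_power[OF upclosed_cov p])
  have colon: "ideal_colon ?R (MI n ?U) (MI n (cov n FF)) = MI n (CC ?p)"
    by (simp only: MI_colon[OF upclosed_upset upclosed_cov] colon_exponents[OF p0])
  have gen: "Idl\<^bsub>?R\<^esub> {mvps_monom ?m} = MI n (upset n {?m})"
    using Idl_monoms[of "{?m}" n, where ?'k = 'k] m by simp
  have up: "?U \<union> W \<union> upset n {?m} = BB ?p \<union> W"
  proof -
    have "?U = {c \<in> exps n. \<forall>F\<in>FF. \<exists>i\<in>F. ?p \<le> c i}"
      by (auto simp: upset_scaled_cov[OF p0])
    moreover have "?m \<le> c \<longleftrightarrow> (\<forall>i\<in>\<Union>FF. ?p - 1 \<le> c i)" for c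
      by (auto simp: le_fun_def)
    ultimately show ?thesis by (auto simp: BB_def upset_def)
  qed
  have "J_equation n (MI n (cov n FF) :: 'k mvps set) ?p (MI n W) \<longleftrightarrow>
     (MI n (CC ?p) :: 'k mvps set) = MI n (BB ?p \<union> W)"
    unfolding J_equation_def decomposition_vars_eq br colon gen MI_set_add up by (rule refl)
  also have "\<dots> \<longleftrightarrow> CC ?p = BB ?p \<union> W"
    using W CC_exps by (intro MI_eq_iff) (auto simp: BB_def upclosed_def)
  also have "\<dots> \<longleftrightarrow> upset n (scl ?p ` QQ) \<subseteq> W \<and> W \<subseteq> CC ?p"
    by (rule CC_decompose[OF p2 W])
  finally show ?thesis .
qed

lemma scl_QQ_exps: "scl q ` QQ \<subseteq> exps n"
  using scl_exps by (auto simp: QQ_def MS_def PP_def CC_def)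

text \<open>The solutions fill the interval between the up-set of the scaled patterns and
  \<open>CC\<close>, so there is a least one, and it is the only minimal one.\<close>

lemma J_ideal_eq:
  assumes p: "Factorial_Ring.prime CHAR('k::field)"
  shows "J_ideal n (MI n (cov n FF) :: 'k mvps set) CHAR('k) = MI n (upset n (scl CHAR('k) ` QQ))"
    (is "_ = MI n ?U")
proof -
  let ?p = "CHAR('k)" and ?I = "MI n (cov n FF) :: 'k mvps set"
  have p2: "?p \<ge> 2" using p by (rule prime_ge_2_nat)
  have Ux: "?U \<subseteq> exps n" by (auto simp: upset_def)
  have UC: "?U \<subseteq> CC ?p"
  proof
    fix c assume "c \<in> ?U"
    then obtain s where "c \<in> exps n" "s \<in> QQ" "scl ?p s \<le> c" by (auto simp: upset_def)
    then show "c \<in> CC ?p" using CC_up[OF scl_CC[OF p2]] by (auto simp: QQ_def MS_def)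
  qed
  have J0: "monomial_ideal n (MI n ?U :: 'k mvps set)" "J_equation n ?I ?p (MI n ?U)"
    unfolding monomial_ideal_iff J_equation_iff[OF p upclosed_upset]
    using upclosed_upset[of n "scl ?p ` QQ"] UC by (auto intro: exI[of _ ?U])
  have least: "MI n ?U \<subseteq> J" if "monomial_ideal n J" "J_equation n ?I ?p J" for J
  proof -
    from that(1) obtain W where W: "upclosed n W" "J = MI n W" by (auto simp: monomial_ideal_iff)
    have "?U \<subseteq> W \<and> W \<subseteq> CC ?p" using that(2) unfolding W(2) J_equation_iff[OF p W(1)] .
    then have "?U \<subseteq> W" by (rule conjunct1)
    then show ?thesis unfolding W(2) by (rule MI_mono)
  qed
  show ?thesis
    unfolding J_ideal_def
  proof (rule the_equality)
    show "monomial_ideal n (MI n ?U :: 'k mvps set) \<and> J_equation n ?I ?p (MI n ?U) \<and>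
     (\<forall>J'. monomial_ideal n J' \<and> J_equation n ?I ?p J' \<and> J' \<subseteq> MI n ?U \<longrightarrow> J' = MI n ?U)"
      using J0 by (intro conjI allI impI antisym least) auto
    fix J assume J: "monomial_ideal n J \<and> J_equation n ?I ?p J \<and>
     (\<forall>J'. monomial_ideal n J' \<and> J_equation n ?I ?p J' \<and> J' \<subseteq> J \<longrightarrow> J' = J)"
    have "MI n ?U \<subseteq> J" using J by (intro least) auto
    then show "J = MI n ?U" using J J0 by auto
  qed
qed

lemma QQ_finite: "finite QQ"
  using finite_MS by (simp add: QQ_def)

text \<open>At a minimal exponent multiplication only sees the constant term of the multiplier. This
  takes the role of Nakayama's lemma in counting generators.\<close>

lemma pmul_at_minimal:
  assumes "f \<in> MI n U" "s \<in> exps n" "\<And>b. b \<in> U \<Longrightarrow> b \<le> s \<Longrightarrow> b = s"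
  shows "pmul g f s = g 0 * f s"
proof -
  have "pmul g f s = (\<Sum>b\<in>{b. b \<le> s}. f b * g (s - b))"
    by (subst pmul_commute) (simp add: pmul_def)
  also have "\<dots> = (\<Sum>b\<in>{s}. f b * g (s - b))"
  proof (rule sum.mono_neutral_right[OF finite_le_exp[OF assms(2)]])
    show "\<forall>b\<in>{b. b \<le> s} - {s}. f b * g (s - b) = 0"
    proof
      fix b assume b: "b \<in> {b. b \<le> s} - {s}"
      then have "b \<notin> U" using assms(3)[of b] by auto
      then have "f b = 0" using assms(1) by (auto simp: MI_def)
      then show "f b * g (s - b) = 0" by simp
    qed
  qed auto
  also have "\<dots> = g 0 * f s"
  proof -
    have "s - s = 0" by (simp add: fun_eq_iff)
    then show ?thesis by (simp add: mult.commute)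
  qed
  finally show ?thesis .
qed

lemma min_num_gens_J:
  assumes q: "q \<ge> 2"
  shows "min_num_gens (mvps_ring n) (MI n (upset n (scl q ` QQ)) :: 'k::field mvps set) = enat (card QQ)"
proof -
  interpret cring "mvps_ring n :: 'k mvps ring" by (rule cring_mvps)
  let ?U = "upset n (scl q ` QQ)" and ?J = "MI n (upset n (scl q ` QQ)) :: 'k mvps set"
  let ?S = "{A. finite A \<and> A \<subseteq> carrier (mvps_ring n) \<and> Idl\<^bsub>mvps_ring n\<^esub> A = ?J}"
  have minl: "b = scl q s" if "s \<in> QQ" "b \<in> ?U" "b \<le> scl q s" for s b
  proof -
    from that(2) obtain t where "b \<in> exps n" "t \<in> QQ" "scl q t \<le> b" by (auto simp: upset_def)
    then have "b \<in> CC q" using CC_up[OF scl_CC[OF q]] by (auto simp: QQ_def MS_def)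
    then show ?thesis using scl_MS_minimal[OF q] that by (auto simp: QQ_def)
  qed
  have "card QQ \<le> card A" if A: "A \<in> ?S" for A
  proof (rule card_le_of_spanning[where v = "\<lambda>f s. f (scl q s)"])
    show "finite A" "finite QQ" using A QQ_finite by auto
    \<comment> \<open>Those members of the ideal whose coefficients at the minimal exponents are a
      linear combination of the ones of \<open>A\<close>. Being an ideal that contains
      \<open>A\<close>, it is everything.\<close>
    define K where "K = {f \<in> ?J. \<exists>c. \<forall>s\<in>QQ. f (scl q s) = (\<Sum>x\<in>A. c x * x (scl q s))}"
    have AJ: "A \<subseteq> ?J" using A genideal_self[of A] by auto
    have KI: "ideal K (mvps_ring n)"
    proof (rule ideal_mvpsI)
      interpret J: ps_ideal n ?J by (rule ps_ideal.intro) (rule MI_ideal[OF upclosed_upset])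
      show "K \<subseteq> pser n" by (auto simp: K_def MI_def)
      show "0 \<in> K" by (auto simp: K_def J.A_zero intro!: exI[of _ "\<lambda>_. 0"])
      show "f + g \<in> K" if f: "f \<in> K" and g: "g \<in> K" for f g
      proof -
        from f g obtain c d where "\<forall>s\<in>QQ. f (scl q s) = (\<Sum>x\<in>A. c x * x (scl q s))"
           "\<forall>s\<in>QQ. g (scl q s) = (\<Sum>x\<in>A. d x * x (scl q s))" by (auto simp: K_def)
        then have "\<forall>s\<in>QQ. (f + g) (scl q s) = (\<Sum>x\<in>A. (c x + d x) * x (scl q s))"
          by (simp add: distrib_right sum.distrib)
        moreover have "f + g \<in> ?J" using f g by (intro J.A_add) (auto simp: K_def)
        ultimately show ?thesis
          unfolding K_def by (intro CollectI conjI exI[of _ "\<lambda>x. c x + d x"])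
      qed
      show "pmul g f \<in> K" if f: "f \<in> K" and g: "g \<in> pser n" for f g
      proof -
        from f obtain c where c: "\<forall>s\<in>QQ. f (scl q s) = (\<Sum>x\<in>A. c x * x (scl q s))" and fJ: "f \<in> ?J"
          by (auto simp: K_def)
        have "pmul g f (scl q s) = (\<Sum>x\<in>A. (g 0 * c x) * x (scl q s))" if s: "s \<in> QQ" for s
        proof -
          have sx: "scl q s \<in> exps n" using scl_QQ_exps s by auto
          have "pmul g f (scl q s) = g 0 * f (scl q s)"
            by (rule pmul_at_minimal[OF fJ sx]) (rule minl[OF s])
          then show ?thesis using c s by (simp add: sum_distrib_left mult.assoc)
        qed
        moreover have "pmul g f \<in> ?J" using J.A_mult[OF fJ g] .
        ultimately show ?thesis
          unfolding K_def by (intro CollectI conjI exI[of _ "\<lambda>x. g 0 * c x"] ballI)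
      qed
    qed
    have "A \<subseteq> K"
    proof
      fix a assume a: "a \<in> A"
      have "a (scl q s) = (\<Sum>x\<in>A. (if x = a then 1 else 0) * x (scl q s))" for s
      proof -
        have "(\<Sum>x\<in>A. (if x = a then 1 else 0) * x (scl q s)) = (\<Sum>x\<in>A. if x = a then a (scl q s) else 0)"
          by (intro sum.cong) auto
        then show ?thesis using a A by simp
      qed
      then show "a \<in> K" using subsetD[OF AJ a] unfolding K_def
        by (intro CollectI conjI exI[of _ "\<lambda>x. if x = a then 1 else 0"] ballI)
    qed
    then have "Idl\<^bsub>mvps_ring n\<^esub> A \<subseteq> K" by (rule genideal_minimal[OF KI])
    then have JK: "?J \<subseteq> K" using A by auto
    fix s0 assume s0: "s0 \<in> QQ"
    have "scl q s0 \<in> ?U" using s0 scl_QQ_exps by (auto simp: upset_def)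
    moreover from this have "scl q s0 \<in> exps n" by (simp add: upset_def)
    ultimately have "(mvps_monom (scl q s0) :: 'k mvps) \<in> ?J" unfolding MI_monom by (rule conjI)
    then have "(mvps_monom (scl q s0) :: 'k mvps) \<in> K" using JK by (rule subsetD[rotated])
    then obtain c where c: "\<forall>s\<in>QQ. (mvps_monom (scl q s0) :: 'k mvps) (scl q s) = (\<Sum>x\<in>A. c x * x (scl q s))"
      by (auto simp: K_def)
    have "scl q s = scl q s0 \<longleftrightarrow> s = s0" if "s \<in> QQ" for s
      using inj_on_eq_iff[OF scl_inj[OF q], of s s0] that s0 by (auto simp: QQ_def MS_def)
    with c show "\<exists>c. \<forall>s\<in>QQ. (if s = s0 then 1 else 0) = (\<Sum>x\<in>A. c x * x (scl q s))"
      by (intro exI[of _ c]) (simp add: mvps_monom_def)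
  qed
  then have "enat (card QQ) \<le> min_num_gens (mvps_ring n) ?J"
    unfolding min_num_gens_def by (intro INF_greatest) auto
  moreover have "min_num_gens (mvps_ring n) ?J \<le> enat (card QQ)"
  proof -
    let ?A = "mvps_monom ` scl q ` QQ :: 'k mvps set"
    have "?A \<in> ?S"
      using Idl_monoms[OF scl_QQ_exps, where ?'k = 'k, of q] QQ_finite scl_QQ_exps[of q]
      by (auto simp: mvps_ring_simps(1) mvps_monom_eq)
    then have "min_num_gens (mvps_ring n) ?J \<le> enat (card ?A)"
      unfolding min_num_gens_def by (rule INF_lower)
    also have "card ?A \<le> card QQ"
      by (metis QQ_finite card_image_le finite_imageI order_trans)
    finally show ?thesis by simp
  qed
  ultimately show ?thesis by (rule antisym[rotated])
qed

end

section \<open>The injective hull as a module of functionals\<close>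

text \<open>A finitely supported \<open>z\<close> is read as a continuous functional on power series, with \<open>z c\<close> its value
  at the monomial with exponent \<open>c\<close>; power series act by contraction.\<close>

definition act :: "'k::comm_ring mvps \<Rightarrow> 'k mvps \<Rightarrow> 'k mvps" where
  "act f z b = (\<Sum>c\<in>{c. z c \<noteq> 0 \<and> b \<le> c}. f (c - b) * z c)"

lemma act_eq_sum:
  assumes "finite D" "\<And>c. z c \<noteq> 0 \<Longrightarrow> c \<in> D"
  shows "act f z b = (\<Sum>c\<in>D. if b \<le> c then f (c - b) * z c else 0)"
proof -
  have "act f z b = (\<Sum>c\<in>{c. z c \<noteq> 0 \<and> b \<le> c}. if b \<le> c then f (c - b) * z c else 0)"
    unfolding act_def by (intro sum.cong) auto
  also have "\<dots> = (\<Sum>c\<in>D. if b \<le> c then f (c - b) * z c else 0)"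
    using assms by (intro sum.mono_neutral_left) auto
  finally show ?thesis .
qed

lemma act_nonzeroD:
  assumes "act f z b \<noteq> 0"
  shows "\<exists>c. z c \<noteq> 0 \<and> b \<le> c \<and> f (c - b) \<noteq> 0"
proof (rule ccontr)
  assume no: "\<not> ?thesis"
  have "act f z b = 0" unfolding act_def
  proof (rule sum.neutral, rule ballI)
    fix c assume "c \<in> {c. z c \<noteq> 0 \<and> b \<le> c}"
    with no have "f (c - b) = 0" by auto
    then show "f (c - b) * z c = 0" by simp
  qed
  with assms show False by simp
qed

definition fsupp :: "nat \<Rightarrow> 'k::zero mvps set" where
  "fsupp n = {z. finite {c. z c \<noteq> 0} \<and> (\<forall>c. z c \<noteq> 0 \<longrightarrow> c \<in> exps n)}"

lemma fsuppD: "z \<in> fsupp n \<Longrightarrow> finite {c. z c \<noteq> 0}" "z \<in> fsupp n \<Longrightarrow> z c \<noteq> 0 \<Longrightarrow> c \<in> exps n"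
  by (auto simp: fsupp_def)

lemma act_fsupp:
  assumes z: "z \<in> fsupp n"
  shows "act f z \<in> fsupp n"
proof -
  let ?D = "\<Union>c\<in>{c. z c \<noteq> 0}. {b. b \<le> c}"
  have "finite ?D" using fsuppD[OF z] finite_le_exp by (intro finite_UN_I) auto
  moreover have "b \<in> ?D \<and> b \<in> exps n" if "act f z b \<noteq> 0" for b
  proof -
    from act_nonzeroD[OF that] obtain c where c: "z c \<noteq> 0" "b \<le> c" by auto
    with exps_mono[OF fsuppD(2)[OF z c(1)] c(2)] show ?thesis by auto
  qed
  ultimately show ?thesis
    unfolding fsupp_def by (auto intro: finite_subset[of _ ?D])
qed

lemma act_add_left: "z \<in> fsupp n \<Longrightarrow> act (f + g) z = act f z + act g z"
proof
  fix b assume z: "z \<in> fsupp n"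
  note e = act_eq_sum[of "{c. z c \<noteq> 0}" z _ b, OF fsuppD(1)[OF z]]
  show "act (f + g) z b = (act f z + act g z) b"
    by (simp add: e sum.distrib[symmetric] distrib_right if_distrib cong: if_cong)
qed

lemma act_add_right:
  assumes "z \<in> fsupp n" "w \<in> fsupp n"
  shows "act f (z + w) = act f z + act f w"
proof
  fix b
  let ?D = "{c. z c \<noteq> 0} \<union> {c. w c \<noteq> 0}"
  have fin: "finite ?D" using fsuppD(1)[OF assms(1)] fsuppD(1)[OF assms(2)] by simp
  have "act f (z + w) b = (\<Sum>c\<in>?D. if b \<le> c then f (c - b) * (z + w) c else 0)"
    by (rule act_eq_sum[OF fin, of "z + w"]) auto
  also have "\<dots> = (\<Sum>c\<in>?D. if b \<le> c then f (c - b) * z c else 0) + (\<Sum>c\<in>?D. if b \<le> c then f (c - b) * w c else 0)"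
    unfolding sum.distrib[symmetric] by (intro sum.cong) (auto simp: distrib_left)
  also have "(\<Sum>c\<in>?D. if b \<le> c then f (c - b) * z c else 0) = act f z b"
    by (rule act_eq_sum[OF fin, symmetric]) auto
  also have "(\<Sum>c\<in>?D. if b \<le> c then f (c - b) * w c else 0) = act f w b"
    by (rule act_eq_sum[OF fin, symmetric]) auto
  finally show "act f (z + w) b = (act f z + act f w) b"
    unfolding plus_fun_apply[of "act f z"] .
qed

lemma act_pmul:
  assumes z: "z \<in> fsupp n"
  shows "act (pmul f g) z = act f (act g z)"
proof
  fix b
  let ?Z = "{c. z c \<noteq> 0}"
  let ?D = "\<Union>c\<in>?Z. {b. b \<le> c}"
  have finZ: "finite ?Z" by (rule fsuppD(1)[OF z])
  have finD: "finite ?D" using fsuppD[OF z] finite_le_exp by (intro finite_UN_I) auto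
  have D: "c \<in> ?D" if "act g z c \<noteq> 0" for c using act_nonzeroD[OF that] by auto
  have inner: "(\<Sum>c\<in>?D. if b \<le> c then f (c - b) * (if c \<le> d then g (d - c) * z d else 0) else 0) =
      (if b \<le> d then pmul f g (d - b) * z d else 0)" if d: "z d \<noteq> 0" for d
  proof -
    have "(\<Sum>c\<in>?D. if b \<le> c then f (c - b) * (if c \<le> d then g (d - c) * z d else 0) else 0) =
       (\<Sum>c\<in>{c. b \<le> c \<and> c \<le> d}. f (c - b) * g (d - c) * z d)"
    proof (rule sum.mono_neutral_cong_right[OF finD])
      show "{c. b \<le> c \<and> c \<le> d} \<subseteq> ?D" using d by auto
    qed (auto simp: mult.assoc)
    also have "\<dots> = (if b \<le> d then pmul f g (d - b) * z d else 0)"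
    proof (cases "b \<le> d")
      case True
      have "(\<Sum>c\<in>{c. b \<le> c \<and> c \<le> d}. f (c - b) * g (d - c) * z d) =
          (\<Sum>x\<in>{x. x \<le> d - b}. f x * g (d - b - x) * z d)"
      proof (rule sum.reindex_bij_witness[where i = "\<lambda>x. x + b" and j = "\<lambda>c. c - b"])
        fix c assume c: "c \<in> {c. b \<le> c \<and> c \<le> d}"
        then have "b i \<le> c i" "c i \<le> d i" for i by (auto simp: le_fun_def)
        then have "c - b + b = c \<and> c - b \<in> {x. x \<le> d - b} \<and> d - b - (c - b) = d - c"
          by (auto simp: fun_eq_iff le_fun_def diff_le_mono)
        then show "c - b + b = c" "c - b \<in> {x. x \<le> d - b}"
            "f (c - b) * g (d - b - (c - b)) * z d = f (c - b) * g (d - c) * z d"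
          by auto
      next
        fix x assume "x \<in> {x. x \<le> d - b}"
        then have *: "x i \<le> d i - b i" for i by (auto simp: le_fun_def)
        have "b i \<le> d i" for i using True by (simp add: le_fun_def)
        with * have "x i + b i \<le> d i" for i by (metis le_diff_conv2)
        then show "x + b - b = x" "x + b \<in> {c. b \<le> c \<and> c \<le> d}" by (auto simp: fun_eq_iff le_fun_def)
      qed
      with True show ?thesis by (simp add: pmul_def sum_distrib_right)
    next
      case False
      have "{c. b \<le> c \<and> c \<le> d} = {}"
      proof (rule ccontr)
        assume "{c. b \<le> c \<and> c \<le> d} \<noteq> {}"
        then obtain c where "b \<le> c" "c \<le> d" by auto
        with False show False using order_trans[of b c d] by simp
      qed
      then show ?thesis using False by (simp only: sum.empty if_False)
    qed
    finally show ?thesis .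
  qed
  have ag: "act g z c = (\<Sum>d\<in>?Z. if c \<le> d then g (d - c) * z d else 0)" for c
    by (rule act_eq_sum[OF finZ]) simp
  have "act f (act g z) b = (\<Sum>c\<in>?D. if b \<le> c then f (c - b) * act g z c else 0)"
    by (rule act_eq_sum[OF finD D])
  also have "\<dots> = (\<Sum>c\<in>?D. if b \<le> c then f (c - b) * (\<Sum>d\<in>?Z. if c \<le> d then g (d - c) * z d else 0) else 0)"
    by (simp only: ag)
  also have "\<dots> = (\<Sum>c\<in>?D. \<Sum>d\<in>?Z. if b \<le> c then f (c - b) * (if c \<le> d then g (d - c) * z d else 0) else 0)"
    by (intro sum.cong refl) (simp add: sum_distrib_left)
  also have "\<dots> = (\<Sum>d\<in>?Z. \<Sum>c\<in>?D. if b \<le> c then f (c - b) * (if c \<le> d then g (d - c) * z d else 0) else 0)"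
    by (rule sum.swap)
  also have "\<dots> = (\<Sum>d\<in>?Z. if b \<le> d then pmul f g (d - b) * z d else 0)"
    by (intro sum.cong refl inner) simp
  also have "\<dots> = act (pmul f g) z b"
    by (rule act_eq_sum[OF finZ, symmetric]) simp
  finally show "act (pmul f g) z b = act f (act g z) b" by simp
qed

lemma act_pterm:
  assumes "finite {c. z c \<noteq> 0}"
  shows "act (pterm a t) z b = t * z (a + b)"
proof -
  have "act (pterm a t) z b = (\<Sum>c\<in>{c. z c \<noteq> 0 \<and> b \<le> c}. if c = a + b then t * z (a + b) else 0)"
    unfolding act_def
  proof (rule sum.cong[OF refl])
    fix c assume "c \<in> {c. z c \<noteq> 0 \<and> b \<le> c}"
    then have "c = a + b \<longleftrightarrow> c - b = a"
      using add_eq_iff_le_diff[of b a c] by (auto simp: add.commute)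
    then show "pterm a t (c - b) * z c = (if c = a + b then t * z (a + b) else 0)"
      by (auto simp: pterm_def)
  qed
  also have "\<dots> = t * z (a + b)"
    using assms by (cases "z (a + b) = 0") (auto simp: le_fun_def intro!: sum.neutral)
  finally show ?thesis .
qed

text \<open>This coefficient is the value of the functional \<open>z\<close> at \<open>f\<close>;
  the other coefficients are obtained after multiplying \<open>f\<close> by monomials.\<close>

lemma act_at_zero: "act f z 0 = (\<Sum>c\<in>{c. z c \<noteq> 0}. f c * z c)"
proof -
  have "c - 0 = c" "0 \<le> c" for c :: "nat \<Rightarrow> nat" by (simp_all add: fun_eq_iff le_fun_def)
  then show ?thesis by (simp add: act_def)
qed

lemma fsupp_zero: "0 \<in> fsupp n" by (simp add: fsupp_def)

lemma fsupp_add: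
  fixes z w :: "'k::comm_ring mvps"
  assumes z: "z \<in> fsupp n" and w: "w \<in> fsupp n"
  shows "z + w \<in> fsupp n"
proof -
  have "finite ({c. z c \<noteq> 0} \<union> {c. w c \<noteq> 0})" using fsuppD(1)[OF z] fsuppD(1)[OF w] by simp
  moreover have "{c. (z + w) c \<noteq> 0} \<subseteq> {c. z c \<noteq> 0} \<union> {c. w c \<noteq> 0}" by auto
  ultimately have "finite {c. (z + w) c \<noteq> 0}" by (rule finite_subset[rotated])
  moreover have "c \<in> exps n" if c: "(z + w) c \<noteq> 0" for c
    using c fsuppD(2)[OF z, of c] fsuppD(2)[OF w, of c] by (cases "z c = 0") auto
  ultimately show ?thesis by (simp add: fsupp_def)
qed

section \<open>The model of the injective hull\<close>

context antichain
begin

definition EE :: "'k::field mvps set" where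
  "EE = {z \<in> fsupp n. \<forall>c. z c \<noteq> 0 \<longrightarrow> c \<in> NN}"

lemma EE_fsupp: "z \<in> EE \<Longrightarrow> z \<in> fsupp n" and EE_NN: "z \<in> EE \<Longrightarrow> z c \<noteq> 0 \<Longrightarrow> c \<in> NN"
  by (auto simp: EE_def)

lemma EE_zero: "0 \<in> EE"
  by (simp add: EE_def fsupp_zero)

lemma EE_add: "z \<in> EE \<Longrightarrow> w \<in> EE \<Longrightarrow> z + w \<in> EE"
proof -
  assume z: "z \<in> EE" and w: "w \<in> EE"
  have "c \<in> NN" if "(z + w) c \<noteq> 0" for c
    using EE_NN[OF z, of c] EE_NN[OF w, of c] that by (cases "z c = 0") auto
  with fsupp_add[OF EE_fsupp[OF z] EE_fsupp[OF w]] show ?thesis by (simp add: EE_def)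
qed

lemma EE_minus: "z \<in> EE \<Longrightarrow> - z \<in> EE"
  by (simp add: EE_def fsupp_def)

lemma EE_act: "z \<in> EE \<Longrightarrow> act f z \<in> EE"
proof -
  assume z: "z \<in> EE"
  have "b \<in> NN" if "act f z b \<noteq> 0" for b
  proof -
    from act_nonzeroD[OF that] obtain c where "z c \<noteq> 0" "b \<le> c" by auto
    with NN_down[OF EE_NN[OF z]] show ?thesis by auto
  qed
  with act_fsupp[OF EE_fsupp[OF z]] show ?thesis by (simp add: EE_def)
qed

lemma EE_pterm: "a \<in> NN \<Longrightarrow> pterm a t \<in> EE"
  using NN_exps by (auto simp: EE_def fsupp_def pterm_def)

lemma act_ideal_zero:
  assumes "f \<in> MI n (cov n FF)" "z \<in> EE"
  shows "act f z = 0"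
proof
  fix b
  show "act f z b = 0 b"
  proof (rule ccontr)
    assume "act f z b \<noteq> 0 b"
    then have "act f z b \<noteq> 0" by simp
    from act_nonzeroD[OF this] obtain c where c: "z c \<noteq> 0" "b \<le> c" "f (c - b) \<noteq> 0" by auto
    have "c - b \<le> c" by (simp add: le_fun_def)
    from NN_down[OF EE_NN[OF assms(2) c(1)] this] c(3) assms(1) show False
      by (auto simp: MI_def cov_NN)
  qed
qed

lemma act_one: "z \<in> EE \<Longrightarrow> act (pterm 0 1) z = z"
  by (rule ext) (simp add: act_pterm fsuppD(1)[OF EE_fsupp])

text \<open>The socle element is reached by contracting with a monomial of maximal degree.\<close>

lemma EE_socle:
  assumes z: "z \<in> EE" "z \<noteq> 0"
  shows "\<exists>a\<in>exps n. \<exists>c. c \<noteq> 0 \<and> act (pterm a 1) z = pterm 0 c"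
proof -
  have fin: "finite {c. z c \<noteq> 0}" by (rule fsuppD(1)[OF EE_fsupp[OF z(1)]])
  have ne: "{c. z c \<noteq> 0} \<noteq> {}" using z(2) by (auto simp: fun_eq_iff)
  define a where "a = (ARG_MAX (ev n) c. z c \<noteq> 0)"
  have "finite (ev n ` {c. z c \<noteq> 0})" using fin by simp
  then obtain K where K: "\<And>c. z c \<noteq> 0 \<Longrightarrow> ev n c \<le> K" using Max_ge by (metis (mono_tags) imageI mem_Collect_eq)
  obtain c0 where c0: "z c0 \<noteq> 0" using ne by auto
  have amax: "z a \<noteq> 0 \<and> (\<forall>c. z c \<noteq> 0 \<longrightarrow> ev n c \<le> ev n a)"
    unfolding a_def by (rule arg_max_nat_lemma[where P = "\<lambda>c. z c \<noteq> 0" and b = "Suc K"])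
      (use c0 K in \<open>auto simp: less_Suc_eq_le\<close>)
  have ax: "a \<in> exps n" using fsuppD(2)[OF EE_fsupp[OF z(1)]] amax by auto
  have "act (pterm a 1) z = pterm 0 (z a)"
  proof
    fix b
    show "act (pterm a 1) z b = pterm 0 (z a) b"
    proof (cases "b = 0")
      case False
      have "z (a + b) = 0"
      proof (rule ccontr)
        assume nz: "z (a + b) \<noteq> 0"
        then have "a + b \<in> exps n" using fsuppD(2)[OF EE_fsupp[OF z(1)]] by auto
        then have bx: "b \<in> exps n" by (simp add: exps_add)
        have "ev n a * ev n b \<le> ev n a" using amax nz ev_add[of n a b] by auto
        then have "ev n b \<le> 1" using ev_pos[of n a] by simp
        moreover have "ev n 0 = 1" by (simp add: ev_def)
        ultimately have "ev n b = ev n 0" using ev_pos[of n b] by linarith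
        from ev_inj[OF bx _ this] False show False by simp
      qed
      then have "act (pterm a 1) z b = 0" by (simp only: act_pterm[OF fin] mult_zero_right)
      with False show ?thesis by (simp add: pterm_def)
    next
      case True
      then have "act (pterm a 1) z b = z a" by (simp only: act_pterm[OF fin] add_0_right mult_1_left)
      with True show ?thesis by (simp add: pterm_def)
    qed
  qed
  with ax amax show ?thesis by blast
qed

end

lemma carrier_Quot_image: "carrier (A Quot B) = (\<lambda>r. B +>\<^bsub>A\<^esub> r) ` carrier A"
  by (auto simp: FactRing_def A_RCOSETS_def')

section \<open>The Stanley-Reisner ring and its maximal ideal\<close>

locale hull = antichain n FF for n FF +
  fixes E :: "('k::field mvps set, 'e) module"
  assumes hull: "injective_hull (mvps_ring n Quot MI n (cov n FF))
    (residue_field_module (mvps_ring n Quot MI n (cov n FF))) E"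
begin

abbreviation "SS \<equiv> mvps_ring n :: 'k mvps ring"
abbreviation "II \<equiv> MI n (cov n FF) :: 'k mvps set"
abbreviation "RR \<equiv> SS Quot II"

definition cl :: "'k mvps \<Rightarrow> 'k mvps set" where
  "cl f = II +>\<^bsub>SS\<^esub> f"

lemma II_ideal: "ideal II SS"
  by (rule MI_ideal[OF upclosed_cov])

lemma SS_cring: "cring SS" by (rule cring_mvps)

lemma RR_cring: "cring RR"
  using ideal.quotient_is_cring[OF II_ideal SS_cring] .

lemma cl_hom: "ring_hom_ring SS RR cl"
  using ideal.rcos_ring_hom_ring[OF II_ideal] by (simp add: cl_def[abs_def])

lemma carrier_RR: "carrier RR = cl ` pser n"
  by (auto simp: FactRing_def A_RCOSETS_def' cl_def mvps_ring_simps(1))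

lemma cl_carrier: "f \<in> pser n \<Longrightarrow> cl f \<in> carrier RR"
  by (simp add: carrier_RR)

lemma cl_add: "f \<in> pser n \<Longrightarrow> g \<in> pser n \<Longrightarrow> cl (f + g) = cl f \<oplus>\<^bsub>RR\<^esub> cl g"
  using ring_hom_ring.homh[OF cl_hom] ring_hom_add[of cl SS RR f g] by (simp add: mvps_ring_simps)

lemma cl_mult: "f \<in> pser n \<Longrightarrow> g \<in> pser n \<Longrightarrow> cl (pmul f g) = cl f \<otimes>\<^bsub>RR\<^esub> cl g"
  using ring_hom_ring.homh[OF cl_hom] ring_hom_mult[of cl SS RR f g] by (simp add: mvps_ring_simps)

lemma cl_one: "cl (pterm 0 1) = \<one>\<^bsub>RR\<^esub>"
  using ring_hom_ring.homh[OF cl_hom] ring_hom_one[of cl SS RR] by (simp add: mvps_ring_simps)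

lemma cl_zero: "cl 0 = \<zero>\<^bsub>RR\<^esub>"
  using ring_hom_zero[OF ring_hom_ring.homh[OF cl_hom] cring.axioms(1)[OF SS_cring] cring.axioms(1)[OF RR_cring]]
  by (simp add: mvps_ring_simps)

lemma cl_pow: "f \<in> pser n \<Longrightarrow> cl f [^]\<^bsub>RR\<^esub> (m::nat) = cl (f [^]\<^bsub>SS\<^esub> m)"
  using ring_hom_ring.hom_nat_pow[OF cl_hom, of f m] by (simp add: mvps_ring_simps(1))

lemma cl_eq_iff:
  assumes "f \<in> pser n" "g \<in> pser n"
  shows "cl f = cl g \<longleftrightarrow> f - g \<in> II"
proof -
  interpret S: cring SS by (rule SS_cring)
  have "\<ominus>\<^bsub>SS\<^esub> g = - g"
    using assms(2) by (intro S.minus_equality) (auto simp: mvps_ring_simps)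
  then have "f \<ominus>\<^bsub>SS\<^esub> g = f - g" by (simp add: a_minus_def mvps_ring_simps)
  then show ?thesis
    unfolding cl_def using S.quotient_eq_iff_same_a_r_cos[OF II_ideal, of f g] assms
    by (simp add: mvps_ring_simps(1))
qed

lemma cl_self: "f \<in> pser n \<Longrightarrow> f \<in> cl f"
proof -
  assume f: "f \<in> pser n"
  have "0 \<in> II" by (simp add: MI_def)
  then have "0 \<oplus>\<^bsub>SS\<^esub> f \<in> cl f" unfolding cl_def by (auto simp: a_r_coset_def' mvps_ring_simps)
  then show ?thesis by (simp add: mvps_ring_simps)
qed

lemma cl_memD: "g \<in> cl f \<Longrightarrow> f \<in> pser n \<Longrightarrow> g \<in> pser n \<and> g - f \<in> II"
  by (auto simp: cl_def a_r_coset_def' mvps_ring_simps MI_def)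

lemma RR_idealI:
  assumes A: "ideal A SS"
  shows "ideal (cl ` A) RR"
proof -
  interpret R: cring RR by (rule RR_cring)
  interpret A: ps_ideal n A by (rule ps_ideal.intro[OF A])
  have Ap: "a \<in> pser n" if "a \<in> A" for a using A.A_pser that by auto
  show ?thesis
  proof (rule idealI)
    show "ring RR" by (rule R.ring_axioms)
    show "subgroup (cl ` A) (add_monoid RR)"
    proof (rule R.add.subgroupI)
      show "cl ` A \<subseteq> carrier RR" using Ap by (auto simp: cl_carrier)
      show "cl ` A \<noteq> {}" using A.A_zero by auto
      fix x assume "x \<in> cl ` A"
      then obtain a where a: "a \<in> A" "x = cl a" by auto
      have "- a \<in> A" using A.A_diff[OF A.A_zero a(1)] by simp
      moreover have "cl (- a) \<oplus>\<^bsub>RR\<^esub> cl a = \<zero>\<^bsub>RR\<^esub>"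
        using cl_add[of "- a" a] a Ap by (simp add: pser_minus cl_zero)
      then have "\<ominus>\<^bsub>RR\<^esub> x = cl (- a)"
        using a Ap by (intro R.minus_equality) (auto simp: cl_carrier pser_minus)
      ultimately show "\<ominus>\<^bsub>RR\<^esub> x \<in> cl ` A" by simp
      fix y assume "y \<in> cl ` A"
      then obtain b where b: "b \<in> A" "y = cl b" by auto
      then show "x \<oplus>\<^bsub>RR\<^esub> y \<in> cl ` A"
        using a A.A_add[OF a(1) b(1)] cl_add[of a b] Ap by (auto simp del: plus_fun_apply)
    qed
    fix x r assume "x \<in> cl ` A" "r \<in> carrier RR"
    then obtain a f where af: "a \<in> A" "x = cl a" "f \<in> pser n" "r = cl f" by (auto simp: carrier_RR)
    then have "r \<otimes>\<^bsub>RR\<^esub> x = cl (pmul f a)" using Ap by (simp add: cl_mult)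
    then show "r \<otimes>\<^bsub>RR\<^esub> x \<in> cl ` A" using A.A_mult[OF af(1,3)] by simp
    then show "x \<otimes>\<^bsub>RR\<^esub> r \<in> cl ` A"
      using af Ap R.m_comm[of x r] by (simp add: cl_carrier)
  qed
qed

definition m0 :: "'k mvps set set" where
  "m0 = cl ` {f \<in> pser n. f 0 = 0}"

lemma pmul_zero_coeff: "pmul g f 0 = g 0 * f 0"
proof -
  have "{b. b \<le> (0 :: nat \<Rightarrow> nat)} = {0}" by (auto simp: le_fun_def fun_eq_iff)
  then show ?thesis by (simp add: pmul_def fun_diff_def zero_fun_def)
qed

lemma m0_ideal: "ideal m0 RR"
  unfolding m0_def
  by (intro RR_idealI ideal_mvpsI) (auto simp: pmul_zero_coeff)

lemma cl_in_m0:
  assumes "f \<in> pser n" "cl f \<in> m0"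
  shows "f 0 = 0"
proof -
  from assms(2) obtain g where g: "g \<in> pser n" "g 0 = 0" "cl f = cl g" by (auto simp: m0_def)
  then have "f - g \<in> II" using assms cl_eq_iff by simp
  have "(f - g) 0 = 0"
  proof (rule ccontr)
    assume "(f - g) 0 \<noteq> 0"
    with \<open>f - g \<in> II\<close> have "0 \<in> cov n FF" unfolding MI_def by blast
    with zero_NN show False by (simp add: cov_NN)
  qed
  with g show ?thesis by (simp add: fun_diff_def)
qed

text \<open>An element outside \<open>m0\<close> has a representative with nonzero constant term, so
  the preimage of \<open>J\<close> in the power series ring would be everything.\<close>

lemma proper_ideal_le_m0:
  assumes J: "ideal J RR" "J \<noteq> carrier RR"
  shows "J \<subseteq> m0"
proof (rule ccontr)
  interpret R: cring RR by (rule RR_cring)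
  interpret J: ideal J RR by fact
  assume "\<not> J \<subseteq> m0"
  then obtain x where x: "x \<in> J" "x \<notin> m0" by auto
  then have "x \<in> carrier RR" using J.a_subset by auto
  then obtain f where f: "f \<in> pser n" "x = cl f" by (auto simp: carrier_RR)
  have "ideal {g \<in> pser n. cl g \<in> J} SS"
  proof (rule ideal_mvpsI)
    show "0 \<in> {g \<in> pser n. cl g \<in> J}" using J.zero_closed by (simp add: cl_zero)
  next
    fix g h assume "g \<in> {g \<in> pser n. cl g \<in> J}" "h \<in> {g \<in> pser n. cl g \<in> J}"
    then show "g + h \<in> {g \<in> pser n. cl g \<in> J}" by (auto simp: cl_add pser_add J.a_closed)
  next
    fix g h :: "'k mvps" assume "g \<in> {g \<in> pser n. cl g \<in> J}" "h \<in> pser n"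
    then show "pmul h g \<in> {g \<in> pser n. cl g \<in> J}" by (auto simp: cl_mult pser_pmul J.I_l_closed cl_carrier)
  qed auto
  then interpret A: ps_ideal n "{g \<in> pser n. cl g \<in> J}" by (rule ps_ideal.intro)
  have "f 0 \<noteq> 0" using x f by (auto simp: m0_def)
  then have "{g \<in> pser n. cl g \<in> J} = pser n"
    using x f by (intro A.const_term_nonzero[of f]) auto
  then have "cl g \<in> J" if "g \<in> pser n" for g using that by blast
  then have "carrier RR \<subseteq> J" by (auto simp: carrier_RR)
  with J J.a_subset show False by auto
qed

lemma m0_proper: "m0 \<noteq> carrier RR"
proof
  assume "m0 = carrier RR"
  moreover have one: "pterm 0 1 \<in> (pser n :: 'k mvps set)" by (intro pser_pterm zero_in_exps)
  ultimately have "cl (pterm 0 1) \<in> m0" by (simp add: cl_carrier)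
  from cl_in_m0[OF one this] show False by (simp add: pterm_def)
qed

lemma the_maximalideal: "(THE M. maximalideal M RR) = m0"
proof (rule the_equality)
  show "maximalideal m0 RR"
  proof (rule maximalidealI[OF m0_ideal])
    show "carrier RR \<noteq> m0" using m0_proper by simp
    fix J assume "ideal J RR" "m0 \<subseteq> J"
    then show "J = m0 \<or> J = carrier RR" using proper_ideal_le_m0[of J] by auto
  qed
  fix M assume M: "maximalideal M RR"
  then have "ideal M RR" "carrier RR \<noteq> M" by (auto simp: maximalideal_def maximalideal_axioms_def)
  then have "M \<subseteq> m0" by (intro proper_ideal_le_m0) auto
  moreover have "m0 \<subseteq> carrier RR" using ideal.axioms(1)[OF m0_ideal] additive_subgroup.a_subset by blast
  ultimately show "M = m0"
    using maximalideal.I_maximal[OF M m0_ideal] m0_proper by auto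
qed

lemma E_injective: "injective_module RR E"
  using hull by (simp add: injective_hull_def)

lemma E_module: "module RR E"
  using E_injective by (simp add: injective_module_def)

section \<open>Socle of the given hull and embedding of the model\<close>

text \<open>\<open>E\<close> as a module over the power series ring, which spares the choice of
  representatives.\<close>

definition sm :: "'k mvps \<Rightarrow> 'e \<Rightarrow> 'e" where
  "sm f y = cl f \<odot>\<^bsub>E\<^esub> y"

sublocale E: module RR E by (rule E_module)

lemma sm_closed: "f \<in> pser n \<Longrightarrow> y \<in> carrier E \<Longrightarrow> sm f y \<in> carrier E"
  by (simp add: sm_def cl_carrier)

lemma sm_add_left: "f \<in> pser n \<Longrightarrow> g \<in> pser n \<Longrightarrow> y \<in> carrier E \<Longrightarrow> sm (f + g) y = sm f y \<oplus>\<^bsub>E\<^esub> sm g y"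
  by (simp add: sm_def cl_carrier cl_add E.smult_l_distr)

lemma sm_add_right: "f \<in> pser n \<Longrightarrow> x \<in> carrier E \<Longrightarrow> y \<in> carrier E \<Longrightarrow> sm f (x \<oplus>\<^bsub>E\<^esub> y) = sm f x \<oplus>\<^bsub>E\<^esub> sm f y"
  by (simp add: sm_def cl_carrier E.smult_r_distr)

lemma sm_mult: "f \<in> pser n \<Longrightarrow> g \<in> pser n \<Longrightarrow> y \<in> carrier E \<Longrightarrow> sm (pmul f g) y = sm f (sm g y)"
  by (simp add: sm_def cl_carrier cl_mult E.smult_assoc1)

lemma sm_one: "y \<in> carrier E \<Longrightarrow> sm (pterm 0 1) y = y"
  by (simp add: sm_def cl_one)

lemma sm_ideal: "f \<in> II \<Longrightarrow> y \<in> carrier E \<Longrightarrow> sm f y = \<zero>\<^bsub>E\<^esub>"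
proof -
  assume f: "f \<in> II" and y: "y \<in> carrier E"
  then have fp: "f \<in> pser n" by (simp add: MI_def)
  have "f - 0 \<in> II" using f by simp
  then have "cl f = cl 0" using cl_eq_iff[OF fp pser_zero] by simp
  then show ?thesis using y by (simp add: sm_def cl_zero)
qed

text \<open>\<open>e0\<close> is the image of the class of \<open>1\<close> under the embedding of
  the residue field. That copy consists of the scalar multiples of \<open>e0\<close>, which is how
  essentiality takes the form of the last claim.\<close>

lemma socle:
  "\<exists>e0\<in>carrier E. e0 \<noteq> \<zero>\<^bsub>E\<^esub> \<and> (\<forall>f\<in>pser n. f 0 = 0 \<longrightarrow> sm f e0 = \<zero>\<^bsub>E\<^esub>) \<and>
     (\<forall>N. submodule N RR E \<and> N \<noteq> {\<zero>\<^bsub>E\<^esub>} \<longrightarrow> (\<exists>c. c \<noteq> 0 \<and> sm (pterm 0 c) e0 \<in> N))"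
proof -
  interpret m0: ideal m0 RR by (rule m0_ideal)
  let ?k = "residue_field_module RR" and ?c = "\<lambda>r. m0 +>\<^bsub>RR\<^esub> r"
  have kc: "carrier ?k = ?c ` carrier RR"
    by (simp only: residue_field_module_def the_maximalideal quotient_module_def partial_object.simps carrier_Quot_image)
  have ks: "smult ?k r x = ?c r \<otimes>\<^bsub>RR Quot m0\<^esub> x" for r x
    by (simp add: residue_field_module_def the_maximalideal quotient_module_def)
  have ksc: "smult ?k r (?c s) = ?c (r \<otimes>\<^bsub>RR\<^esub> s)" if "r \<in> carrier RR" "s \<in> carrier RR" for r s
    using ring_hom_mult[OF m0.rcos_ring_hom that] by (simp add: ks)
  from hull obtain i where i: "i \<in> mod_homs RR ?k E" "inj_on i (carrier ?k)"
     "\<forall>N. submodule N RR E \<and> N \<noteq> {\<zero>\<^bsub>E\<^esub>} \<longrightarrow> N \<inter> i ` carrier ?k \<noteq> {\<zero>\<^bsub>E\<^esub>}"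
    unfolding injective_hull_def by (elim conjE bexE)
  have i_sm: "i (?c r) = r \<odot>\<^bsub>E\<^esub> i (?c \<one>\<^bsub>RR\<^esub>)" if r: "r \<in> carrier RR" for r
  proof -
    have "i (smult ?k r (?c \<one>\<^bsub>RR\<^esub>)) = r \<odot>\<^bsub>E\<^esub> i (?c \<one>\<^bsub>RR\<^esub>)"
      using i(1) r unfolding mod_homs_def kc by auto
    then show ?thesis using r by (simp add: ksc)
  qed
  define e0 where "e0 = i (?c \<one>\<^bsub>RR\<^esub>)"
  have e0: "e0 \<in> carrier E" using i(1) by (auto simp: e0_def mod_homs_def kc)
  have isf: "i (?c (cl f)) = sm f e0" if "f \<in> pser n" for f
    using i_sm[OF cl_carrier[OF that]] by (simp add: sm_def e0_def)
  have zero: "?c x = ?c \<zero>\<^bsub>RR\<^esub>" if "x \<in> m0" for x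
  proof -
    have xc: "x \<in> carrier RR" using that m0.a_subset by (rule subsetD[rotated])
    then have "x \<ominus>\<^bsub>RR\<^esub> \<zero>\<^bsub>RR\<^esub> = x" by (simp add: a_minus_def)
    then show ?thesis
      using ring.quotient_eq_iff_same_a_r_cos[OF cring.axioms(1)[OF RR_cring] m0_ideal xc E.R.zero_closed] that by simp
  qed
  have c0: "i (?c \<zero>\<^bsub>RR\<^esub>) = \<zero>\<^bsub>E\<^esub>" using i_sm[of "\<zero>\<^bsub>RR\<^esub>"] e0 by (simp add: e0_def)
  have kill: "sm f e0 = \<zero>\<^bsub>E\<^esub>" if "f \<in> pser n" "f 0 = 0" for f
    using isf[OF that(1)] zero[of "cl f"] that c0 by (auto simp: m0_def)
  have "e0 \<noteq> \<zero>\<^bsub>E\<^esub>"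
  proof
    assume "e0 = \<zero>\<^bsub>E\<^esub>"
    then have "i (?c \<one>\<^bsub>RR\<^esub>) = i (?c \<zero>\<^bsub>RR\<^esub>)" by (simp add: c0 e0_def)
    then have "?c \<one>\<^bsub>RR\<^esub> = ?c \<zero>\<^bsub>RR\<^esub>" using i(2) unfolding kc inj_on_def by blast
    then have "\<one>\<^bsub>RR\<^esub> \<ominus>\<^bsub>RR\<^esub> \<zero>\<^bsub>RR\<^esub> \<in> m0"
      using ring.quotient_eq_iff_same_a_r_cos[OF cring.axioms(1)[OF RR_cring] m0_ideal, of "\<one>\<^bsub>RR\<^esub>" "\<zero>\<^bsub>RR\<^esub>"] by simp
    then have "\<one>\<^bsub>RR\<^esub> \<in> m0" by (simp add: a_minus_def)
    then show False using m0.one_imp_carrier m0_proper by auto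
  qed
  moreover have "\<exists>c. c \<noteq> 0 \<and> sm (pterm 0 c) e0 \<in> N" if N: "submodule N RR E" "N \<noteq> {\<zero>\<^bsub>E\<^esub>}" for N
  proof -
    have "\<zero>\<^bsub>E\<^esub> \<in> N" using subgroup.one_closed[OF submodule.axioms(1)[OF N(1)]] by simp
    moreover have "\<zero>\<^bsub>E\<^esub> \<in> i ` carrier ?k" unfolding kc using imageI[OF imageI[OF E.R.zero_closed, of ?c], of i] by (simp only: c0)
    ultimately obtain x where x: "x \<in> N" "x \<in> i ` carrier ?k" "x \<noteq> \<zero>\<^bsub>E\<^esub>" using i(3)[rule_format, OF conjI[OF N]] by auto
    then obtain f where f: "f \<in> pser n" "x = sm f e0" using isf by (auto simp: kc carrier_RR)
    have cp: "pterm 0 (f 0) \<in> (pser n :: 'k mvps set)" by (intro pser_pterm zero_in_exps)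
    have dp: "f - pterm 0 (f 0) \<in> pser n" by (intro pser_diff f(1) cp)
    \<comment> \<open>Only the constant term of \<open>f\<close> acts on \<open>e0\<close>.\<close>
    have "f = pterm 0 (f 0) + (f - pterm 0 (f 0))" by simp
    then have "x = sm (pterm 0 (f 0)) e0 \<oplus>\<^bsub>E\<^esub> sm (f - pterm 0 (f 0)) e0"
      using sm_add_left[OF cp dp e0] f by (simp del: plus_fun_apply)
    also have "sm (f - pterm 0 (f 0)) e0 = \<zero>\<^bsub>E\<^esub>" by (rule kill[OF dp]) (simp add: pterm_def)
    finally have eq: "x = sm (pterm 0 (f 0)) e0" by (simp only: E.M.r_zero[OF sm_closed[OF cp e0]])
    have "f 0 \<noteq> 0"
    proof
      assume "f 0 = 0"
      from kill[OF f(1) this] f(2) x(3) show False by simp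
    qed
    with eq x(1) show ?thesis by auto
  qed
  ultimately show ?thesis using e0 kill by (intro bexI[of _ e0] conjI allI impI ballI) auto
qed

text \<open>\<open>EE\<close> as a module, with the carrier of singletons \<open>{z}\<close>: the carrier type has to be the element
  type of the ring in order to apply the lifting property of \<open>E\<close>.\<close>

definition EM :: "('k mvps set, 'k mvps set) module" where
  "EM = \<lparr>carrier = (\<lambda>z. {z}) ` EE, monoid.mult = undefined, one = undefined, ring.zero = {0},
     ring.add = (\<lambda>Z W. {the_elem Z + the_elem W}),
     smult = (\<lambda>r Z. {act (SOME f. f \<in> r) (the_elem Z)})\<rparr>"

text \<open>The ideal annihilates the model, so the representative picked by \<open>SOME\<close>
  does not matter.\<close>

lemma act_cl:
  assumes "f \<in> pser n" "z \<in> EE"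
  shows "act (SOME g. g \<in> cl f) z = act f z"
proof -
  have "(SOME g. g \<in> cl f) \<in> cl f" by (rule someI[of "\<lambda>g. g \<in> cl f", OF cl_self[OF assms(1)]])
  then have g: "(SOME g. g \<in> cl f) \<in> pser n" "(SOME g. g \<in> cl f) - f \<in> II" using cl_memD[OF _ assms(1)] by auto
  let ?g = "SOME g. g \<in> cl f"
  have "act ?g z = act (f + (?g - f)) z" by simp
  also have "\<dots> = act f z + act (?g - f) z" by (rule act_add_left[OF EE_fsupp[OF assms(2)]])
  also have "act (?g - f) z = 0" by (rule act_ideal_zero[OF g(2) assms(2)])
  finally show ?thesis by simp
qed

lemma EM_simps:
  "carrier EM = (\<lambda>z. {z}) ` EE" "\<zero>\<^bsub>EM\<^esub> = {0}" "{z} \<oplus>\<^bsub>EM\<^esub> {w} = {z + w}"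
  by (simp_all add: EM_def)

lemma EM_smult: "f \<in> pser n \<Longrightarrow> z \<in> EE \<Longrightarrow> cl f \<odot>\<^bsub>EM\<^esub> {z} = {act f z}"
  by (simp add: EM_def act_cl)

text \<open>The subset \<open>D\<close> is a parameter because the lifting property is applied to an
  inclusion: both the socle and the whole of \<open>EE\<close> have to be modules.\<close>

lemma EM_submodule:
  assumes sub: "D \<subseteq> EE" and zero: "0 \<in> D" and add: "\<And>z w. z \<in> D \<Longrightarrow> w \<in> D \<Longrightarrow> z + w \<in> D"
    and neg: "\<And>z. z \<in> D \<Longrightarrow> - z \<in> D" and act: "\<And>f z. f \<in> pser n \<Longrightarrow> z \<in> D \<Longrightarrow> act f z \<in> D"
  shows "module RR (EM\<lparr>carrier := (\<lambda>z. {z}) ` D\<rparr>)" (is "module RR ?M")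
proof (rule moduleI[OF RR_cring])
  have M: "carrier ?M = (\<lambda>z. {z}) ` D" "smult ?M = smult EM" "ring.add ?M = ring.add EM" "\<zero>\<^bsub>?M\<^esub> = \<zero>\<^bsub>EM\<^esub>"
    by simp_all
  have s: "cl f \<odot>\<^bsub>EM\<^esub> {z} = {act f z}" if "f \<in> pser n" "z \<in> D" for f z
    using that sub by (intro EM_smult) auto
  have fs: "z \<in> fsupp n" if "z \<in> D" for z using that sub EE_fsupp by auto
  show "abelian_group ?M"
  proof (rule abelian_groupI, unfold M)
    fix x y assume "x \<in> (\<lambda>z. {z}) ` D" "y \<in> (\<lambda>z. {z}) ` D"
    then obtain z w where zw: "z \<in> D" "x = {z}" "w \<in> D" "y = {w}" by blast
    show "x \<oplus>\<^bsub>EM\<^esub> y \<in> (\<lambda>z. {z}) ` D"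
      unfolding zw EM_simps by (intro imageI add zw)
    show "x \<oplus>\<^bsub>EM\<^esub> y = y \<oplus>\<^bsub>EM\<^esub> x"
      unfolding zw EM_simps by (simp only: add.commute[of z w])
    fix v assume "v \<in> (\<lambda>z. {z}) ` D"
    then obtain t where t: "v = {t}" by blast
    show "x \<oplus>\<^bsub>EM\<^esub> y \<oplus>\<^bsub>EM\<^esub> v = x \<oplus>\<^bsub>EM\<^esub> (y \<oplus>\<^bsub>EM\<^esub> v)"
      unfolding zw t EM_simps by (simp only: add.assoc)
  next
    show "\<zero>\<^bsub>EM\<^esub> \<in> (\<lambda>z. {z}) ` D" unfolding EM_simps by (intro imageI zero)
  next
    fix x assume "x \<in> (\<lambda>z. {z}) ` D"
    then obtain z where z: "z \<in> D" "x = {z}" by blast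
    show "\<zero>\<^bsub>EM\<^esub> \<oplus>\<^bsub>EM\<^esub> x = x" unfolding z EM_simps by (simp only: add_0_left)
    have "{- z} \<oplus>\<^bsub>EM\<^esub> x = \<zero>\<^bsub>EM\<^esub>" unfolding z EM_simps by (simp only: left_minus)
    then show "\<exists>y\<in>(\<lambda>z. {z}) ` D. y \<oplus>\<^bsub>EM\<^esub> x = \<zero>\<^bsub>EM\<^esub>"
      by (intro bexI[of _ "{- z}"] imageI neg z(1))
  qed
  {
    fix a b x y assume "a \<in> carrier RR" "b \<in> carrier RR" "x \<in> carrier ?M" "y \<in> carrier ?M"
    then obtain f g z w where fz: "f \<in> pser n" "a = cl f" "g \<in> pser n" "b = cl g"
        "z \<in> D" "x = {z}" "w \<in> D" "y = {w}"
      unfolding carrier_RR M by blast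
    have "cl f \<odot>\<^bsub>EM\<^esub> {z} \<in> (\<lambda>z. {z}) ` D" unfolding s[OF fz(1,5)] by (intro imageI act fz)
    then show "a \<odot>\<^bsub>?M\<^esub> x \<in> carrier ?M" unfolding M fz .
    show "(a \<oplus>\<^bsub>RR\<^esub> b) \<odot>\<^bsub>?M\<^esub> x = a \<odot>\<^bsub>?M\<^esub> x \<oplus>\<^bsub>?M\<^esub> b \<odot>\<^bsub>?M\<^esub> x"
      unfolding M fz cl_add[OF fz(1,3), symmetric] s[OF pser_add[OF fz(1,3)] fz(5)] s[OF fz(1,5)] s[OF fz(3,5)]
        EM_simps act_add_left[OF fs[OF fz(5)]] ..
    show "(a \<otimes>\<^bsub>RR\<^esub> b) \<odot>\<^bsub>?M\<^esub> x = a \<odot>\<^bsub>?M\<^esub> (b \<odot>\<^bsub>?M\<^esub> x)"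
      unfolding M fz cl_mult[OF fz(1,3), symmetric] s[OF pser_pmul[OF fz(1,3)] fz(5)] s[OF fz(3,5)]
        s[OF fz(1) act[OF fz(3,5)]] act_pmul[OF fs[OF fz(5)]] ..
    show "a \<odot>\<^bsub>?M\<^esub> (x \<oplus>\<^bsub>?M\<^esub> y) = a \<odot>\<^bsub>?M\<^esub> x \<oplus>\<^bsub>?M\<^esub> a \<odot>\<^bsub>?M\<^esub> y"
      unfolding M fz EM_simps s[OF fz(1) add[OF fz(5,7)]] s[OF fz(1,5)] s[OF fz(1,7)]
        act_add_right[OF fs[OF fz(5)] fs[OF fz(7)]] ..
  }
  fix x assume "x \<in> carrier ?M"
  then obtain z where z: "z \<in> D" "x = {z}" unfolding M by blast
  have one: "pterm 0 1 \<in> (pser n :: 'k mvps set)" by (intro pser_pterm zero_in_exps)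
  have zE: "z \<in> EE" using sub z(1) by (rule subsetD)
  show "\<one>\<^bsub>RR\<^esub> \<odot>\<^bsub>?M\<^esub> x = x"
    unfolding M z cl_one[symmetric] s[OF one z(1)] act_one[OF zE] ..
qed

lemma act_socle:
  fixes f :: "'k mvps"
  shows "act f (pterm 0 c) = pterm 0 (f 0 * c)"
proof
  fix b
  show "act f (pterm 0 c) b = pterm 0 (f 0 * c) b"
  proof (cases "b = 0")
    case True
    have "act f (pterm 0 c) 0 = (\<Sum>a\<in>{a. pterm 0 c a \<noteq> 0}. f a * pterm 0 c a)" by (rule act_at_zero)
    also have "\<dots> = (\<Sum>a\<in>{0}. f a * pterm 0 c a)"
      by (rule sum.mono_neutral_left) (auto simp: pterm_def)
    finally show ?thesis using True by (simp add: pterm_def)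
  next
    case False
    have "act f (pterm 0 c) b = 0"
    proof (rule ccontr)
      assume "act f (pterm 0 c) b \<noteq> 0"
      from act_nonzeroD[OF this] obtain a where "pterm 0 c a \<noteq> 0" "b \<le> a" by auto
      then have "b \<le> 0" by (auto simp: pterm_def split: if_splits)
      with False show False by (auto simp: le_fun_def fun_eq_iff)
    qed
    with False show ?thesis by (simp add: pterm_def)
  qed
qed

text \<open>Extending the inclusion of the socle along \<open>EE\<close> embeds \<open>EE\<close> into \<open>E\<close>.\<close>

lemma embedding:
  "\<exists>G. (\<forall>z\<in>EE. G z \<in> carrier E) \<and> (\<forall>z\<in>EE. \<forall>w\<in>EE. G (z + w) = G z \<oplus>\<^bsub>E\<^esub> G w) \<and>
     (\<forall>f\<in>pser n. \<forall>z\<in>EE. G (act f z) = sm f (G z)) \<and> inj_on G EE \<and>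
     (\<forall>N. submodule N RR E \<and> N \<noteq> {\<zero>\<^bsub>E\<^esub>} \<longrightarrow> (\<exists>c. c \<noteq> 0 \<and> G (pterm 0 c) \<in> N))"
proof -
  obtain e0 where e0: "e0 \<in> carrier E" "e0 \<noteq> \<zero>\<^bsub>E\<^esub>" "\<forall>f\<in>pser n. f 0 = 0 \<longrightarrow> sm f e0 = \<zero>\<^bsub>E\<^esub>"
     and ess: "\<forall>N. submodule N RR E \<and> N \<noteq> {\<zero>\<^bsub>E\<^esub>} \<longrightarrow> (\<exists>c. c \<noteq> 0 \<and> sm (pterm 0 c) e0 \<in> N)"
    using socle by blast
  have cp: "pterm 0 c \<in> (pser n :: 'k mvps set)" for c by (intro pser_pterm zero_in_exps)
  let ?D = "range (pterm 0) :: 'k mvps set"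
  let ?SM = "EM\<lparr>carrier := (\<lambda>z. {z}) ` ?D\<rparr>"
  have DE: "?D \<subseteq> EE" using EE_pterm[OF zero_NN] by auto
  have padd: "pterm 0 c + pterm 0 d = pterm 0 (c + d)" for c d :: 'k by (auto simp: pterm_def fun_eq_iff)
  have pneg: "- pterm 0 c = pterm 0 (- c)" for c :: 'k by (auto simp: pterm_def fun_eq_iff)
  have p0: "pterm 0 0 = (0 :: 'k mvps)" by (auto simp: pterm_def fun_eq_iff)
  have SM: "module RR ?SM"
  proof (rule EM_submodule[OF DE])
    show "0 \<in> ?D" by (rule image_eqI[of _ _ 0]) (simp_all add: p0)
  qed (auto simp: padd pneg act_socle)
  have "module RR (EM\<lparr>carrier := (\<lambda>z. {z}) ` EE\<rparr>)"
    by (rule EM_submodule) (auto simp: EE_zero EE_add EE_minus EE_act)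
  then have EM: "module RR EM" by (simp add: EM_def)
  \<comment> \<open>The socle of the model goes to the copy of the residue field: the coefficient
    \<open>c\<close> at exponent \<open>0\<close> is sent to \<open>c\<close> times
    \<open>e0\<close>.\<close>
  define u where "u = (\<lambda>Z. sm (pterm 0 (the_elem Z (0 :: nat \<Rightarrow> nat))) e0)"
  have u: "u {pterm 0 c} = sm (pterm 0 c) e0" for c
  proof -
    have "pterm 0 c (0 :: nat \<Rightarrow> nat) = c" by (simp add: pterm_def)
    then show ?thesis by (simp only: u_def the_elem_eq)
  qed
  have u_hom: "u \<in> mod_homs RR ?SM E"
    unfolding mod_homs_def
  proof (intro CollectI conjI ballI)
    show "u \<in> carrier ?SM \<rightarrow> carrier E" using e0(1) cp by (auto simp: u sm_closed)
    fix x y assume "x \<in> carrier ?SM" "y \<in> carrier ?SM"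
    then obtain c d where cd: "x = {pterm 0 c}" "y = {pterm 0 d}" by auto
    then show "u (x \<oplus>\<^bsub>?SM\<^esub> y) = u x \<oplus>\<^bsub>E\<^esub> u y"
      using sm_add_left[OF cp cp e0(1), of c d] by (simp add: EM_simps padd u)
  next
    fix r x assume "r \<in> carrier RR" "x \<in> carrier ?SM"
    then obtain f c where fc: "f \<in> pser n" "r = cl f" "x = {pterm 0 c}" by (auto simp: carrier_RR)
    have zE: "pterm 0 c \<in> EE" using DE by auto
    \<comment> \<open>Without constant term, this series kills \<open>e0\<close>; so
      \<open>f\<close> acts on the socle through \<open>f 0\<close>.\<close>
    let ?h = "pmul f (pterm 0 c) - pterm 0 (f 0 * c)"
    have hp: "?h \<in> pser n" using fc cp by (intro pser_diff pser_pmul)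
    have "?h 0 = 0" by (simp add: pmul_zero_coeff pterm_def)
    then have hz: "sm ?h e0 = \<zero>\<^bsub>E\<^esub>" using e0(3) hp by blast
    have "sm f (sm (pterm 0 c) e0) = sm (pmul f (pterm 0 c)) e0"
      using sm_mult[OF fc(1) cp e0(1)] by simp
    also have "pmul f (pterm 0 c) = pterm 0 (f 0 * c) + ?h" by simp
    also have "sm (pterm 0 (f 0 * c) + ?h) e0 = sm (pterm 0 (f 0 * c)) e0 \<oplus>\<^bsub>E\<^esub> sm ?h e0"
      by (rule sm_add_left[OF cp hp e0(1)])
    also have "\<dots> = sm (pterm 0 (f 0 * c)) e0"
      by (simp only: hz E.M.r_zero[OF sm_closed[OF cp e0(1)]])
    finally have "sm f (sm (pterm 0 c) e0) = sm (pterm 0 (f 0 * c)) e0" .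
    then show "u (r \<odot>\<^bsub>?SM\<^esub> x) = r \<odot>\<^bsub>E\<^esub> u x"
      using fc zE by (simp add: EM_smult act_socle u) (simp add: sm_def)
  qed
  have inc: "(\<lambda>x. x) \<in> mod_homs RR ?SM EM"
    using DE unfolding mod_homs_def by (auto simp: EM_simps)
  have lift: "\<forall>(M :: ('k mvps set, 'k mvps set) module) (N :: ('k mvps set, 'k mvps set) module) i f.
        module RR M \<and> module RR N \<and> i \<in> mod_homs RR M N \<and> inj_on i (carrier M) \<and> f \<in> mod_homs RR M E \<longrightarrow>
        (\<exists>g \<in> mod_homs RR N E. \<forall>x\<in>carrier M. g (i x) = f x)"
    using E_injective unfolding injective_module_def by (rule conjunct2)
  have "\<exists>g\<in>mod_homs RR EM E. \<forall>x\<in>carrier ?SM. g x = u x"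
    using lift[rule_format, of ?SM EM "\<lambda>x. x" u] SM EM inc u_hom by (simp add: inj_on_def)
  then obtain g where g: "g \<in> mod_homs RR EM E" "\<forall>x\<in>carrier ?SM. g x = u x" by blast
  define G where "G = (\<lambda>z. g {z})"
  have G1: "G z \<in> carrier E" if "z \<in> EE" for z
    using g(1) that by (auto simp: mod_homs_def EM_simps G_def)
  have G2: "G (z + w) = G z \<oplus>\<^bsub>E\<^esub> G w" if "z \<in> EE" "w \<in> EE" for z w
  proof -
    have "g ({z} \<oplus>\<^bsub>EM\<^esub> {w}) = g {z} \<oplus>\<^bsub>E\<^esub> g {w}"
      using g(1) that unfolding mod_homs_def EM_simps(1) by blast
    then show ?thesis by (simp add: EM_simps G_def)
  qed
  have G3: "G (act f z) = sm f (G z)" if "f \<in> pser n" "z \<in> EE" for f z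
  proof -
    have "g (cl f \<odot>\<^bsub>EM\<^esub> {z}) = cl f \<odot>\<^bsub>E\<^esub> g {z}"
      using g(1) that cl_carrier[OF that(1)] unfolding mod_homs_def EM_simps(1) by blast
    then show ?thesis using that by (simp add: EM_smult G_def sm_def)
  qed
  have G4: "G (pterm 0 c) = sm (pterm 0 c) e0" for c
    using g(2) by (simp add: G_def u)
  have G0: "G 0 = \<zero>\<^bsub>E\<^esub>"
  proof -
    have "G 0 = sm (pterm 0 0) e0" using G4[of 0] by (simp only: p0)
    also have "\<dots> = \<zero>\<^bsub>E\<^esub>" using e0(3) cp[of 0] by (auto simp: pterm_def)
    finally show ?thesis .
  qed
  \<comment> \<open>Contraction would carry a nonzero kernel element to a nonzero socle element,
    where the map is already injective.\<close>
  have inj0: "z = 0" if z: "z \<in> EE" "G z = \<zero>\<^bsub>E\<^esub>" for z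
  proof (rule ccontr)
    assume "z \<noteq> 0"
    from EE_socle[OF z(1) this] obtain a c where ac: "a \<in> exps n" "c \<noteq> 0" "act (pterm a 1) z = pterm 0 c" by auto
    have "sm (pterm 0 c) e0 = G (act (pterm a 1) z)" by (simp add: ac G4)
    also have "\<dots> = sm (pterm a 1) (G z)" using ac(1) z(1) by (intro G3 pser_pterm)
    also have "\<dots> = \<zero>\<^bsub>E\<^esub>" using z(2) ac(1) by (simp add: sm_def cl_carrier pser_pterm)
    finally have *: "sm (pterm 0 c) e0 = \<zero>\<^bsub>E\<^esub>" .
    have "e0 = sm (pmul (pterm 0 (inverse c)) (pterm 0 c)) e0"
      using ac(2) e0(1) by (simp add: pmul_pterm_pterm[of _ n] sm_one)
    also have "\<dots> = sm (pterm 0 (inverse c)) \<zero>\<^bsub>E\<^esub>" by (simp only: sm_mult[OF cp cp e0(1)] *)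
    also have "\<dots> = \<zero>\<^bsub>E\<^esub>" by (simp add: sm_def cl_carrier cp)
    finally show False using e0(2) by simp
  qed
  have "inj_on G EE"
  proof (rule inj_onI)
    fix z w assume zw: "z \<in> EE" "w \<in> EE" "G z = G w"
    have "\<zero>\<^bsub>E\<^esub> = G (w + - w)" using G0 by simp
    also have "\<dots> = G w \<oplus>\<^bsub>E\<^esub> G (- w)" by (rule G2[OF zw(2) EE_minus[OF zw(2)]])
    also have "\<dots> = G (z + - w)" by (simp only: G2[OF zw(1) EE_minus[OF zw(2)]] zw(3))
    finally have "z + - w = 0" using inj0[OF EE_add[OF zw(1) EE_minus[OF zw(2)]]] by (simp only:)
    then show "z = w" by (simp only: add_eq_0_iff2 minus_minus)
  qed
  moreover have "\<forall>N. submodule N RR E \<and> N \<noteq> {\<zero>\<^bsub>E\<^esub>} \<longrightarrow> (\<exists>c. c \<noteq> 0 \<and> G (pterm 0 c) \<in> N)"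
    using ess by (simp only: G4)
  ultimately show ?thesis by (intro exI[of _ G] conjI ballI G1 G2 G3)
qed

end

section \<open>Surjectivity of the embedding\<close>

context ps_ideal
begin

text \<open>Descending induction on the order \<open>j\<close>, starting from the vanishing
  hypothesis at \<open>j = K\<close>. Since at most one exponent has \<open>ev = j\<close>, allowing
  order \<open>j\<close> instead of \<open>Suc j\<close> adds at most one dimension, and one new
  coefficient of \<open>e\<close> adjusts the value there.\<close>

lemma extend_functional:
  fixes lam :: "'k mvps \<Rightarrow> 'k"
  assumes add: "\<And>f g. f \<in> A \<Longrightarrow> g \<in> A \<Longrightarrow> lam (f + g) = lam f + lam g"
    and scale: "\<And>c f. f \<in> A \<Longrightarrow> lam (\<lambda>a. c * f a) = c * lam f"
    and van: "\<And>f. f \<in> A \<Longrightarrow> \<forall>a. ev n a < K \<longrightarrow> f a = 0 \<Longrightarrow> lam f = 0"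
  shows "\<exists>e. (\<forall>a. e a \<noteq> 0 \<longrightarrow> a \<in> exps n \<and> ev n a < K) \<and>
    (\<forall>f\<in>A. lam f = (\<Sum>a\<in>{a \<in> exps n. ev n a < K}. f a * e a))"
proof -
  let ?D = "{a \<in> exps n. ev n a < K}"
  have fin: "finite ?D" by (rule finite_ev_less)
  have "\<exists>e. (\<forall>a. e a \<noteq> 0 \<longrightarrow> a \<in> exps n \<and> 0 \<le> ev n a \<and> ev n a < K) \<and>
    (\<forall>f\<in>A. (\<forall>a. ev n a < 0 \<longrightarrow> f a = 0) \<longrightarrow> lam f = (\<Sum>a\<in>?D. f a * e a))"
    using le0[of K]
  proof (induction rule: inc_induct)
    case base
    show ?case using van by (intro exI[of _ "\<lambda>_. 0"]) simp
  next
    case (step j)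
    then obtain e where e: "\<forall>a. e a \<noteq> 0 \<longrightarrow> a \<in> exps n \<and> Suc j \<le> ev n a \<and> ev n a < K"
      "\<And>f. f \<in> A \<Longrightarrow> \<forall>a. ev n a < Suc j \<longrightarrow> f a = 0 \<Longrightarrow> lam f = (\<Sum>a\<in>?D. f a * e a)"
      by auto
    show ?case
    proof (cases "\<exists>u\<in>A. (\<forall>a. ev n a < j \<longrightarrow> u a = 0) \<and> (\<exists>a. ev n a = j \<and> u a \<noteq> 0)")
      case False
      have "lam f = (\<Sum>a\<in>?D. f a * e a)" if f: "f \<in> A" "\<forall>a. ev n a < j \<longrightarrow> f a = 0" for f
      proof (rule e(2)[OF f(1)], intro allI impI)
        fix a assume "ev n a < Suc j"
        with False f show "f a = 0" by (cases "ev n a = j") auto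
      qed
      moreover have "\<forall>a. e a \<noteq> 0 \<longrightarrow> a \<in> exps n \<and> j \<le> ev n a \<and> ev n a < K"
        using e(1) by auto
      ultimately show ?thesis by (intro exI[of _ e]) auto
    next
      case True
      then obtain u a0 where u: "u \<in> A" "\<forall>a. ev n a < j \<longrightarrow> u a = 0" "ev n a0 = j" "u a0 \<noteq> 0" by auto
      have a0: "a0 \<in> exps n" using u(1,4) A_pser by (auto simp: pser_def)
      define w where "w = (\<lambda>a. inverse (u a0) * u a)"
      have w: "w \<in> A" "\<forall>a. ev n a < j \<longrightarrow> w a = 0" "w a0 = 1"
        using A_scale[OF u(1)] u by (auto simp: w_def)
      \<comment> \<open>The error at \<open>w\<close>, which becomes the coefficient at
        \<open>a0\<close>; elements of order above \<open>j\<close> do not notice it.\<close>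
      define t where "t = lam w - (\<Sum>a\<in>?D. w a * e a)"
      define e' where "e' = (\<lambda>a. if a = a0 then t else e a)"
      have ea0: "e a0 = 0" using e(1) u(3) by (metis Suc_n_not_le_n)
      have a0D: "a0 \<in> ?D" using a0 u(3) step.hyps by simp
      have sum_e': "(\<Sum>a\<in>?D. f a * e' a) = (\<Sum>a\<in>?D. f a * e a) + f a0 * t" for f
      proof -
        have "(\<Sum>a\<in>?D. f a * e' a) = (\<Sum>a\<in>?D. f a * e a + (if a = a0 then f a0 * t else 0))"
          using ea0 by (intro sum.cong) (auto simp: e'_def)
        then show ?thesis using fin a0D by (simp add: sum.distrib)
      qed
      have "lam f = (\<Sum>a\<in>?D. f a * e' a)" if f: "f \<in> A" "\<forall>a. ev n a < j \<longrightarrow> f a = 0" for f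
      proof -
        \<comment> \<open>Cancelling the term at \<open>a0\<close> by a multiple of \<open>w\<close>
          raises the order to \<open>Suc j\<close>.\<close>
        define g where "g = (\<lambda>a. (- f a0) * w a)"
        have gA: "g \<in> A" unfolding g_def by (rule A_scale[OF w(1)])
        have lg: "lam g = - (f a0 * lam w)" unfolding g_def scale[OF w(1)] by simp
        have "f + g \<in> A" by (rule A_add[OF f(1) gA])
        moreover have "\<forall>a. ev n a < Suc j \<longrightarrow> (f + g) a = 0"
        proof (intro allI impI)
          fix a assume a: "ev n a < Suc j"
          show "(f + g) a = 0"
          proof (cases "a = a0")
            case False
            have "f a = 0 \<and> w a = 0"
            proof (cases "a \<in> exps n")
              case True
              then have "ev n a \<noteq> j" using ev_inj[OF True a0] u(3) False by auto
              then show ?thesis using a f(2) w(2) by simp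
            next
              case False
              then show ?thesis using f(1) w(1) A_pser by (auto simp: pser_def)
            qed
            then show ?thesis by (simp add: g_def)
          qed (simp add: g_def w(3))
        qed
        ultimately have "lam (f + g) = (\<Sum>a\<in>?D. (f + g) a * e a)" by (rule e(2))
        also have "\<dots> = (\<Sum>a\<in>?D. f a * e a) - f a0 * (\<Sum>a\<in>?D. w a * e a)"
          by (simp add: g_def algebra_simps sum_subtractf sum_distrib_left)
        finally have "lam f - f a0 * lam w = (\<Sum>a\<in>?D. f a * e a) - f a0 * (\<Sum>a\<in>?D. w a * e a)"
          using add[OF f(1) gA] lg by simp
        then show ?thesis unfolding sum_e' t_def by (simp add: algebra_simps)
      qed
      moreover have "\<forall>a. e' a \<noteq> 0 \<longrightarrow> a \<in> exps n \<and> j \<le> ev n a \<and> ev n a < K"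
        using e(1) a0D u(3) by (auto simp: e'_def)
      ultimately show ?thesis by (intro exI[of _ e']) auto
    qed
  qed
  then show ?thesis by auto
qed

end

context hull
begin

definition GG :: "'k mvps \<Rightarrow> 'e" where
  "GG = (SOME G. (\<forall>z\<in>EE. G z \<in> carrier E) \<and> (\<forall>z\<in>EE. \<forall>w\<in>EE. G (z + w) = G z \<oplus>\<^bsub>E\<^esub> G w) \<and>
     (\<forall>f\<in>pser n. \<forall>z\<in>EE. G (act f z) = sm f (G z)) \<and> inj_on G EE \<and>
     (\<forall>N. submodule N RR E \<and> N \<noteq> {\<zero>\<^bsub>E\<^esub>} \<longrightarrow> (\<exists>c. c \<noteq> 0 \<and> G (pterm 0 c) \<in> N)))"

lemma GG_all: "(\<forall>z\<in>EE. GG z \<in> carrier E) \<and> (\<forall>z\<in>EE. \<forall>w\<in>EE. GG (z + w) = GG z \<oplus>\<^bsub>E\<^esub> GG w) \<and>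
     (\<forall>f\<in>pser n. \<forall>z\<in>EE. GG (act f z) = sm f (GG z)) \<and> inj_on GG EE \<and>
     (\<forall>N. submodule N RR E \<and> N \<noteq> {\<zero>\<^bsub>E\<^esub>} \<longrightarrow> (\<exists>c. c \<noteq> 0 \<and> GG (pterm 0 c) \<in> N))"
  unfolding GG_def by (rule someI_ex[OF embedding])

lemma GG_closed: "z \<in> EE \<Longrightarrow> GG z \<in> carrier E"
  and GG_add: "z \<in> EE \<Longrightarrow> w \<in> EE \<Longrightarrow> GG (z + w) = GG z \<oplus>\<^bsub>E\<^esub> GG w"
  and GG_act: "f \<in> pser n \<Longrightarrow> z \<in> EE \<Longrightarrow> GG (act f z) = sm f (GG z)"
  and GG_inj: "inj_on GG EE"
  and GG_ess: "submodule N RR E \<Longrightarrow> N \<noteq> {\<zero>\<^bsub>E\<^esub>} \<Longrightarrow> \<exists>c. c \<noteq> 0 \<and> GG (pterm 0 c) \<in> N"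
  using GG_all by simp_all

lemma GG_zero: "GG 0 = \<zero>\<^bsub>E\<^esub>"
proof -
  have "GG 0 \<oplus>\<^bsub>E\<^esub> GG 0 = GG (0 + 0)" by (rule GG_add[OF EE_zero EE_zero, symmetric])
  then have "GG 0 \<oplus>\<^bsub>E\<^esub> GG 0 = GG 0" by (simp only: add_0_left)
  then show ?thesis using GG_closed[OF EE_zero] by (metis E.M.add.l_cancel_one')
qed

text \<open>On the ideal \<open>?A\<close> of all \<open>f\<close> that move \<open>y\<close> into
  the image of \<open>EE\<close>, the assignment of the preimage of \<open>f y\<close> to
  \<open>f\<close> is a homomorphism \<open>h\<close> into \<open>EE\<close>. It extends to all
  power series, that is, \<open>h f = act f e\<close> for some \<open>e\<close>. So
  \<open>y - GG e\<close> is annihilated by \<open>?A\<close>, and essentiality forces it to be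
  zero.\<close>

lemma GG_surj_at:
  assumes y: "y \<in> carrier E"
  shows "y \<in> GG ` EE"
proof -
  have cp: "pterm 0 c \<in> (pser n :: 'k mvps set)" for c by (intro pser_pterm zero_in_exps)
  let ?A = "{f \<in> pser n. sm f y \<in> GG ` EE}"
  have idA: "ideal ?A SS"
  proof (rule ideal_mvpsI)
    show "0 \<in> ?A"
    proof (intro CollectI conjI pser_zero)
      have "sm 0 y = \<zero>\<^bsub>E\<^esub>" using y by (simp add: sm_def cl_zero)
      then show "sm 0 y \<in> GG ` EE" using imageI[OF EE_zero, of GG] by (simp only: GG_zero)
    qed
    fix f g assume f: "f \<in> ?A" and g: "g \<in> ?A"
    then obtain z w where "z \<in> EE" "sm f y = GG z" "w \<in> EE" "sm g y = GG w" by auto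
    then have "sm (f + g) y = GG (z + w)" "z + w \<in> EE"
      using f g y sm_add_left[of f g y] GG_add[of z w] EE_add[of z w] by (simp_all del: plus_fun_apply)
    then show "f + g \<in> ?A" using f g pser_add[of f n g] by blast
  next
    fix f g :: "'k mvps" assume f: "f \<in> ?A" and g: "g \<in> pser n"
    then obtain z where "z \<in> EE" "sm f y = GG z" by auto
    then have "sm (pmul g f) y = GG (act g z)" "act g z \<in> EE"
      using f g y sm_mult[of g f y] GG_act[of g z] EE_act[of z g] by simp_all
    then show "pmul g f \<in> ?A" using f g pser_pmul[of g n f] by blast
  qed auto
  interpret A: ps_ideal n ?A by (rule ps_ideal.intro[OF idA])
  define h where "h = (\<lambda>f. inv_into EE GG (sm f y))"
  have h: "h f \<in> EE" "GG (h f) = sm f y" if "f \<in> ?A" for f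
  proof -
    have m: "sm f y \<in> GG ` EE" using that by simp
    show "h f \<in> EE" "GG (h f) = sm f y"
      unfolding h_def by (rule inv_into_into[OF m], rule f_inv_into_f[OF m])
  qed
  have hI: "h f = z" if "z \<in> EE" "GG z = sm f y" for f z
    unfolding h_def that(2)[symmetric] by (rule inv_into_f_f[OF GG_inj that(1)])
  have h_add: "h (f + g) = h f + h g" if f: "f \<in> ?A" and g: "g \<in> ?A" for f g
  proof (rule hI[OF EE_add[OF h(1)[OF f] h(1)[OF g]]])
    show "GG (h f + h g) = sm (f + g) y"
      using sm_add_left[of f g y] f g y by (simp only: GG_add[OF h(1)[OF f] h(1)[OF g]] h(2)[OF f] h(2)[OF g] mem_Collect_eq)
  qed
  have h_mult: "h (pmul g f) = act g (h f)" if f: "f \<in> ?A" and g: "g \<in> pser n" for f g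
  proof (rule hI[OF EE_act[OF h(1)[OF f]]])
    show "GG (act g (h f)) = sm (pmul g f) y"
      using sm_mult[of g f y] f g y by (simp only: GG_act[OF g h(1)[OF f]] h(2)[OF f] mem_Collect_eq)
  qed
  \<comment> \<open>One coefficient determines \<open>h\<close>, because \<open>h f b\<close> is the
    value of \<open>lam\<close> at \<open>f\<close> times the monomial with exponent
    \<open>b\<close>.\<close>
  define lam where "lam = (\<lambda>f. h f 0)"
  have lam_add: "lam (f + g) = lam f + lam g" if "f \<in> ?A" "g \<in> ?A" for f g
    unfolding lam_def h_add[OF that] by simp
  have lam_mult: "lam (pmul g f) = (\<Sum>c\<in>{c. h f c \<noteq> 0}. g c * h f c)" if "f \<in> ?A" "g \<in> pser n" for f g
    unfolding lam_def h_mult[OF that] by (rule act_at_zero)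
  have scale_pmul: "(\<lambda>a. c * f a) = pmul (pterm 0 c) f" if "f \<in> pser n" for c :: 'k and f :: "'k mvps"
  proof
    fix a show "c * f a = pmul (pterm 0 c) f a"
    proof (cases "a \<in> exps n")
      case False
      then have "pmul (pterm 0 c) f a = 0" "f a = 0"
        using pser_pmul[OF cp that] that by (auto simp: pser_def)
      then show ?thesis by simp
    qed (auto simp: pmul_pterm le_fun_def fun_diff_def)
  qed
  have lam_scale: "lam (\<lambda>a. c * f a) = c * lam f" if f: "f \<in> ?A" for c f
  proof -
    have fp: "f \<in> pser n" using f by simp
    have "lam (\<lambda>a. c * f a) = act (pterm 0 c) (h f) 0"
      unfolding lam_def scale_pmul[OF fp] h_mult[OF f cp] ..
    also have "\<dots> = c * h f 0"
      by (simp only: act_pterm[OF fsuppD(1)[OF EE_fsupp[OF h(1)[OF f]]]] add_0_left)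
    finally show ?thesis by (simp only: lam_def)
  qed
  obtain L F where L: "finite L" "F ` L \<subseteq> ?A" and
    div: "\<forall>f\<in>?A. \<forall>K. (\<forall>a. ev n a < K \<longrightarrow> f a = 0) \<longrightarrow>
       (\<exists>g. (\<forall>l. g l \<in> pser n) \<and> f = (\<Sum>l\<in>L. pmul (g l) (F l)) \<and>
         (\<forall>l\<in>L. \<forall>b. g l b \<noteq> 0 \<longrightarrow> K \<le> ev n b * ev n l))"
    using A.standard_basis by (elim exE conjE) (rule that)
  have FA: "F l \<in> ?A" if "l \<in> L" for l using L(2) that by (rule subsetD[OF _ imageI])
  define M1 where "M1 = (\<Sum>l\<in>L. \<Sum>c\<in>{c. h (F l) c \<noteq> 0}. Suc (ev n c))"
  define M2 where "M2 = (\<Sum>l\<in>L. ev n l)"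
  have M1: "ev n c < M1" if "l \<in> L" "h (F l) c \<noteq> 0" for l c
  proof -
    have fin: "finite {c. h (F l) c \<noteq> 0}" by (rule fsuppD(1)[OF EE_fsupp[OF h(1)[OF FA[OF that(1)]]]])
    have "Suc (ev n c) \<le> (\<Sum>c\<in>{c. h (F l) c \<noteq> 0}. Suc (ev n c))"
      using that(2) by (intro member_le_sum fin) auto
    also have "\<dots> \<le> M1"
      unfolding M1_def by (rule member_le_sum[where f = "\<lambda>l. \<Sum>c\<in>{c. h (F l) c \<noteq> 0}. Suc (ev n c)", OF that(1) _ L(1)]) simp
    finally show ?thesis by simp
  qed
  have M2: "ev n l \<le> M2" if "l \<in> L" for l
    unfolding M2_def by (rule member_le_sum[OF that _ L(1)]) simp
  \<comment> \<open>If \<open>f\<close> has order at least \<open>K\<close>, a term of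
    \<open>g l\<close> at \<open>c\<close> satisfies \<open>M1 * M2 \<le> ev n c * ev n l\<close>,
    so \<open>M1 \<le> ev n c\<close>, which is beyond the support of every
    \<open>h (F l)\<close>.\<close>
  define K where "K = M1 * M2"
  have lam_van: "lam f = 0" if f: "f \<in> ?A" "\<forall>a. ev n a < K \<longrightarrow> f a = 0" for f
  proof -
    obtain g where g: "\<forall>l. g l \<in> pser n" "f = (\<Sum>l\<in>L. pmul (g l) (F l))"
        "\<forall>l\<in>L. \<forall>b. g l b \<noteq> 0 \<longrightarrow> K \<le> ev n b * ev n l"
      using div[rule_format, OF f(1), of K] f(2) by blast
    have zero: "lam (pmul (g l) (F l)) = 0" if l: "l \<in> L" for l
      unfolding lam_mult[OF FA[OF l] g(1)[rule_format]]
    proof (rule sum.neutral, rule ballI)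
      fix c assume "c \<in> {c. h (F l) c \<noteq> 0}"
      then have less: "ev n c < M1" using M1[OF l] by simp
      have "g l c = 0"
      proof (rule ccontr)
        assume "g l c \<noteq> 0"
        then have "M1 * M2 \<le> ev n c * ev n l" using g(3) l by (simp add: K_def)
        also have "\<dots> \<le> ev n c * M2" using M2[OF l] by simp
        finally have "M1 * M2 \<le> ev n c * M2" .
        moreover have "M2 > 0" using M2[OF l] ev_pos[of n l] by linarith
        ultimately show False using less by simp
      qed
      then show "g l c * h (F l) c = 0" by simp
    qed
    have "(\<Sum>l\<in>L'. pmul (g l) (F l)) \<in> ?A \<and> lam (\<Sum>l\<in>L'. pmul (g l) (F l)) = 0" if "finite L'" "L' \<subseteq> L" for L'
      using that
    proof (induction L' rule: finite_induct)
      case empty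
      have "lam 0 = lam 0 + lam 0" using lam_add[OF A.A_zero A.A_zero] by (simp only: add_0_left)
      then have "lam 0 = 0" by (simp only: add_cancel_right_right)
      then show ?case using A.A_zero by (simp only: sum.empty simp_thms)
    next
      case (insert l L')
      have lL: "l \<in> L" using insert.prems by auto
      have 1: "pmul (g l) (F l) \<in> ?A" by (rule A.A_mult[OF FA[OF lL] g(1)[rule_format]])
      have 2: "(\<Sum>l\<in>L'. pmul (g l) (F l)) \<in> ?A" "lam (\<Sum>l\<in>L'. pmul (g l) (F l)) = 0"
        using insert.IH insert.prems by auto
      have s: "(\<Sum>l\<in>insert l L'. pmul (g l) (F l)) = pmul (g l) (F l) + (\<Sum>l\<in>L'. pmul (g l) (F l))"
        by (rule sum.insert[OF insert.hyps])
      show ?case unfolding s lam_add[OF 1 2(1)] zero[OF lL] 2(2)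
        by (intro conjI A.A_add 1 2 add_0_left)
    qed
    from this[OF L(1) order_refl] show ?thesis by (simp only: g(2) simp_thms)
  qed
  have ex: "\<exists>e. (\<forall>a. e a \<noteq> 0 \<longrightarrow> a \<in> exps n \<and> ev n a < K) \<and>
    (\<forall>f\<in>?A. lam f = (\<Sum>a\<in>{a \<in> exps n. ev n a < K}. f a * e a))"
    by (rule A.extend_functional[of lam K, OF lam_add lam_scale lam_van])
  then obtain e where e: "\<forall>a. e a \<noteq> 0 \<longrightarrow> a \<in> exps n \<and> ev n a < K"
     "\<forall>f\<in>?A. lam f = (\<Sum>a\<in>{a \<in> exps n. ev n a < K}. f a * e a)"
    by (elim exE conjE)
  let ?D = "{a \<in> exps n. ev n a < K}"
  have finD: "finite ?D" by (rule finite_ev_less)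
  have eE: "e \<in> EE"
    unfolding EE_def fsupp_def
  proof (intro CollectI conjI allI impI)
    have "{c. e c \<noteq> 0} \<subseteq> ?D" using e(1) by auto
    then show "finite {c. e c \<noteq> 0}" by (rule finite_subset[OF _ finD])
    fix c assume c: "e c \<noteq> 0"
    then show cx: "c \<in> exps n" using e(1) by auto
    \<comment> \<open>Monomials of \<open>I\<close> annihilate \<open>y\<close>, so
      \<open>lam\<close> vanishes on them and \<open>e\<close> has no coefficient there.\<close>
    show "c \<in> NN"
    proof (rule ccontr)
      assume "c \<notin> NN"
      then have "(mvps_monom c :: 'k mvps) \<in> II" using cx by (simp add: MI_monom cov_NN)
      then have mp: "(mvps_monom c :: 'k mvps) \<in> pser n" and "sm (mvps_monom c) y = GG 0"
        using sm_ideal[OF _ y] by (auto simp: MI_def GG_zero)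
      then have mA: "mvps_monom c \<in> ?A" and "h (mvps_monom c) = 0"
        using EE_zero hI[OF EE_zero] by auto
      then have "lam (mvps_monom c) = 0" by (simp add: lam_def)
      moreover have "lam (mvps_monom c) = (\<Sum>a\<in>?D. mvps_monom c a * e a)" using e(2) mA by blast
      moreover have "(\<Sum>a\<in>?D. mvps_monom c a * e a) = (\<Sum>a\<in>?D. if a = c then e c else 0)"
        by (intro sum.cong) (auto simp: mvps_monom_def)
      moreover have "c \<in> ?D" using e(1) c by auto
      ultimately show False using c finD by simp
    qed
  qed
  have h_eq: "h f = act f e" if f: "f \<in> ?A" for f
  proof
    fix b
    have fp: "f \<in> pser n" using f by simp
    show "h f b = act f e b"
    proof (cases "b \<in> exps n")
      case True
      have xp: "pterm b 1 \<in> (pser n :: 'k mvps set)" by (rule pser_pterm[OF True])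
      have "h f b = act (pterm b 1) (h f) 0"
        by (simp only: act_pterm[OF fsuppD(1)[OF EE_fsupp[OF h(1)[OF f]]]] add_0_right mult_1_left)
      also have "\<dots> = lam (pmul (pterm b 1) f)" by (simp only: lam_def h_mult[OF f xp])
      also have "\<dots> = (\<Sum>a\<in>?D. pmul (pterm b 1) f a * e a)"
        using e(2) A.A_mult[OF f xp] by blast
      also have "\<dots> = (\<Sum>a\<in>?D. if b \<le> a then f (a - b) * e a else 0)"
        by (intro sum.cong) (auto simp: pmul_pterm)
      also have "\<dots> = act f e b"
        using e(1) by (intro act_eq_sum[symmetric, OF finD]) auto
      finally show ?thesis .
    next
      case False
      then have "h f b = 0" "act f e b = 0"
        using fsuppD(2)[OF EE_fsupp[OF h(1)[OF f]], of b] fsuppD(2)[OF EE_fsupp[OF EE_act[OF eE, of f]], of b] by auto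
      then show ?thesis by simp
    qed
  qed
  define y' where "y' = y \<ominus>\<^bsub>E\<^esub> GG e"
  have Ge: "GG e \<in> carrier E" by (rule GG_closed[OF eE])
  have y': "y' \<in> carrier E" using y Ge by (simp add: y'_def)
  have yy': "y = y' \<oplus>\<^bsub>E\<^esub> GG e"
    using y Ge by (simp add: y'_def a_minus_def E.M.a_assoc E.M.l_neg)
  have sm_y: "sm f y = sm f y' \<oplus>\<^bsub>E\<^esub> GG (act f e)" if "f \<in> pser n" for f
    by (subst yy') (simp only: sm_add_right[OF that y' Ge] GG_act[OF that eE])
  have kill: "sm f y' = \<zero>\<^bsub>E\<^esub>" if f: "f \<in> ?A" for f
  proof -
    have fp: "f \<in> pser n" using f by simp
    have "\<zero>\<^bsub>E\<^esub> \<oplus>\<^bsub>E\<^esub> GG (act f e) = sm f y' \<oplus>\<^bsub>E\<^esub> GG (act f e)"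
      using sm_y[OF fp] h(2)[OF f] GG_closed[OF EE_act[OF eE, of f]] by (simp add: h_eq[OF f])
    then show ?thesis
      using E.M.add.right_cancel[OF GG_closed[OF EE_act[OF eE, of f]] E.M.zero_closed sm_closed[OF fp y']] by simp
  qed
  let ?N = "(\<lambda>f. sm f y') ` pser n"
  have N: "submodule ?N RR E"
  proof (rule E.submoduleI)
    show "?N \<subseteq> carrier E" using sm_closed[OF _ y'] by auto
    have "sm 0 y' = \<zero>\<^bsub>E\<^esub>" using y' by (simp add: sm_def cl_zero)
    then show "\<zero>\<^bsub>E\<^esub> \<in> ?N" using imageI[OF pser_zero, of "\<lambda>f. sm f y'"] by simp
  next
    fix a assume "a \<in> ?N"
    then obtain f where f: "f \<in> pser n" "a = sm f y'" by auto
    have "sm (- f) y' \<oplus>\<^bsub>E\<^esub> sm f y' = sm (- f + f) y'"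
      by (rule sm_add_left[OF pser_minus[OF f(1)] f(1) y', symmetric])
    also have "\<dots> = \<zero>\<^bsub>E\<^esub>" using y' by (simp add: sm_def cl_zero)
    finally have "\<ominus>\<^bsub>E\<^esub> a = sm (- f) y'"
      using sm_closed[OF f(1) y'] sm_closed[OF pser_minus[OF f(1)] y'] f(2)
      by (intro E.M.minus_equality) auto
    then show "\<ominus>\<^bsub>E\<^esub> a \<in> ?N" using pser_minus[OF f(1)] by auto
  next
    fix a b assume "a \<in> ?N" "b \<in> ?N"
    then obtain f g where fg: "f \<in> pser n" "a = sm f y'" "g \<in> pser n" "b = sm g y'" by auto
    have "a \<oplus>\<^bsub>E\<^esub> b = sm (f + g) y'" unfolding fg by (rule sm_add_left[OF fg(1,3) y', symmetric])
    then show "a \<oplus>\<^bsub>E\<^esub> b \<in> ?N" using pser_add[OF fg(1,3)] by blast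
  next
    fix r a assume "r \<in> carrier RR" "a \<in> ?N"
    then obtain f g where fg: "f \<in> pser n" "a = sm f y'" "g \<in> pser n" "r = cl g" by (auto simp: carrier_RR)
    have "r \<odot>\<^bsub>E\<^esub> a = sm (pmul g f) y'" unfolding fg by (simp only: sm_mult[OF fg(3,1) y']) (simp only: sm_def)
    then show "r \<odot>\<^bsub>E\<^esub> a \<in> ?N" using pser_pmul[OF fg(3,1)] by blast
  qed
  have "y' = \<zero>\<^bsub>E\<^esub>"
  proof (rule ccontr)
    assume ne: "y' \<noteq> \<zero>\<^bsub>E\<^esub>"
    have "y' \<in> ?N" using imageI[OF cp[of 1], of "\<lambda>f. sm f y'"] by (simp only: sm_one[OF y'])
    with ne have "?N \<noteq> {\<zero>\<^bsub>E\<^esub>}" by auto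
    \<comment> \<open>If \<open>f\<close> moves \<open>y'\<close> into the socle, it moves
      \<open>y\<close> into the image of \<open>EE\<close>; so \<open>f\<close> belongs to
      \<open>?A\<close> and kills \<open>y'\<close>.\<close>
    from GG_ess[OF N this] obtain c where c: "c \<noteq> 0" "GG (pterm 0 c) \<in> ?N" by auto
    then obtain f where f: "f \<in> pser n" "GG (pterm 0 c) = sm f y'" by auto
    have pE: "pterm 0 c \<in> EE" by (rule EE_pterm[OF zero_NN])
    have aE: "act f e \<in> EE" by (rule EE_act[OF eE])
    have "sm f y = GG (pterm 0 c + act f e)"
      by (simp only: sm_y[OF f(1)] GG_add[OF pE aE] f(2))
    then have "sm f y \<in> GG ` EE" using EE_add[OF pE aE] by blast
    then have "f \<in> ?A" using f(1) by simp
    from kill[OF this] f(2) have "GG (pterm 0 c) = GG 0" by (simp only: GG_zero)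
    then have "pterm 0 c = (0 :: 'k mvps)" using inj_onD[OF GG_inj _ pE EE_zero] by simp
    then have "pterm 0 c (0 :: nat \<Rightarrow> nat) = 0" by (simp only: zero_fun_apply)
    with c(1) show False by (simp add: pterm_def)
  qed
  then have "y = GG e" using yy' Ge by simp
  then show ?thesis using eE by auto
qed

end

section \<open>Frobenius maps\<close>

context antichain
begin

text \<open>\<open>fr q\<close> is the natural Frobenius action on the injective hull \<open>E\<^sub>S\<close> of \<open>k\<close> over \<open>S\<close>; in the notation
  \<open>x\<^sup>-\<^sup>a\<^sup>-\<^sup>1\<close> for its basis, it raises to the \<open>q\<close>-th power, that is, \<open>a\<close> is sent to \<open>q a + (q - 1)\<close>.\<close>

definition fr :: "nat \<Rightarrow> 'k::field mvps \<Rightarrow> 'k mvps" where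
  "fr q z c = (if tw q (\<lambda>i. c i div q) = c then z (\<lambda>i. c i div q) ^ q else 0)"

lemma mult_add_pred_div: "(q * x + (q - 1)) div q = x" and mult_add_pred_mod: "(q * x + (q - 1)) mod q = q - 1"
  if "q > 0" for q x :: nat
proof -
  have "(q * x + r) div q = x" "(q * x + r) mod q = r" if "r < q" for r using that by simp_all
  from this[of "q - 1"] show "(q * x + (q - 1)) div q = x" "(q * x + (q - 1)) mod q = q - 1"
    using that by simp_all
qed

lemma tw_div: "q > 0 \<Longrightarrow> a \<in> exps n \<Longrightarrow> (\<lambda>i. tw q a i div q) = a"
proof
  fix i assume q: "q > 0" and a: "a \<in> exps n"
  show "tw q a i div q = a i"
  proof (cases "i < n")
    case True
    then show ?thesis by (simp only: tw_def if_True mult_add_pred_div[OF q])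
  next
    case False
    with a show ?thesis by (simp add: tw_def exps_def)
  qed
qed

lemma tw_inj: "q > 0 \<Longrightarrow> inj_on (tw q) (exps n)"
  by (rule inj_onI) (metis tw_div)

lemma fr_tw: "q > 0 \<Longrightarrow> a \<in> exps n \<Longrightarrow> fr q z (tw q a) = z a ^ q"
  by (simp add: fr_def tw_div)

lemma fr_nonzeroD:
  assumes "q > 0" "z \<in> fsupp n" "fr q z c \<noteq> 0"
  shows "c \<in> tw q ` {a. z a \<noteq> 0}"
proof -
  from assms(1,3) have "tw q (\<lambda>i. c i div q) = c" "z (\<lambda>i. c i div q) \<noteq> 0"
    by (auto simp: fr_def split: if_splits)
  then show ?thesis by (intro image_eqI[of c "tw q" "\<lambda>i. c i div q"]) simp_all
qed

lemma fr_fsupp: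
  assumes "q > 0" "z \<in> fsupp n"
  shows "fr q z \<in> fsupp n"
  unfolding fsupp_def
proof (intro CollectI conjI allI impI)
  show "finite {c. fr q z c \<noteq> 0}"
    by (rule finite_subset[of _ "tw q ` {a. z a \<noteq> 0}"])
       (use fr_nonzeroD[OF assms] fsuppD(1)[OF assms(2)] in auto)
  fix c assume "fr q z c \<noteq> 0"
  from fr_nonzeroD[OF assms this] show "c \<in> exps n" using tw_exps by auto
qed

lemma act_fr:
  assumes "q > 0" "z \<in> fsupp n"
  shows "act u (fr q z) b = (\<Sum>a\<in>{a. z a \<noteq> 0}. if b \<le> tw q a then u (tw q a - b) * z a ^ q else 0)"
proof -
  have sub: "{a. z a \<noteq> 0} \<subseteq> exps n" using fsuppD(2)[OF assms(2)] by auto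
  have "act u (fr q z) b = (\<Sum>c\<in>tw q ` {a. z a \<noteq> 0}. if b \<le> c then u (c - b) * fr q z c else 0)"
    by (rule act_eq_sum) (use fsuppD(1)[OF assms(2)] fr_nonzeroD[OF assms] in auto)
  also have "\<dots> = (\<Sum>a\<in>{a. z a \<noteq> 0}. if b \<le> tw q a then u (tw q a - b) * fr q z (tw q a) else 0)"
    by (simp add: sum.reindex[OF inj_on_subset[OF tw_inj[OF assms(1)] sub]])
  also have "\<dots> = (\<Sum>a\<in>{a. z a \<noteq> 0}. if b \<le> tw q a then u (tw q a - b) * z a ^ q else 0)"
    using sub assms(1) by (intro sum.cong refl) (auto simp: fr_tw)
  finally show ?thesis .
qed

lemma tw_le_iff: "q > 0 \<Longrightarrow> a \<in> exps n \<Longrightarrow> tw q a \<le> tw q d \<longleftrightarrow> a \<le> d"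
proof -
  assume q: "q > 0" and a: "a \<in> exps n"
  have "tw q a i \<le> tw q d i \<longleftrightarrow> a i \<le> d i" for i
  proof (cases "i < n")
    case True
    have "q * a i + r \<le> q * d i + r \<longleftrightarrow> a i \<le> d i" for r using q by simp
    with True show ?thesis by (simp only: tw_def if_True)
  next
    case False
    with a show ?thesis by (simp add: tw_def exps_def)
  qed
  then show ?thesis by (simp add: le_fun_def)
qed

text \<open>On the image of \<open>tw\<close>, freshman's dream moves the power into the sum, where
  \<open>tw q d - tw q a = q * (d - a)\<close> for \<open>a \<le> d\<close>. Off the image both
  sides vanish: if \<open>c \<le> tw q d\<close>, not all entries of \<open>tw q d - c\<close> are
  divisible by \<open>q\<close>.\<close>

lemma fr_act:
  assumes q: "q = CHAR('k::field) ^ e" and p: "Factorial_Ring.prime CHAR('k)" and z: "z \<in> fsupp n"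
  shows "fr q (act r z) = act (pfrob q r) (fr q (z :: 'k mvps))"
proof
  fix c
  let ?Z = "{a. z a \<noteq> 0}"
  have q0: "q > 0" using p by (simp add: q prime_gt_0_nat)
  have finZ: "finite ?Z" by (rule fsuppD(1)[OF z])
  note R = act_fr[OF q0 z, of "pfrob q r" c]
  show "fr q (act r z) c = act (pfrob q r) (fr q z) c"
  proof (cases "tw q (\<lambda>i. c i div q) = c")
    case True
    define a where "a = (\<lambda>i. c i div q)"
    have ca: "c = tw q a" using True by (simp add: a_def)
    have ax: "a \<in> exps n"
    proof -
      have "c \<in> exps n" unfolding ca by (rule tw_exps)
      then show ?thesis by (auto simp: a_def exps_def)
    qed
    have "fr q (act r z) c = act r z a ^ q" unfolding ca by (rule fr_tw[OF q0 ax])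
    also have "act r z a = (\<Sum>d\<in>?Z. if a \<le> d then r (d - a) * z d else 0)"
      by (rule act_eq_sum[OF finZ]) simp
    also have "\<dots> ^ q = (\<Sum>d\<in>?Z. (if a \<le> d then r (d - a) * z d else 0) ^ q)"
      by (rule freshmans_dream_sum'[OF p q])
    also have "\<dots> = (\<Sum>d\<in>?Z. if c \<le> tw q d then pfrob q r (tw q d - c) * z d ^ q else 0)"
    proof (rule sum.cong[OF refl])
      fix d assume d: "d \<in> ?Z"
      have "pfrob q r (tw q d - c) = r (d - a) ^ q" if "a \<le> d"
      proof -
        have dx: "d \<in> exps n" using d fsuppD(2)[OF z] by auto
        have "tw q d - c = (\<lambda>i. q * (d i - a i))"
          using ax dx by (auto simp: ca tw_def exps_def fun_eq_iff diff_mult_distrib2)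
        then show ?thesis using q0 by (simp add: pfrob_def fun_diff_def)
      qed
      then show "(if a \<le> d then r (d - a) * z d else 0) ^ q =
          (if c \<le> tw q d then pfrob q r (tw q d - c) * z d ^ q else 0)"
        using q0 by (simp add: ca tw_le_iff[OF q0 ax] power_mult_distrib)
    qed
    finally show ?thesis unfolding R .
  next
    case False
    have "pfrob q r (tw q d - c) = 0" if le: "c \<le> tw q d" for d
    proof (rule ccontr)
      assume "pfrob q r (tw q d - c) \<noteq> 0"
      then have dv: "q dvd tw q d i - c i" for i by (auto simp: pfrob_def split: if_splits)
      have "tw q (\<lambda>i. c i div q) i = c i" for i
      proof (cases "i < n")
        case True
        have ci: "c i \<le> q * d i + (q - 1)" using le_funD[OF le, of i] True by (simp add: tw_def)
        obtain k where "q * d i + (q - 1) - c i = q * k" using dv[of i] True by (auto simp: tw_def dvd_def)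
        then have eq: "q * d i + (q - 1) = c i + q * k" using ci by linarith
        have "(c i + q * k) mod q = (q * d i + (q - 1)) mod q" by (simp only: eq)
        then have "c i mod q = q - 1" by (simp only: mult_add_pred_mod[OF q0] mod_mult_self2)
        then show ?thesis using True mult_div_mod_eq[of q "c i"] by (simp add: tw_def)
      next
        case False
        then show ?thesis using le_funD[OF le, of i] by (simp add: tw_def)
      qed
      then have "tw q (\<lambda>i. c i div q) = c" by (rule ext)
      with \<open>tw q (\<lambda>i. c i div q) \<noteq> c\<close> show False ..
    qed
    then have "act (pfrob q r) (fr q z) c = 0" unfolding R by (intro sum.neutral) auto
    with False show ?thesis by (simp add: fr_def)
  qed
qed

text \<open>The twists compose, since
  \<open>q * (q' * a + q' - 1) + q - 1 = q * q' * a + q * q' - 1\<close>.\<close>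

lemma fr_fr: "q > 0 \<Longrightarrow> q' > 0 \<Longrightarrow> z \<in> fsupp n \<Longrightarrow> fr q (fr q' z) = fr (q * q') z"
proof
  fix c :: "nat \<Rightarrow> nat" assume q: "q > 0" "q' > 0" and z: "z \<in> fsupp n"
  have tt: "tw q (tw q' a) = tw (q * q') a" for a
  proof
    fix i
    obtain l where "q = Suc l" using q(1) by (cases q) auto
    moreover obtain l' where "q' = Suc l'" using q(2) by (cases q') auto
    ultimately show "tw q (tw q' a) i = tw (q * q') a i" by (simp add: tw_def algebra_simps)
  qed
  have dd: "(\<lambda>i. c i div q div q') = (\<lambda>i. c i div (q * q'))"
    by (simp add: div_mult2_eq)
  show "fr q (fr q' z) c = fr (q * q') z c"
  proof (cases "tw (q * q') (\<lambda>i. c i div (q * q')) = c")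
    case True
    define a where "a = (\<lambda>i. c i div (q * q'))"
    have ca: "tw (q * q') a = c" using True by (simp only: a_def)
    have ax: "a \<in> exps n"
    proof -
      have "c \<in> exps n" using tw_exps[of "q * q'" a] unfolding ca .
      then show ?thesis by (auto simp: exps_def a_def)
    qed
    have "fr q (fr q' z) (tw q (tw q' a)) = (z a ^ q') ^ q"
      by (simp only: fr_tw[OF q(1) tw_exps] fr_tw[OF q(2) ax])
    also have "\<dots> = fr (q * q') z (tw (q * q') a)"
      using q ax by (simp add: fr_tw power_mult[symmetric] mult.commute)
    finally show ?thesis by (simp only: tt ca)
  next
    case False
    have "fr q (fr q' z) c = 0"
    proof (rule ccontr)
      assume "fr q (fr q' z) c \<noteq> 0"
      then obtain b where b: "fr q' z b \<noteq> 0" "c = tw q b"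
        using fr_nonzeroD[OF q(1) fr_fsupp[OF q(2) z], of c] by auto
      then obtain a where a: "z a \<noteq> 0" "b = tw q' a" using fr_nonzeroD[OF q(2) z, of b] by auto
      have "c = tw (q * q') a" by (simp only: b a tt)
      moreover have "a \<in> exps n" using fsuppD(2)[OF z a(1)] .
      ultimately show False using False tw_div[of "q * q'" a] q by simp
    qed
    with False show ?thesis by (simp add: fr_def)
  qed
qed

lemma fr_add:
  assumes q: "q = CHAR('k::field) ^ e" and p: "Factorial_Ring.prime CHAR('k)"
  shows "fr q (z + w :: 'k mvps) = fr q z + fr q w"
  by (rule ext) (simp add: fr_def freshmans_dream'[OF p q])

section \<open>Classification of the \<open>p^e\<close>-linear maps on the model\<close>

text \<open>The conditions of \<open>frobenius_maps\<close> carried over to the model, with power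
  series in place of their classes.\<close>

definition semi :: "nat \<Rightarrow> ('k::field mvps \<Rightarrow> 'k mvps) \<Rightarrow> bool" where
  "semi q \<psi> \<longleftrightarrow> (\<forall>z\<in>EE. \<psi> z \<in> EE) \<and> (\<forall>z\<in>EE. \<forall>w\<in>EE. \<psi> (z + w) = \<psi> z + \<psi> w) \<and>
    (\<forall>r\<in>pser n. \<forall>z\<in>EE. \<psi> (act r z) = act (pfrob q r) (\<psi> z))"

text \<open>Normal forms of the multipliers: with \<open>q = p^e\<close>, the maps of degree
  \<open>e\<close> correspond to them one to one.\<close>

definition useries :: "nat \<Rightarrow> 'k::field mvps set" where
  "useries q = {u. \<forall>c. u c \<noteq> 0 \<longrightarrow> c \<in> TT q}"

lemma useries_pser: "u \<in> useries q \<Longrightarrow> u \<in> pser n"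
  using TT_CC CC_exps by (force simp: useries_def pser_def)

lemma act_fr_EE:
  assumes q: "q > 0" and u: "u \<in> useries q" and z: "z \<in> EE"
  shows "act u (fr q z) \<in> EE"
proof -
  have "b \<in> NN" if "act u (fr q z) b \<noteq> 0" for b
  proof -
    from act_nonzeroD[OF that] obtain c where c: "fr q z c \<noteq> 0" "b \<le> c" "u (c - b) \<noteq> 0" by auto
    from fr_nonzeroD[OF q EE_fsupp[OF z] c(1)] obtain a where a: "z a \<noteq> 0" "c = tw q a" by auto
    have "c - b \<in> TT q" using u c(3) by (simp add: useries_def)
    moreover have "c - b + b = tw q a" using c(2) a(2) by (auto simp: fun_eq_iff le_fun_def)
    ultimately show ?thesis by (rule TT_decompose(2)[OF q _ EE_NN[OF z a(1)]])
  qed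
  then show ?thesis using act_fsupp[OF fr_fsupp[OF q EE_fsupp[OF z]], of u] by (simp add: EE_def)
qed

lemma act_pterm_pterm:
  "act (pterm d s) (pterm a t) = (if d \<le> a then pterm (a - d) (s * t) else 0)" for s t :: "'k::field"
proof
  fix b
  have fin: "finite {c. pterm a t c \<noteq> 0}" by (rule finite_subset[of _ "{a}"]) (auto simp: pterm_def)
  have "d + b = a \<longleftrightarrow> d \<le> a \<and> b = a - d" by (rule add_eq_iff_le_diff)
  then show "act (pterm d s) (pterm a t) b = (if d \<le> a then pterm (a - d) (s * t) else 0) b"
    by (simp only: act_pterm[OF fin]) (auto simp: pterm_def)
qed

lemma pfrob_pterm: "q > 0 \<Longrightarrow> pfrob q (pterm a t) = pterm (\<lambda>i. q * a i) (t ^ q)" for t :: "'k::field"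
proof
  fix c assume q: "q > 0"
  show "pfrob q (pterm a t) c = pterm (\<lambda>i. q * a i) (t ^ q) c"
  proof (cases "\<forall>i. q dvd c i")
    case True
    then have "(\<lambda>i. q * (c i div q)) = c" by (intro ext) simp
    then have "(\<lambda>i. c i div q) = a \<longleftrightarrow> c = (\<lambda>i. q * a i)" using q by auto
    with True q show ?thesis by (simp add: pfrob_def pterm_def)
  next
    case False
    then have "c \<noteq> (\<lambda>i. q * a i)" by auto
    with False show ?thesis by (auto simp: pfrob_def pterm_def)
  qed
qed

lemma semi_closed: "semi q \<psi> \<Longrightarrow> z \<in> EE \<Longrightarrow> \<psi> z \<in> EE"
  and semi_add: "semi q \<psi> \<Longrightarrow> z \<in> EE \<Longrightarrow> w \<in> EE \<Longrightarrow> \<psi> (z + w) = \<psi> z + \<psi> w"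
  and semi_act: "semi q \<psi> \<Longrightarrow> r \<in> pser n \<Longrightarrow> z \<in> EE \<Longrightarrow> \<psi> (act r z) = act (pfrob q r) (\<psi> z)"
  by (simp_all add: semi_def)

lemma semi_zero: "semi q \<psi> \<Longrightarrow> \<psi> 0 = 0"
proof -
  assume s: "semi q \<psi>"
  have "\<psi> (0 + 0) = \<psi> 0 + \<psi> 0" by (rule semi_add[OF s EE_zero EE_zero])
  then show ?thesis by (simp only: add_0_left add_cancel_right_right)
qed

lemma semi_monomial:
  assumes q: "q > 0" and s: "semi q \<psi>" and a: "a \<in> NN" and d: "d \<in> exps n"
  shows "\<psi> (act (pterm d t) (pterm a 1)) b = t ^ q * \<psi> (pterm a 1) ((\<lambda>i. q * d i) + b)"
proof -
  have aE: "pterm a 1 \<in> EE" by (rule EE_pterm[OF a])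
  then have pE: "\<psi> (pterm a 1) \<in> EE" by (rule semi_closed[OF s])
  have "\<psi> (act (pterm d t) (pterm a 1)) = act (pfrob q (pterm d t)) (\<psi> (pterm a 1))"
    by (rule semi_act[OF s pser_pterm[OF d] aE])
  then show ?thesis
    by (simp only: pfrob_pterm[OF q] act_pterm[OF fsuppD(1)[OF EE_fsupp[OF pE]]])
qed

text \<open>The coefficient depends only on \<open>c = tw q a - b\<close>. Both sides are compared
  with the pair of the componentwise minima \<open>m\<close> of \<open>a, a'\<close> and
  \<open>l\<close> of \<open>b, b'\<close>: as twists differ by multiples of \<open>q\<close>,
  \<open>b = q * (a - m) + l\<close>, which is the shift that semilinearity attaches to contraction
  from \<open>a\<close> to \<open>m\<close>.\<close>

lemma semi_consistent:
  assumes q: "q > 0" and s: "semi q \<psi>" and a: "a \<in> NN" "a' \<in> NN"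
    and c: "c + b = tw q a" "c + b' = tw q a'"
  shows "\<psi> (pterm a 1) b = \<psi> (pterm a' 1) b'"
proof -
  have bx: "b \<in> exps n" "b' \<in> exps n"
    using tw_exps[of q a] tw_exps[of q a'] unfolding c[symmetric] exps_add by simp_all
  have ax: "a \<in> exps n" "a' \<in> exps n" using a NN_exps by auto
  define m where "m = (\<lambda>i. min (a i) (a' i))"
  define l where "l = (\<lambda>i. min (b i) (b' i))"
  have eqn: "(\<lambda>i. q * (a - m) i) + l = b" "(\<lambda>i. q * (a' - m) i) + l = b'"
  proof -
    have "q * (a i - m i) + l i = b i \<and> q * (a' i - m i) + l i = b' i" for i
    proof (cases "i < n")
      case True
      have e1: "c i + b i = q * a i + (q - 1)" using fun_cong[OF c(1), of i] True by (simp add: tw_def)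
      have e2: "c i + b' i = q * a' i + (q - 1)" using fun_cong[OF c(2), of i] True by (simp add: tw_def)
      show ?thesis
      proof (cases "a i \<le> a' i")
        case True
        then have le: "q * a i \<le> q * a' i" by simp
        have ble: "b i \<le> b' i" using e1 e2 le by linarith
        have eq: "q * a' i - q * a i + b i = b' i" using e1 e2 le by linarith
        have "l i = b i" "m i = a i" using True ble by (simp_all add: l_def m_def)
        then show ?thesis using eq by (simp only: diff_mult_distrib2 diff_self_eq_0 add_0_left simp_thms)
      next
        case False
        then have le: "q * a' i \<le> q * a i" by simp
        have ble: "b' i \<le> b i" using e1 e2 le by linarith
        have eq: "q * a i - q * a' i + b' i = b i" using e1 e2 le by linarith
        have "l i = b' i" "m i = a' i" using False ble by (simp_all add: l_def m_def)
        then show ?thesis using eq by (simp only: diff_mult_distrib2 diff_self_eq_0 add_0_left simp_thms)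
      qed
    next
      case False
      then show ?thesis using ax bx by (auto simp: exps_def m_def l_def)
    qed
    then show "(\<lambda>i. q * (a - m) i) + l = b" "(\<lambda>i. q * (a' - m) i) + l = b'" by (auto simp: fun_eq_iff)
  qed
  have m: "a - m \<le> a" "a' - m \<le> a'" "a - (a - m) = m" "a' - (a' - m) = m"
    by (auto simp: le_fun_def fun_eq_iff m_def)
  have mx: "a - m \<in> exps n" "a' - m \<in> exps n" using exps_mono[OF ax(1) m(1)] exps_mono[OF ax(2) m(2)] .
  have "\<psi> (pterm m 1) l = \<psi> (pterm a 1) b"
    using semi_monomial[OF q s a(1) mx(1), of 1 l] unfolding act_pterm_pterm eqn(1) m(3) by (simp add: m(1))
  moreover have "\<psi> (pterm m 1) l = \<psi> (pterm a' 1) b'"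
    using semi_monomial[OF q s a(2) mx(2), of 1 l] unfolding act_pterm_pterm eqn(2) m(4) by (simp add: m(2))
  ultimately show ?thesis by simp
qed

text \<open>The multiplier of \<open>\<psi>\<close>: a pair exists by \<open>TT_decompose\<close>,
  and by \<open>semi_consistent\<close> its choice does not matter.\<close>

definition cof :: "nat \<Rightarrow> ('k::field mvps \<Rightarrow> 'k mvps) \<Rightarrow> 'k mvps" where
  "cof q \<psi> c = (if c \<in> TT q then
     (let (a, b) = (SOME (a, b). a \<in> NN \<and> c + b = tw q a) in \<psi> (pterm a 1) b) else 0)"

lemma cof_useries: "cof q \<psi> \<in> useries q"
  by (simp add: useries_def cof_def)

lemma cof_eq:
  assumes q: "q > 0" and s: "semi q \<psi>" and c: "c \<in> TT q" "a \<in> NN" "c + b = tw q a"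
  shows "cof q \<psi> c = \<psi> (pterm a 1) b"
proof -
  obtain a' b' where ab': "(SOME (a, b). a \<in> NN \<and> c + b = tw q a) = (a', b')" by (cases "SOME (a, b). a \<in> NN \<and> c + b = tw q a")
  have "case (SOME (a, b). a \<in> NN \<and> c + b = tw q a) of (a, b) \<Rightarrow> a \<in> NN \<and> c + b = tw q a"
    by (rule someI[of _ "(a, b)"]) (simp add: c)
  then have "a' \<in> NN" "c + b' = tw q a'" unfolding ab' by simp_all
  from semi_consistent[OF q s this(1) c(2) this(2) c(3)] show ?thesis
    using c(1) unfolding cof_def by (simp add: ab')
qed

lemma semi_at_monomial:
  assumes q: "q > 0" and s: "semi q \<psi>" and a: "a \<in> NN"
  shows "\<psi> (pterm a 1) b = (if b \<le> tw q a then cof q \<psi> (tw q a - b) else 0)"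
proof -
  have aE: "pterm a 1 \<in> EE" by (rule EE_pterm[OF a])
  then have pE: "\<psi> (pterm a 1) \<in> EE" by (rule semi_closed[OF s])
  show ?thesis
  proof (cases "b \<le> tw q a")
    case True
    let ?c = "tw q a - b"
    have cb: "?c + b = tw q a" using le_funD[OF True] by (auto simp: fun_eq_iff)
    show ?thesis
    proof (cases "?c \<in> TT q")
      case T: True
      with cof_eq[OF q s T a cb] True show ?thesis by simp
    next
      case F: False
      \<comment> \<open>A nonzero coefficient would recur at every pair with the same
        \<open>?c\<close>, so all such pairs would end in \<open>NN\<close>, which puts
        \<open>?c\<close> into \<open>TT q\<close>.\<close>
      have "\<psi> (pterm a 1) b = 0"
      proof (rule ccontr)
        assume nz: "\<psi> (pterm a 1) b \<noteq> 0"
        have all: "b' \<in> NN" if a': "a' \<in> NN" "?c + b' = tw q a'" for a' b'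
        proof -
          have "\<psi> (pterm a' 1) b' \<noteq> 0" using semi_consistent[OF q s a a'(1) cb a'(2)] nz by simp
          moreover have "\<psi> (pterm a' 1) \<in> EE" by (rule semi_closed[OF s EE_pterm[OF a'(1)]])
          ultimately show ?thesis by (rule EE_NN[rotated])
        qed
        have "?c \<in> TT q" by (rule TT_I[OF q a cb]) (rule all)
        with F show False by simp
      qed
      with F show ?thesis by (simp add: cof_def)
    qed
  next
    case False
    then obtain i where i: "tw q a i < b i" by (auto simp: le_fun_def not_le)
    have "\<psi> (pterm a 1) b = 0"
    proof (cases "i < n")
      case True
      \<comment> \<open>\<open>tw q a i < b i\<close> means \<open>q * Suc (a i) \<le> b i\<close>,
        so the coefficient reappears in the image of the contraction by \<open>?d\<close>, and that
        contraction kills \<open>pterm a 1\<close>.\<close>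
      let ?d = "\<lambda>j. if j = i then Suc (a i) else 0"
      have dx: "?d \<in> exps n" using True by (simp add: exps_def)
      have "\<not> ?d \<le> a" by (auto simp: le_fun_def intro!: exI[of _ i])
      then have z: "act (pterm ?d 1) (pterm a (1 :: 'a)) = 0" by (simp only: act_pterm_pterm if_False)
      have "(\<lambda>j. q * ?d j) + (b - (\<lambda>j. q * ?d j)) = b"
        using i True q by (auto simp: fun_eq_iff tw_def)
      then have "\<psi> (pterm a 1) b = 0 (b - (\<lambda>j. q * ?d j))"
        using semi_monomial[OF q s a dx, of 1 "b - (\<lambda>j. q * ?d j)"] unfolding z semi_zero[OF s]
        by (simp only: power_one mult_1_left)
      then show ?thesis by simp
    next
      case False
      then have "b \<notin> exps n" using i by (auto simp: exps_def intro!: exI[of _ i])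
      then show ?thesis using fsuppD(2)[OF EE_fsupp[OF pE], of b] by auto
    qed
    with False show ?thesis by simp
  qed
qed

lemma semi_eq_act:
  assumes q: "q > 0" and s: "semi q \<psi>" and z: "z \<in> EE"
  shows "\<psi> z = act (cof q \<psi>) (fr q z)"
proof
  fix b
  let ?Z = "{a. z a \<noteq> 0}"
  have finZ: "finite ?Z" by (rule fsuppD(1)[OF EE_fsupp[OF z]])
  have main: "(\<Sum>a\<in>D. pterm a (z a)) \<in> EE \<and>
      \<psi> (\<Sum>a\<in>D. pterm a (z a)) b = (\<Sum>a\<in>D. z a ^ q * \<psi> (pterm a 1) b)" if "finite D" "D \<subseteq> NN" for D
    using that
  proof (induction D rule: finite_induct)
    case empty
    show ?case unfolding sum.empty semi_zero[OF s] by (intro conjI EE_zero) simp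
  next
    case (insert a D)
    have a: "a \<in> NN" using insert.prems by simp
    have pE: "pterm a (z a) \<in> EE" by (rule EE_pterm[OF a])
    have IH: "(\<Sum>a\<in>D. pterm a (z a)) \<in> EE" "\<psi> (\<Sum>a\<in>D. pterm a (z a)) b = (\<Sum>a\<in>D. z a ^ q * \<psi> (pterm a 1) b)"
      using insert.IH insert.prems by auto
    have S: "(\<Sum>a\<in>insert a D. pterm a (z a)) = pterm a (z a) + (\<Sum>a\<in>D. pterm a (z a))"
      by (rule sum.insert[OF insert.hyps])
    have add: "\<psi> (pterm a (z a) + (\<Sum>a\<in>D. pterm a (z a))) = \<psi> (pterm a (z a)) + \<psi> (\<Sum>a\<in>D. pterm a (z a))"
      by (rule semi_add[OF s pE IH(1)])
    have "act (pterm 0 (z a)) (pterm a 1) = pterm a (z a)"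
      by (simp add: act_pterm_pterm le_fun_def fun_diff_def)
    then have "\<psi> (pterm a (z a)) b = z a ^ q * \<psi> (pterm a 1) ((\<lambda>i. q * (0 :: nat \<Rightarrow> nat) i) + b)"
      using semi_monomial[OF q s a zero_in_exps, of "z a" b] by (simp only:)
    also have "(\<lambda>i. q * (0 :: nat \<Rightarrow> nat) i) + b = b" by (simp add: fun_eq_iff)
    finally have m: "\<psi> (pterm a (z a)) b = z a ^ q * \<psi> (pterm a 1) b" .
    show ?case
      unfolding S add plus_fun_apply[of "\<psi> _"] m IH(2) sum.insert[OF insert.hyps]
      by (intro conjI EE_add pE IH(1) refl)
  qed
  have sub: "?Z \<subseteq> NN" using EE_NN[OF z] by auto
  have zsum: "(\<Sum>a\<in>?Z. pterm a (z a)) = z"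
  proof
    fix c show "(\<Sum>a\<in>?Z. pterm a (z a)) c = z c"
      using finZ by (cases "z c = 0") (simp_all add: sum_fun_apply pterm_def)
  qed
  have "\<psi> z b = (\<Sum>a\<in>?Z. z a ^ q * \<psi> (pterm a 1) b)"
    using main[OF finZ sub] unfolding zsum by (rule conjunct2)
  also have "\<dots> = (\<Sum>a\<in>?Z. if b \<le> tw q a then cof q \<psi> (tw q a - b) * z a ^ q else 0)"
    using EE_NN[OF z] by (intro sum.cong refl) (simp add: semi_at_monomial[OF q s])
  also have "\<dots> = act (cof q \<psi>) (fr q z) b" by (rule act_fr[OF q EE_fsupp[OF z], symmetric])
  finally show "\<psi> z b = act (cof q \<psi>) (fr q z) b" .
qed

lemma cof_unique:
  assumes q: "q > 0" and s: "semi q \<psi>" and w: "\<And>z. z \<in> EE \<Longrightarrow> \<psi> z = act w (fr q z)" and c: "c \<in> TT q"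
  shows "cof q \<psi> c = w c"
proof -
  obtain a b where ab: "a \<in> NN" "c + b = tw q a" using TT_decompose(1)[OF q c] by blast
  have aE: "pterm a 1 \<in> (EE :: 'a mvps set)" by (rule EE_pterm[OF ab(1)])
  have cb: "b \<le> tw q a" "tw q a - b = c"
    using ab(2) add_eq_iff_le_diff[of b c "tw q a"] by (auto simp: add.commute)
  have Z: "{a'. pterm a (1::'a) a' \<noteq> 0} = {a}" by (auto simp: pterm_def)
  have "cof q \<psi> c = \<psi> (pterm a 1) b" by (rule cof_eq[OF q s c ab])
  also have "\<dots> = act w (fr q (pterm a 1)) b" by (simp only: w[OF aE])
  also have "\<dots> = w c" unfolding act_fr[OF q EE_fsupp[OF aE]] Z using cb by (simp add: pterm_def)
  finally show ?thesis .
qed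

end

lemma pfrob_pser:
  fixes f :: "'k::field mvps"
  assumes "Factorial_Ring.prime CHAR('k)" "f \<in> pser n"
  shows "pfrob (CHAR('k) ^ e) f \<in> pser n"
proof -
  interpret cring "mvps_ring n :: 'k mvps ring" by (rule cring_mvps)
  show ?thesis
    using nat_pow_closed[of f "CHAR('k) ^ e"] assms(2)
    by (simp only: mvps_ring_simps(1) pser_pow_char_power[OF assms])
qed

section \<open>Generators of the Frobenius algebra\<close>

locale frobenius_hull = hull n FF E for n FF and E :: "('k::field mvps set, 'e) module" +
  fixes p :: nat
  assumes prime_char: "Factorial_Ring.prime CHAR('k)" and p_char: "p = CHAR('k)"
begin

abbreviation "pw e \<equiv> p ^ e"
abbreviation "FM \<equiv> frobenius_maps p RR E"

lemma pw_char: "pw e = CHAR('k) ^ e"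
  by (simp only: p_char)

lemma pow_pfrob: "f \<in> pser n \<Longrightarrow> f [^]\<^bsub>SS\<^esub> pw e = pfrob (pw e) f"
  unfolding pw_char by (rule pser_pow_char_power[OF prime_char])

lemma pfrob_closed: "f \<in> pser n \<Longrightarrow> pfrob (pw e) (f :: 'k mvps) \<in> pser n"
  unfolding pw_char by (rule pfrob_pser[OF prime_char])

definition GI :: "'e \<Rightarrow> 'k mvps" where
  "GI = inv_into EE GG"

lemma GI: "y \<in> carrier E \<Longrightarrow> GI y \<in> EE" "y \<in> carrier E \<Longrightarrow> GG (GI y) = y"
  unfolding GI_def using GG_surj_at by (simp_all add: inv_into_into f_inv_into_f)

lemma GI_GG: "z \<in> EE \<Longrightarrow> GI (GG z) = z"
  unfolding GI_def by (rule inv_into_f_f[OF GG_inj])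

lemma pw_pos: "pw e > 0"
  using prime_char by (simp add: p_char prime_gt_0_nat)

text \<open>\<open>rep e w \<phi>\<close> expresses that \<open>\<phi>\<close> is \<open>w\<close> times the natural Frobenius action.\<close>

definition rep :: "nat \<Rightarrow> 'k mvps \<Rightarrow> ('e \<Rightarrow> 'e) \<Rightarrow> bool" where
  "rep e w \<phi> \<longleftrightarrow> \<phi> \<in> extensional (carrier E) \<and>
     (\<forall>z\<in>EE. act w (fr (pw e) z) \<in> EE \<and> \<phi> (GG z) = GG (act w (fr (pw e) z)))"

definition cf :: "nat \<Rightarrow> ('e \<Rightarrow> 'e) \<Rightarrow> 'k mvps" where
  "cf e \<phi> = cof (pw e) (\<lambda>z. GI (\<phi> (GG z)))"

lemma rep_ext: "rep e w \<phi> \<Longrightarrow> \<phi> \<in> extensional (carrier E)"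
  and rep_EE: "rep e w \<phi> \<Longrightarrow> z \<in> EE \<Longrightarrow> act w (fr (pw e) z) \<in> EE"
  and rep_GG: "rep e w \<phi> \<Longrightarrow> z \<in> EE \<Longrightarrow> \<phi> (GG z) = GG (act w (fr (pw e) z))"
  by (simp_all add: rep_def)

lemma rep_FM:
  assumes r: "rep e w \<phi>"
  shows "\<phi> \<in> FM e"
  unfolding frobenius_maps_def
proof (intro CollectI conjI ballI)
  show "\<phi> \<in> carrier E \<rightarrow>\<^sub>E carrier E"
    unfolding PiE_def
  proof (intro IntI rep_ext[OF r] Pi_I)
    fix y assume y: "y \<in> carrier E"
    have "\<phi> (GG (GI y)) \<in> carrier E" unfolding rep_GG[OF r GI(1)[OF y]] by (intro GG_closed rep_EE[OF r] GI(1)[OF y])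
    then show "\<phi> y \<in> carrier E" unfolding GI(2)[OF y] .
  qed
  note fz = fr_fsupp[OF pw_pos EE_fsupp]
  fix x assume x: "x \<in> carrier E"
  obtain z where z: "z \<in> EE" "x = GG z" using GI[OF x] by metis
  show "\<phi> (x \<oplus>\<^bsub>E\<^esub> y) = \<phi> x \<oplus>\<^bsub>E\<^esub> \<phi> y" if y: "y \<in> carrier E" for y
  proof -
    obtain v where v: "v \<in> EE" "y = GG v" using GI[OF y] by metis
    have eq: "act w (fr (pw e) (z + v)) = act w (fr (pw e) z) + act w (fr (pw e) v)"
      by (simp only: fr_add[OF pw_char prime_char] act_add_right[OF fz[OF z(1)] fz[OF v(1)]])
    have "\<phi> (GG (z + v)) = GG (act w (fr (pw e) z) + act w (fr (pw e) v))"
      unfolding rep_GG[OF r EE_add[OF z(1) v(1)]] eq ..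
    then show ?thesis
      unfolding z(2) v(2) GG_add[OF z(1) v(1)] rep_GG[OF r z(1)] rep_GG[OF r v(1)]
        GG_add[OF rep_EE[OF r z(1)] rep_EE[OF r v(1)]] .
  qed
  fix t assume "t \<in> carrier RR"
  then obtain f where f: "f \<in> pser n" "t = cl f" by (auto simp: carrier_RR)
  note pf = pfrob_closed[OF f(1), of e]
  have eq: "act w (fr (pw e) (act f z)) = act (pfrob (pw e) f) (act w (fr (pw e) z))"
    by (simp only: fr_act[OF pw_char prime_char EE_fsupp[OF z(1)]] act_pmul[OF fz[OF z(1)], symmetric])
       (simp only: pmul_commute)
  have "\<phi> (GG (act f z)) = sm (pfrob (pw e) f) (GG (act w (fr (pw e) z)))"
    unfolding rep_GG[OF r EE_act[OF z(1)]] eq GG_act[OF pf rep_EE[OF r z(1)]] ..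
  then have "\<phi> (sm f (GG z)) = sm (pfrob (pw e) f) (\<phi> (GG z))"
    unfolding GG_act[OF f(1) z(1)] rep_GG[OF r z(1)] .
  moreover have "t [^]\<^bsub>RR\<^esub> pw e = cl (pfrob (pw e) f)"
    unfolding f(2) cl_pow[OF f(1)] pow_pfrob[OF f(1)] ..
  ultimately show "\<phi> (t \<odot>\<^bsub>E\<^esub> x) = (t [^]\<^bsub>RR\<^esub> (p ^ e)) \<odot>\<^bsub>E\<^esub> \<phi> x"
    by (simp only: sm_def z(2) f(2))
qed

lemma FM_closed: "\<phi> \<in> FM e \<Longrightarrow> y \<in> carrier E \<Longrightarrow> \<phi> y \<in> carrier E"
  by (auto simp: frobenius_maps_def PiE_def Pi_def)

lemma FM_semi:
  assumes \<phi>: "\<phi> \<in> FM e"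
  shows "semi (pw e) (\<lambda>z. GI (\<phi> (GG z)))"
  unfolding semi_def
proof (intro conjI ballI)
  have add: "\<phi> (x \<oplus>\<^bsub>E\<^esub> y) = \<phi> x \<oplus>\<^bsub>E\<^esub> \<phi> y" if "x \<in> carrier E" "y \<in> carrier E" for x y
    using \<phi> that by (simp add: frobenius_maps_def)
  have sml: "\<phi> (r \<odot>\<^bsub>E\<^esub> x) = (r [^]\<^bsub>RR\<^esub> pw e) \<odot>\<^bsub>E\<^esub> \<phi> x" if "r \<in> carrier RR" "x \<in> carrier E" for r x
    using \<phi> that by (simp add: frobenius_maps_def)
  fix z :: "'k mvps" assume z: "z \<in> EE"
  have cz: "\<phi> (GG z) \<in> carrier E" by (rule FM_closed[OF \<phi> GG_closed[OF z]])
  show "GI (\<phi> (GG z)) \<in> EE" by (rule GI(1)[OF cz])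
  show "GI (\<phi> (GG (z + w))) = GI (\<phi> (GG z)) + GI (\<phi> (GG w))" if w: "w \<in> EE" for w
  proof -
    have cw: "\<phi> (GG w) \<in> carrier E" by (rule FM_closed[OF \<phi> GG_closed[OF w]])
    have "\<phi> (GG (z + w)) = GG (GI (\<phi> (GG z)) + GI (\<phi> (GG w)))"
      by (simp only: GG_add[OF z w] add[OF GG_closed[OF z] GG_closed[OF w]]
          GG_add[OF GI(1)[OF cz] GI(1)[OF cw]] GI(2)[OF cz] GI(2)[OF cw])
    then show ?thesis by (simp only: GI_GG[OF EE_add[OF GI(1)[OF cz] GI(1)[OF cw]]])
  qed
  show "GI (\<phi> (GG (act f z))) = act (pfrob (pw e) f) (GI (\<phi> (GG z)))" if f: "f \<in> pser n" for f
  proof -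
    note pf = pfrob_closed[OF f, of e]
    have "\<phi> (GG (act f z)) = \<phi> (cl f \<odot>\<^bsub>E\<^esub> GG z)" by (simp only: GG_act[OF f z] sm_def)
    also have "\<dots> = (cl f [^]\<^bsub>RR\<^esub> pw e) \<odot>\<^bsub>E\<^esub> \<phi> (GG z)" by (rule sml[OF cl_carrier[OF f] GG_closed[OF z]])
    also have "cl f [^]\<^bsub>RR\<^esub> pw e = cl (pfrob (pw e) f)"
      by (simp only: cl_pow[OF f] pow_pfrob[OF f])
    also have "cl (pfrob (pw e) f) \<odot>\<^bsub>E\<^esub> \<phi> (GG z) = GG (act (pfrob (pw e) f) (GI (\<phi> (GG z))))"
      by (simp only: GG_act[OF pf GI(1)[OF cz]] sm_def GI(2)[OF cz])
    finally show ?thesis by (simp only: GI_GG[OF EE_act[OF GI(1)[OF cz]]])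
  qed
qed

lemma FM_rep:
  assumes \<phi>: "\<phi> \<in> FM e"
  shows "rep e (cf e \<phi>) \<phi>"
  unfolding rep_def
proof (intro conjI ballI)
  show "\<phi> \<in> extensional (carrier E)" using \<phi> by (simp add: frobenius_maps_def PiE_def)
  fix z :: "'k mvps" assume z: "z \<in> EE"
  note s = FM_semi[OF \<phi>]
  have eq: "GI (\<phi> (GG z)) = act (cf e \<phi>) (fr (pw e) z)"
    unfolding cf_def by (rule semi_eq_act[OF pw_pos s z])
  show "act (cf e \<phi>) (fr (pw e) z) \<in> EE"
    unfolding eq[symmetric] by (rule semi_closed[OF s z])
  show "\<phi> (GG z) = GG (act (cf e \<phi>) (fr (pw e) z))"
    unfolding eq[symmetric] by (rule GI(2)[symmetric, OF FM_closed[OF \<phi> GG_closed[OF z]]])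
qed

lemma cf_useries: "cf e \<phi> \<in> useries (pw e)"
  unfolding cf_def by (rule cof_useries)

lemma cf_outside: "c \<notin> TT (pw e) \<Longrightarrow> cf e \<phi> c = 0"
  by (simp add: cf_def cof_def)

lemma rep_cf:
  assumes r: "rep e w \<phi>" and c: "c \<in> TT (pw e)"
  shows "cf e \<phi> c = w c"
  unfolding cf_def
proof (rule cof_unique[OF pw_pos FM_semi[OF rep_FM[OF r]] _ c])
  fix z :: "'k mvps" assume z: "z \<in> EE"
  show "GI (\<phi> (GG z)) = act w (fr (pw e) z)"
    by (simp only: rep_GG[OF r z] GI_GG[OF rep_EE[OF r z]])
qed

lemma cf_inj:
  assumes "\<phi> \<in> FM e" "\<phi>' \<in> FM e" "cf e \<phi> = cf e \<phi>'"
  shows "\<phi> = \<phi>'"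
proof (rule extensionalityI[of _ "carrier E"])
  note r = FM_rep[OF assms(1)] FM_rep[OF assms(2)]
  show "\<phi> \<in> extensional (carrier E)" "\<phi>' \<in> extensional (carrier E)"
    by (rule rep_ext[OF r(1)], rule rep_ext[OF r(2)])
  fix y assume y: "y \<in> carrier E"
  have "\<phi> (GG (GI y)) = \<phi>' (GG (GI y))"
    by (simp only: rep_GG[OF r(1) GI(1)[OF y]] rep_GG[OF r(2) GI(1)[OF y]] assms(3))
  then show "\<phi> y = \<phi>' y" by (simp only: GI(2)[OF y])
qed

definition mk :: "nat \<Rightarrow> 'k mvps \<Rightarrow> 'e \<Rightarrow> 'e" where
  "mk e u = (\<lambda>y\<in>carrier E. GG (act u (fr (pw e) (GI y))))"

lemma mk_rep:
  assumes "u \<in> useries (pw e)"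
  shows "rep e u (mk e u)"
  unfolding rep_def
proof (intro conjI ballI)
  show "mk e u \<in> extensional (carrier E)" by (simp add: mk_def)
  fix z :: "'k mvps" assume z: "z \<in> EE"
  show "act u (fr (pw e) z) \<in> EE" by (rule act_fr_EE[OF pw_pos assms z])
  show "mk e u (GG z) = GG (act u (fr (pw e) z))"
    by (simp add: mk_def GG_closed[OF z] GI_GG[OF z])
qed

lemma cf_eqI:
  assumes "rep e w \<phi>" "w \<in> useries (pw e)"
  shows "cf e \<phi> = w"
proof
  fix c show "cf e \<phi> c = w c"
    using rep_cf[OF assms(1)] cf_outside assms(2) by (cases "c \<in> TT (pw e)") (auto simp: useries_def)
qed

lemma cf_mk: "u \<in> useries (pw e) \<Longrightarrow> cf e (mk e u) = u"
  by (rule cf_eqI[OF mk_rep])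

abbreviation "Zr \<equiv> (\<lambda>z\<in>carrier E. \<zero>\<^bsub>E\<^esub>)"

lemma act_zero_left: "act 0 z = 0"
  by (rule ext) (simp add: act_def)

lemma zero_rep: "rep e 0 Zr"
  unfolding rep_def act_zero_left by (simp add: EE_zero GG_zero GG_closed)

lemma useries_zero: "0 \<in> useries q"
  by (simp add: useries_def)

lemma cf_zero: "cf e Zr = 0"
  by (rule cf_eqI[OF zero_rep useries_zero])

lemma add_rep:
  assumes "rep e u \<phi>" "rep e v \<phi>'"
  shows "rep e (u + v) (\<lambda>z\<in>carrier E. \<phi> z \<oplus>\<^bsub>E\<^esub> \<phi>' z)"
  unfolding rep_def
proof (intro conjI ballI)
  fix z :: "'k mvps" assume z: "z \<in> EE"
  have eq: "act (u + v) (fr (pw e) z) = act u (fr (pw e) z) + act v (fr (pw e) z)"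
    by (rule act_add_left[OF fr_fsupp[OF pw_pos EE_fsupp[OF z]]])
  show "act (u + v) (fr (pw e) z) \<in> EE"
    unfolding eq by (intro EE_add rep_EE[OF assms(1) z] rep_EE[OF assms(2) z])
  show "(\<lambda>z\<in>carrier E. \<phi> z \<oplus>\<^bsub>E\<^esub> \<phi>' z) (GG z) = GG (act (u + v) (fr (pw e) z))"
    unfolding eq GG_add[OF rep_EE[OF assms(1) z] rep_EE[OF assms(2) z]] restrict_apply'[OF GG_closed[OF z]]
      rep_GG[OF assms(1) z] rep_GG[OF assms(2) z] ..
qed simp

text \<open>\<open>u F^i v F^j = u v^(p^i) F^(i+j)\<close>, with \<open>F\<close> the natural
  Frobenius action.\<close>

lemma comp_rep:
  assumes "rep i u \<phi>" "rep j v \<phi>'"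
  shows "rep (i + j) (pmul u (pfrob (pw i) v)) (\<lambda>z\<in>carrier E. \<phi> (\<phi>' z))"
  unfolding rep_def
proof (intro conjI ballI)
  fix z :: "'k mvps" assume z: "z \<in> EE"
  note fj = fr_fsupp[OF pw_pos EE_fsupp[OF z]]
  have eq: "act (pmul u (pfrob (pw i) v)) (fr (pw (i + j)) z) = act u (fr (pw i) (act v (fr (pw j) z)))"
  proof -
    have "act (pmul u (pfrob (pw i) v)) (fr (pw (i + j)) z) = act u (act (pfrob (pw i) v) (fr (pw (i + j)) z))"
      by (rule act_pmul[OF fr_fsupp[OF pw_pos EE_fsupp[OF z]]])
    moreover have "fr (pw (i + j)) z = fr (pw i) (fr (pw j) z)"
      unfolding power_add by (rule fr_fr[OF pw_pos pw_pos EE_fsupp[OF z], symmetric])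
    ultimately show ?thesis by (simp only: fr_act[OF pw_char prime_char fj])
  qed
  note E1 = rep_EE[OF assms(2) z]
  show "act (pmul u (pfrob (pw i) v)) (fr (pw (i + j)) z) \<in> EE"
    unfolding eq by (rule rep_EE[OF assms(1) E1])
  show "(\<lambda>z\<in>carrier E. \<phi> (\<phi>' z)) (GG z) = GG (act (pmul u (pfrob (pw i) v)) (fr (pw (i + j)) z))"
    unfolding eq restrict_apply'[OF GG_closed[OF z]] rep_GG[OF assms(2) z] rep_GG[OF assms(1) E1] ..
qed simp

lemma id_rep: "rep 0 (pterm 0 1) (\<lambda>z\<in>carrier E. z)"
  unfolding rep_def
proof (intro conjI ballI)
  fix z :: "'k mvps" assume z: "z \<in> EE"
  have "fr (pw 0) z = z"
  proof
    fix c
    show "fr (pw 0) z c = z c"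
    proof (cases "c \<in> exps n")
      case True
      then have "tw (pw 0) (\<lambda>i. c i div pw 0) = c" by (auto simp: tw_def exps_def fun_eq_iff)
      then show ?thesis by (simp add: fr_def)
    next
      case False
      then have "z c = 0" "fr (pw 0) z c = 0"
        using fsuppD(2)[OF EE_fsupp[OF z], of c] fsuppD(2)[OF fr_fsupp[OF pw_pos EE_fsupp[OF z]], of 0 c] by auto
      then show ?thesis by simp
    qed
  qed
  then have eq: "act (pterm 0 1) (fr (pw 0) z) = z" by (simp only: act_one[OF z])
  show "act (pterm 0 1) (fr (pw 0) z) \<in> EE" unfolding eq by (rule z)
  show "(\<lambda>z\<in>carrier E. z) (GG z) = GG (act (pterm 0 1) (fr (pw 0) z))"
    unfolding eq restrict_apply'[OF GG_closed[OF z]] ..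
qed simp

lemma finsum_rep:
  assumes "finite A" "\<And>i. i \<in> A \<Longrightarrow> rep e (w i) (h i)"
  shows "rep e (\<Sum>i\<in>A. w i) (\<lambda>z\<in>carrier E. \<Oplus>\<^bsub>E\<^esub>i\<in>A. h i z)"
  using assms
proof (induction A rule: finite_induct)
  case empty
  show ?case unfolding sum.empty E.M.finsum_empty by (rule zero_rep)
next
  case (insert i A)
  have ri: "rep e (w i) (h i)" by (rule insert.prems) simp
  have rA: "rep e (\<Sum>i\<in>A. w i) (\<lambda>z\<in>carrier E. \<Oplus>\<^bsub>E\<^esub>i\<in>A. h i z)"
    by (rule insert.IH) (rule insert.prems, simp)
  have cl: "h j z \<in> carrier E" if "j \<in> insert i A" "z \<in> carrier E" for j z
    by (rule FM_closed[OF rep_FM[OF insert.prems[OF that(1)]] that(2)])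
  have eq: "(\<lambda>z\<in>carrier E. \<Oplus>\<^bsub>E\<^esub>j\<in>insert i A. h j z) =
      (\<lambda>z\<in>carrier E. h i z \<oplus>\<^bsub>E\<^esub> (\<lambda>z\<in>carrier E. \<Oplus>\<^bsub>E\<^esub>j\<in>A. h j z) z)"
    by (rule restrict_ext) (use cl insert.hyps in \<open>simp add: E.M.finsum_insert Pi_def\<close>)
  show ?case unfolding eq sum.insert[OF insert.hyps] by (rule add_rep[OF ri rA])
qed

section \<open>The Frobenius algebra in terms of multipliers\<close>

abbreviation "FA \<equiv> frobenius_algebra p RR E"
abbreviation "DG \<equiv> frobenius_degree p RR E"

text \<open>An element of the algebra is determined by these multipliers, on which addition is
  addition and multiplication is a twisted convolution.\<close>

definition kap :: "nat \<Rightarrow> (nat \<Rightarrow> 'e \<Rightarrow> 'e) \<Rightarrow> 'k mvps" where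
  "kap d \<Phi> = cf d (\<Phi> d)"

lemma FA_carrier: "\<Phi> \<in> carrier FA \<longleftrightarrow> (\<forall>e. \<Phi> e \<in> FM e) \<and> finite {e. \<Phi> e \<noteq> Zr}"
  by (simp add: frobenius_algebra_def)

lemma FA_rep: "\<Phi> \<in> carrier FA \<Longrightarrow> rep d (kap d \<Phi>) (\<Phi> d)"
  unfolding kap_def FA_carrier by (intro FM_rep) simp

lemma FA_eqI:
  assumes "\<Phi> \<in> carrier FA" "\<Psi> \<in> carrier FA" "\<And>d. kap d \<Phi> = kap d \<Psi>"
  shows "\<Phi> = \<Psi>"
proof
  fix d
  show "\<Phi> d = \<Psi> d"
    using assms(1,2) assms(3)[of d] unfolding FA_carrier kap_def by (intro cf_inj) auto
qed

lemma kap_useries: "kap d \<Phi> \<in> useries (pw d)"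
  unfolding kap_def by (rule cf_useries)

lemma useries_add:
  assumes "u \<in> useries q" "v \<in> useries q"
  shows "u + v \<in> useries q"
  unfolding useries_def
proof (intro CollectI allI impI)
  fix c assume c: "(u + v) c \<noteq> 0"
  then have "u c \<noteq> 0 \<or> v c \<noteq> 0" by auto
  with assms show "c \<in> TT q" by (auto simp: useries_def)
qed

lemma FA_add:
  assumes "\<Phi> \<in> carrier FA" "\<Psi> \<in> carrier FA"
  shows "\<Phi> \<oplus>\<^bsub>FA\<^esub> \<Psi> \<in> carrier FA" "kap d (\<Phi> \<oplus>\<^bsub>FA\<^esub> \<Psi>) = kap d \<Phi> + kap d \<Psi>"
proof -
  have A: "(\<Phi> \<oplus>\<^bsub>FA\<^esub> \<Psi>) e = (\<lambda>z\<in>carrier E. \<Phi> e z \<oplus>\<^bsub>E\<^esub> \<Psi> e z)" for e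
    by (simp add: frobenius_algebra_def)
  have rp: "rep e (kap e \<Phi> + kap e \<Psi>) ((\<Phi> \<oplus>\<^bsub>FA\<^esub> \<Psi>) e)" for e
    unfolding A by (rule add_rep[OF FA_rep[OF assms(1)] FA_rep[OF assms(2)]])
  show "kap d (\<Phi> \<oplus>\<^bsub>FA\<^esub> \<Psi>) = kap d \<Phi> + kap d \<Psi>"
    unfolding kap_def[of d "\<Phi> \<oplus>\<^bsub>FA\<^esub> \<Psi>"] by (rule cf_eqI[OF rp useries_add[OF kap_useries kap_useries]])
  have "(\<Phi> \<oplus>\<^bsub>FA\<^esub> \<Psi>) e = Zr" if "\<Phi> e = Zr" "\<Psi> e = Zr" for e
    unfolding A that by (rule restrict_ext) simp
  then have "{e. (\<Phi> \<oplus>\<^bsub>FA\<^esub> \<Psi>) e \<noteq> Zr} \<subseteq> {e. \<Phi> e \<noteq> Zr} \<union> {e. \<Psi> e \<noteq> Zr}" by auto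
  moreover have "finite ({e. \<Phi> e \<noteq> Zr} \<union> {e. \<Psi> e \<noteq> Zr})" using assms by (simp add: FA_carrier)
  ultimately have "finite {e. (\<Phi> \<oplus>\<^bsub>FA\<^esub> \<Psi>) e \<noteq> Zr}" by (rule finite_subset)
  then show "\<Phi> \<oplus>\<^bsub>FA\<^esub> \<Psi> \<in> carrier FA"
    unfolding FA_carrier using rep_FM[OF rp] by blast
qed

lemma FM_zero: "\<phi> \<in> FM e \<Longrightarrow> \<phi> \<zero>\<^bsub>E\<^esub> = \<zero>\<^bsub>E\<^esub>"
proof -
  assume "\<phi> \<in> FM e"
  from rep_GG[OF FM_rep[OF this] EE_zero] show ?thesis
    using semi_zero[OF FM_semi[OF \<open>\<phi> \<in> FM e\<close>]] semi_eq_act[OF pw_pos FM_semi[OF \<open>\<phi> \<in> FM e\<close>] EE_zero]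
    unfolding cf_def by (simp only: GG_zero)
qed

text \<open>The convolution is compared only at exponents in \<open>TT (pw d)\<close>: a product of
  normal forms can have terms elsewhere, which \<open>kap\<close> does not record.\<close>

lemma FA_mult:
  assumes "\<Phi> \<in> carrier FA" "\<Psi> \<in> carrier FA"
  shows "\<Phi> \<otimes>\<^bsub>FA\<^esub> \<Psi> \<in> carrier FA"
    and "c \<in> TT (pw d) \<Longrightarrow> kap d (\<Phi> \<otimes>\<^bsub>FA\<^esub> \<Psi>) c = (\<Sum>i\<in>{..d}. pmul (kap i \<Phi>) (pfrob (pw i) (kap (d - i) \<Psi>)) c)"
proof -
  have A: "(\<Phi> \<otimes>\<^bsub>FA\<^esub> \<Psi>) e = (\<lambda>z\<in>carrier E. \<Oplus>\<^bsub>E\<^esub>i\<in>{..e}. \<Phi> i (\<Psi> (e - i) z))" for e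
    by (simp add: frobenius_algebra_def)
  have rp: "rep e (\<Sum>i\<in>{..e}. pmul (kap i \<Phi>) (pfrob (pw i) (kap (e - i) \<Psi>))) ((\<Phi> \<otimes>\<^bsub>FA\<^esub> \<Psi>) e)" for e
  proof -
    have "rep e (\<Sum>i\<in>{..e}. pmul (kap i \<Phi>) (pfrob (pw i) (kap (e - i) \<Psi>)))
       (\<lambda>z\<in>carrier E. \<Oplus>\<^bsub>E\<^esub>i\<in>{..e}. (\<lambda>z\<in>carrier E. \<Phi> i (\<Psi> (e - i) z)) z)"
    proof (rule finsum_rep)
      fix i assume "i \<in> {..e}"
      then have e: "i + (e - i) = e" by simp
      show "rep e (pmul (kap i \<Phi>) (pfrob (pw i) (kap (e - i) \<Psi>))) (\<lambda>z\<in>carrier E. \<Phi> i (\<Psi> (e - i) z))"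
        using comp_rep[OF FA_rep[OF assms(1), of i] FA_rep[OF assms(2), of "e - i"]] unfolding e .
    qed simp
    also have "(\<lambda>z\<in>carrier E. \<Oplus>\<^bsub>E\<^esub>i\<in>{..e}. (\<lambda>z\<in>carrier E. \<Phi> i (\<Psi> (e - i) z)) z) = (\<Phi> \<otimes>\<^bsub>FA\<^esub> \<Psi>) e"
      unfolding A by (rule restrict_ext) simp
    finally show ?thesis .
  qed
  show "kap d (\<Phi> \<otimes>\<^bsub>FA\<^esub> \<Psi>) c = (\<Sum>i\<in>{..d}. pmul (kap i \<Phi>) (pfrob (pw i) (kap (d - i) \<Psi>)) c)"
    if "c \<in> TT (pw d)"
    unfolding kap_def[of d "\<Phi> \<otimes>\<^bsub>FA\<^esub> \<Psi>"] rep_cf[OF rp that] sum_fun_apply ..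
  have FMs: "\<Phi> i \<in> FM i" "\<Psi> i \<in> FM i" for i using assms by (simp_all add: FA_carrier)
  let ?S = "{e. \<Phi> e \<noteq> Zr}" and ?T = "{e. \<Psi> e \<noteq> Zr}"
  have "{e. (\<Phi> \<otimes>\<^bsub>FA\<^esub> \<Psi>) e \<noteq> Zr} \<subseteq> (\<lambda>(i, j). i + j) ` (?S \<times> ?T)"
  proof (rule subsetI, rule ccontr)
    fix e assume e: "e \<in> {e. (\<Phi> \<otimes>\<^bsub>FA\<^esub> \<Psi>) e \<noteq> Zr}" "e \<notin> (\<lambda>(i, j). i + j) ` (?S \<times> ?T)"
    have z: "\<Phi> i (\<Psi> (e - i) z) = \<zero>\<^bsub>E\<^esub>" if i: "i \<in> {..e}" and z: "z \<in> carrier E" for i z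
    proof (cases "\<Phi> i = Zr")
      case True
      then show ?thesis using FM_closed[OF FMs(2) z] by simp
    next
      case False
      have "\<Psi> (e - i) = Zr"
      proof (rule ccontr)
        assume "\<Psi> (e - i) \<noteq> Zr"
        with False have "(i, e - i) \<in> ?S \<times> ?T" by simp
        from imageI[OF this, of "\<lambda>(i, j). i + j"] i e(2) show False by simp
      qed
      then show ?thesis using z FM_zero[OF FMs(1)] by simp
    qed
    have "(\<Phi> \<otimes>\<^bsub>FA\<^esub> \<Psi>) e = Zr"
      unfolding A
    proof (rule restrict_ext)
      fix z assume zc: "z \<in> carrier E"
      have "(\<Oplus>\<^bsub>E\<^esub>i\<in>{..e}. \<Phi> i (\<Psi> (e - i) z)) = (\<Oplus>\<^bsub>E\<^esub>i\<in>{..e}. \<zero>\<^bsub>E\<^esub>)"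
        by (rule E.M.finsum_cong') (use z zc in auto)
      then show "(\<Oplus>\<^bsub>E\<^esub>i\<in>{..e}. \<Phi> i (\<Psi> (e - i) z)) = \<zero>\<^bsub>E\<^esub>" by simp
    qed
    with e(1) show False by simp
  qed
  moreover have "finite ((\<lambda>(i, j). i + j) ` (?S \<times> ?T))" using assms by (simp add: FA_carrier)
  ultimately have "finite {e. (\<Phi> \<otimes>\<^bsub>FA\<^esub> \<Psi>) e \<noteq> Zr}" by (rule finite_subset)
  then show "\<Phi> \<otimes>\<^bsub>FA\<^esub> \<Psi> \<in> carrier FA"
    unfolding FA_carrier using rep_FM[OF rp] by blast
qed

lemma mk_zero: "mk e 0 = Zr"
  unfolding mk_def act_zero_left by (rule restrict_ext) (simp add: GG_zero)

lemma FA_zero: "\<zero>\<^bsub>FA\<^esub> \<in> carrier FA" "kap d \<zero>\<^bsub>FA\<^esub> = 0"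
proof -
  have z: "\<zero>\<^bsub>FA\<^esub> = (\<lambda>e. Zr)" by (simp add: frobenius_algebra_def)
  show "\<zero>\<^bsub>FA\<^esub> \<in> carrier FA" unfolding z FA_carrier using rep_FM[OF zero_rep] by simp
  show "kap d \<zero>\<^bsub>FA\<^esub> = 0" unfolding z kap_def by (rule cf_zero)
qed

text \<open>The additive inverse is a definite description; negated multipliers give a candidate and
  \<open>FA_eqI\<close> its uniqueness.\<close>

lemma FA_minus:
  assumes F: "\<Phi> \<in> carrier FA"
  shows "\<ominus>\<^bsub>FA\<^esub> \<Phi> \<in> carrier FA" "kap d (\<ominus>\<^bsub>FA\<^esub> \<Phi>) = - kap d \<Phi>"
proof -
  define \<Psi> where "\<Psi> = (\<lambda>e. mk e (- kap e \<Phi>))"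
  have neg: "- kap e \<Phi> \<in> useries (pw e)" for e
    using kap_useries[of e \<Phi>] by (simp add: useries_def)
  have "\<Psi> e = Zr" if "\<Phi> e = Zr" for e
    unfolding \<Psi>_def kap_def that cf_zero minus_zero by (rule mk_zero)
  then have "{e. \<Psi> e \<noteq> Zr} \<subseteq> {e. \<Phi> e \<noteq> Zr}" by auto
  then have "finite {e. \<Psi> e \<noteq> Zr}" by (rule finite_subset) (use F in \<open>simp add: FA_carrier\<close>)
  then have P: "\<Psi> \<in> carrier FA"
    unfolding FA_carrier using rep_FM[OF mk_rep[OF neg]] by (simp add: \<Psi>_def)
  have kP: "kap e \<Psi> = - kap e \<Phi>" for e
  proof -
    have "\<Psi> e = mk e (- kap e \<Phi>)" by (simp only: \<Psi>_def)
    then show ?thesis unfolding kap_def[of e \<Psi>] by (simp only: cf_mk[OF neg])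
  qed
  have "\<ominus>\<^bsub>FA\<^esub> \<Phi> = \<Psi>"
    unfolding a_inv_def m_inv_def
  proof (rule the_equality)
    have "\<Phi> \<oplus>\<^bsub>FA\<^esub> \<Psi> = \<zero>\<^bsub>FA\<^esub>" "\<Psi> \<oplus>\<^bsub>FA\<^esub> \<Phi> = \<zero>\<^bsub>FA\<^esub>"
      by (rule FA_eqI; simp only: FA_add[OF F P] FA_add[OF P F] FA_zero kP add.right_inverse add.left_inverse)+
    then show "\<Psi> \<in> carrier (add_monoid FA) \<and> \<Phi> \<otimes>\<^bsub>add_monoid FA\<^esub> \<Psi> = \<one>\<^bsub>add_monoid FA\<^esub> \<and>
        \<Psi> \<otimes>\<^bsub>add_monoid FA\<^esub> \<Phi> = \<one>\<^bsub>add_monoid FA\<^esub>"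
      using P by simp
    fix y assume "y \<in> carrier (add_monoid FA) \<and> \<Phi> \<otimes>\<^bsub>add_monoid FA\<^esub> y = \<one>\<^bsub>add_monoid FA\<^esub> \<and>
        y \<otimes>\<^bsub>add_monoid FA\<^esub> \<Phi> = \<one>\<^bsub>add_monoid FA\<^esub>"
    then have y: "y \<in> carrier FA" "y \<oplus>\<^bsub>FA\<^esub> \<Phi> = \<zero>\<^bsub>FA\<^esub>" by simp_all
    show "y = \<Psi>"
    proof (rule FA_eqI[OF y(1) P])
      fix e
      have "kap e y + kap e \<Phi> = 0"
        using FA_add(2)[OF y(1) F, of e] unfolding y(2) FA_zero(2) by (rule sym)
      then show "kap e y = kap e \<Psi>" unfolding kP by (simp only: add_eq_0_iff2)
    qed
  qed
  then show "\<ominus>\<^bsub>FA\<^esub> \<Phi> \<in> carrier FA" "kap d (\<ominus>\<^bsub>FA\<^esub> \<Phi>) = - kap d \<Phi>"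
    using P kP by simp_all
qed

definition hmg :: "nat \<Rightarrow> 'k mvps \<Rightarrow> nat \<Rightarrow> 'e \<Rightarrow> 'e" where
  "hmg d u e = (if e = d then mk d u else Zr)"

lemma hmg_carrier: "u \<in> useries (pw d) \<Longrightarrow> hmg d u \<in> carrier FA"
proof -
  assume u: "u \<in> useries (pw d)"
  have "{e. hmg d u e \<noteq> Zr} \<subseteq> {d}" by (auto simp: hmg_def)
  then have "finite {e. hmg d u e \<noteq> Zr}" by (rule finite_subset) simp
  moreover have "hmg d u e \<in> FM e" for e
    using rep_FM[OF mk_rep[OF u]] rep_FM[OF zero_rep] by (simp add: hmg_def)
  ultimately show ?thesis unfolding FA_carrier by blast
qed

lemma hmg_degree: "u \<in> useries (pw d) \<Longrightarrow> hmg d u \<in> DG d"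
  unfolding frobenius_degree_def using hmg_carrier by (simp add: hmg_def)

lemma kap_hmg: "u \<in> useries (pw d) \<Longrightarrow> kap e (hmg d u) = (if e = d then u else 0)"
  by (simp add: kap_def hmg_def cf_mk cf_zero)

lemma degree_carrier: "\<Phi> \<in> DG d \<Longrightarrow> \<Phi> \<in> carrier FA"
  and degree_zero: "\<Phi> \<in> DG d \<Longrightarrow> e \<noteq> d \<Longrightarrow> \<Phi> e = Zr"
  by (simp_all add: frobenius_degree_def)

lemma degree_hmg:
  assumes F: "\<Phi> \<in> DG d"
  shows "\<Phi> = hmg d (kap d \<Phi>)"
proof (rule FA_eqI[OF degree_carrier[OF F] hmg_carrier[OF kap_useries]])
  fix e show "kap e \<Phi> = kap e (hmg d (kap d \<Phi>))"
    using degree_zero[OF F, of e] by (simp add: kap_hmg[OF kap_useries]) (simp add: kap_def cf_zero)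
qed

text \<open>Returns a product of multipliers to normal form.\<close>

definition trunc :: "nat \<Rightarrow> 'k mvps \<Rightarrow> 'k mvps" where
  "trunc q w c = (if c \<in> TT q then w c else 0)"

lemma trunc_useries: "trunc q w \<in> useries q"
  by (simp add: useries_def trunc_def)

lemma pfrob_zero: "q > 0 \<Longrightarrow> pfrob q 0 = (0 :: 'k mvps)"
  by (rule ext) (simp add: pfrob_def)

lemma hmg_mult:
  assumes u: "u \<in> useries (pw i)" and v: "v \<in> useries (pw j)"
  shows "hmg i u \<otimes>\<^bsub>FA\<^esub> hmg j v = hmg (i + j) (trunc (pw (i + j)) (pmul u (pfrob (pw i) v)))"
proof (rule FA_eqI)
  note U = hmg_carrier[OF u] and V = hmg_carrier[OF v]
  let ?w = "pmul u (pfrob (pw i) v)"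
  show "hmg i u \<otimes>\<^bsub>FA\<^esub> hmg j v \<in> carrier FA" by (rule FA_mult(1)[OF U V])
  show "hmg (i + j) (trunc (pw (i + j)) ?w) \<in> carrier FA" by (rule hmg_carrier[OF trunc_useries])
  fix d
  show "kap d (hmg i u \<otimes>\<^bsub>FA\<^esub> hmg j v) = kap d (hmg (i + j) (trunc (pw (i + j)) ?w))"
  proof
    fix c
    show "kap d (hmg i u \<otimes>\<^bsub>FA\<^esub> hmg j v) c = kap d (hmg (i + j) (trunc (pw (i + j)) ?w)) c"
    proof (cases "c \<in> TT (pw d)")
      case False
      then have "kap d x c = 0" for x using kap_useries[of d x] by (auto simp: useries_def)
      then show ?thesis by simp
    next
      case True
      have t: "pmul (kap l (hmg i u)) (pfrob (pw l) (kap (d - l) (hmg j v))) c =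
          (if l = i then (if d = i + j then ?w c else 0) else 0)" if "l \<in> {..d}" for l
      proof (cases "l = i")
        case li: True
        show ?thesis
        proof (cases "d = i + j")
          case True
          with li show ?thesis by (simp add: kap_hmg[OF u] kap_hmg[OF v])
        next
          case False
          with li that have "d - l \<noteq> j" by auto
          then have "kap (d - l) (hmg j v) = 0" by (simp only: kap_hmg[OF v] if_False)
          then have "pmul (kap l (hmg i u)) (pfrob (pw l) (kap (d - l) (hmg j v))) = 0"
            by (simp only: pfrob_zero[OF pw_pos] pmul_zero_right)
          with False show ?thesis by simp
        qed
      next
        case False
        then have "kap l (hmg i u) = 0" by (simp only: kap_hmg[OF u] if_False)
        then have "pmul (kap l (hmg i u)) (pfrob (pw l) (kap (d - l) (hmg j v))) = 0"
          by (simp only: pmul_zero_left)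
        with False show ?thesis by simp
      qed
      have "kap d (hmg i u \<otimes>\<^bsub>FA\<^esub> hmg j v) c =
          (\<Sum>l\<in>{..d}. if l = i then (if d = i + j then ?w c else 0) else 0)"
        unfolding FA_mult(2)[OF U V True] by (rule sum.cong[OF refl t])
      also have "\<dots> = (if d = i + j then ?w c else 0)" by simp
      also have "\<dots> = kap d (hmg (i + j) (trunc (pw (i + j)) ?w)) c"
        using True by (cases "d = i + j") (simp_all add: kap_hmg[OF trunc_useries] trunc_def)
      finally show ?thesis .
    qed
  qed
qed

text \<open>\<open>SH d\<close> encodes the exponents of a minimal set of new generators in degree \<open>d\<close>.\<close>

definition SH :: "nat \<Rightarrow> (nat \<Rightarrow> nat) set" where
  "SH d = (if d = 1 then MS else QQ)"

lemma SH_MS: "SH d \<subseteq> MS"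
  by (auto simp: SH_def QQ_def)

lemma SH_finite: "finite (SH d)"
  using SH_MS finite_MS by (rule finite_subset)

lemma card_MS: "card MS = card QQ + 1"
  using card.remove[OF finite_MS mm_MS] by (simp only: QQ_def Suc_eq_plus1)

lemma pw_ge_2: "d \<ge> 1 \<Longrightarrow> pw d \<ge> 2"
proof -
  assume "d \<ge> 1"
  have p2: "p \<ge> 2" using prime_char unfolding p_char by (rule prime_ge_2_nat)
  then have "p ^ 1 \<le> p ^ d" using \<open>d \<ge> 1\<close> by (intro power_increasing) auto
  with p2 show ?thesis by simp
qed

lemma scl_SH:
  assumes "d \<ge> 1" "s \<in> SH d"
  shows "scl (pw d) s \<in> TT (pw d)" "scl (pw d) s \<in> exps n"
proof -
  have "s \<in> MS" using assms(2) SH_MS by auto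
  from scl_MS_TT[OF pw_ge_2[OF assms(1)] this] show "scl (pw d) s \<in> TT (pw d)" .
  then show "scl (pw d) s \<in> exps n" by (intro subsetD[OF CC_exps] subsetD[OF TT_CC])
qed

lemma useries_MI:
  assumes "u \<in> useries q"
  shows "u \<in> MI n (CC q)"
  unfolding MI_def
proof (intro CollectI conjI allI impI)
  show "u \<in> pser n" by (rule useries_pser[OF assms])
  fix c assume "u c \<noteq> 0"
  with assms have "c \<in> TT q" by (simp add: useries_def)
  then show "c \<in> CC q" by (rule subsetD[OF TT_CC])
qed

lemma pfrob_one: "pfrob 1 f = f"
  by (rule ext) (simp add: pfrob_def)

section \<open>Coefficients at minimal exponents and the lower bound\<close>

lemma pmul_at_scl:
  assumes d: "d \<ge> 1" and s: "s \<in> SH d" and u: "u \<in> useries (pw d)"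
  shows "pmul g u (scl (pw d) s) = g 0 * u (scl (pw d) s)"
proof (rule pmul_at_minimal[OF useries_MI[OF u] scl_SH(2)[OF d s]])
  fix b assume "b \<in> CC (pw d)" "b \<le> scl (pw d) s"
  moreover have "s \<in> MS" using s SH_MS by auto
  ultimately show "b = scl (pw d) s" by (intro scl_MS_minimal[OF pw_ge_2[OF d]])
qed

text \<open>In total degree at least \<open>2\<close> the patterns of \<open>SH\<close> exclude
  \<open>mm\<close>, so \<open>scl_not_product\<close> applies: no product of elements of positive
  degree reaches their exponents.\<close>

lemma pmul_frob_at_scl:
  assumes i: "i \<ge> 1" "j \<ge> 1" and s: "s \<in> SH (i + j)" and u: "u \<in> useries (pw i)" and v: "v \<in> useries (pw j)"
  shows "pmul u (pfrob (pw i) v) (scl (pw (i + j)) s) = 0"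
proof (rule ccontr)
  assume "pmul u (pfrob (pw i) v) (scl (pw (i + j)) s) \<noteq> 0"
  from pmul_nonzeroD[OF this] obtain b c where bc: "b + c = scl (pw (i + j)) s" "u b \<noteq> 0" "pfrob (pw i) v c \<noteq> 0"
    by auto
  have dv: "\<forall>l. pw i dvd c l"
    by (rule ccontr) (use bc(3) in \<open>simp only: pfrob_def if_False simp_thms\<close>)
  have vq: "v (\<lambda>l. c l div pw i) ^ pw i \<noteq> 0" using bc(3) dv by (simp only: pfrob_def if_True simp_thms)
  have vc: "v (\<lambda>l. c l div pw i) \<noteq> 0"
  proof
    assume "v (\<lambda>l. c l div pw i) = 0"
    with vq show False by (simp only: zero_power[OF pw_pos] simp_thms)
  qed
  let ?v = "\<lambda>l. c l div pw i"
  have c: "(\<lambda>l. pw i * ?v l) = c" by (rule ext) (simp only: dvd_mult_div_cancel[OF dv[rule_format]])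
  have "b \<in> CC (pw i)" using u bc(2) by (intro subsetD[OF TT_CC]) (simp add: useries_def)
  moreover have "?v \<in> CC (pw j)" using v vc by (intro subsetD[OF TT_CC]) (simp add: useries_def)
  moreover have "s \<in> MS" "s \<noteq> mm" using s i by (auto simp: SH_def QQ_def)
  ultimately have "b + (\<lambda>l. pw i * ?v l) \<noteq> scl (pw i * pw j) s"
    by (rule scl_not_product[OF pw_ge_2[OF i(1)] pw_ge_2[OF i(2)]])
  then have "b + c \<noteq> scl (pw (i + j)) s" by (simp only: c power_add simp_thms)
  with bc(1) show False by (rule notE[rotated])
qed

text \<open>Only the two ends of the convolution survive. A factor of degree zero acts through its
  constant term, from the right through the \<open>p^d\<close>-th power of it.\<close>

lemma kap_mult_at_scl:
  assumes d: "d \<ge> 1" and s: "s \<in> SH d" and F: "\<Phi> \<in> carrier FA" and G: "\<Psi> \<in> carrier FA"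
  shows "kap d (\<Phi> \<otimes>\<^bsub>FA\<^esub> \<Psi>) (scl (pw d) s) =
    kap 0 \<Phi> 0 * kap d \<Psi> (scl (pw d) s) + kap 0 \<Psi> 0 ^ pw d * kap d \<Phi> (scl (pw d) s)"
proof -
  let ?c = "scl (pw d) s"
  let ?t = "\<lambda>i. pmul (kap i \<Phi>) (pfrob (pw i) (kap (d - i) \<Psi>)) ?c"
  have "kap d (\<Phi> \<otimes>\<^bsub>FA\<^esub> \<Psi>) ?c = (\<Sum>i\<in>{..d}. ?t i)"
    by (rule FA_mult(2)[OF F G scl_SH(1)[OF d s]])
  also have "\<dots> = (\<Sum>i\<in>{0, d}. ?t i)"
  proof (rule sum.mono_neutral_right)
    show "\<forall>i\<in>{..d} - {0, d}. ?t i = 0"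
    proof
      fix i assume "i \<in> {..d} - {0, d}"
      then have i: "i \<ge> 1" "d - i \<ge> 1" "i + (d - i) = d" by auto
      show "?t i = 0"
      proof -
        have "s \<in> SH (i + (d - i))" using s by (simp only: i(3))
        from pmul_frob_at_scl[OF i(1,2) this kap_useries kap_useries] show ?thesis unfolding i(3) .
      qed
    qed
  qed auto
  also have "\<dots> = ?t 0 + ?t d" using d by simp
  also have "?t 0 = kap 0 \<Phi> 0 * kap d \<Psi> ?c"
    unfolding power_0 pfrob_one diff_zero by (rule pmul_at_scl[OF d s kap_useries])
  also have "?t d = kap 0 \<Psi> 0 ^ pw d * kap d \<Phi> ?c"
  proof -
    have "?t d = pmul (pfrob (pw d) (kap 0 \<Psi>)) (kap d \<Phi>) ?c"
      unfolding diff_self_eq_0 by (rule fun_cong[OF pmul_commute])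
    also have "\<dots> = pfrob (pw d) (kap 0 \<Psi>) 0 * kap d \<Phi> ?c" by (rule pmul_at_scl[OF d s kap_useries])
    also have "pfrob (pw d) (kap 0 \<Psi>) 0 = kap 0 \<Psi> 0 ^ pw d" by (simp add: pfrob_def zero_fun_def)
    finally show ?thesis .
  qed
  finally show ?thesis .
qed

abbreviation "GR e \<equiv> frobenius_G p RR E e"

lemma FA_one: "\<one>\<^bsub>FA\<^esub> \<in> carrier FA" "\<one>\<^bsub>FA\<^esub> \<in> DG 0"
proof -
  have o: "\<one>\<^bsub>FA\<^esub> e = (if e = 0 then (\<lambda>z\<in>carrier E. z) else Zr)" for e
    by (simp add: frobenius_algebra_def)
  have "{e. \<one>\<^bsub>FA\<^esub> e \<noteq> Zr} \<subseteq> {0}" by (auto simp: o)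
  then have "finite {e. \<one>\<^bsub>FA\<^esub> e \<noteq> Zr}" by (rule finite_subset) simp
  moreover have "\<one>\<^bsub>FA\<^esub> e \<in> FM e" for e
    unfolding o using rep_FM[OF id_rep] rep_FM[OF zero_rep] by simp
  ultimately show "\<one>\<^bsub>FA\<^esub> \<in> carrier FA" unfolding FA_carrier by blast
  then show "\<one>\<^bsub>FA\<^esub> \<in> DG 0" by (simp add: frobenius_degree_def o)
qed

lemma scl_series: "d \<ge> 1 \<Longrightarrow> s \<in> MS \<Longrightarrow> (mvps_monom (scl (pw d) s) :: 'k mvps) \<in> useries (pw d)"
  using scl_MS_TT[OF pw_ge_2, of d s] by (simp add: useries_def mvps_monom_def)

text \<open>Modulo decomposable elements the coefficients at the exponents encoded by \<open>SH d\<close> depend linearly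
  on the generators of degree \<open>d\<close>.\<close>

lemma card_SH_le:
  assumes A: "finite A" "A \<subseteq> (\<Union>d. DG d)" "generate_ring FA (DG 0 \<union> A) = GR e" and d: "1 \<le> d" "d \<le> e"
  shows "card (SH d) \<le> card {\<Phi> \<in> A. \<Phi> d \<noteq> Zr}"
proof (rule card_le_of_spanning[where v = "\<lambda>\<Phi> s. kap d \<Phi> (scl (pw d) s)"])
  let ?A = "{\<Phi> \<in> A. \<Phi> d \<noteq> Zr}"
  show finA: "finite ?A" using A(1) by simp
  show "finite (SH d)" by (rule SH_finite)
  have zero: "\<exists>c. \<forall>s\<in>SH d. kap d \<Phi> (scl (pw d) s) = (\<Sum>x\<in>?A. c x * kap d x (scl (pw d) s))"
    if "\<Phi> d = Zr" for \<Phi>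
    by (rule exI[of _ "\<lambda>_. 0"]) (simp add: kap_def that cf_zero)
  \<comment> \<open>The carrier is part of the induction because the coefficient formulas for
    \<open>kap\<close> assume it.\<close>
  have main: "\<Phi> \<in> carrier FA \<and> (\<exists>c. \<forall>s\<in>SH d. kap d \<Phi> (scl (pw d) s) = (\<Sum>x\<in>?A. c x * kap d x (scl (pw d) s)))"
    if "\<Phi> \<in> generate_ring FA (DG 0 \<union> A)" for \<Phi>
    using that
  proof (induction rule: generate_ring.induct)
    case one
    have "\<one>\<^bsub>FA\<^esub> d = Zr" using degree_zero[OF FA_one(2), of d] d by simp
    from zero[of "\<one>\<^bsub>FA\<^esub>", OF this] FA_one(1) show ?case by (rule conjI[rotated])
  next
    case (incl h)
    then have "h \<in> (\<Union>d. DG d)" using A(2) by auto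
    then have hc: "h \<in> carrier FA" using degree_carrier by auto
    show ?case
    proof (cases "h d = Zr")
      case True
      from hc zero[of h, OF this] show ?thesis by (rule conjI)
    next
      case False
      \<comment> \<open>Elements of degree zero have no component of degree
        \<open>d \<ge> 1\<close>, so \<open>h\<close> comes from \<open>A\<close>.\<close>
      have "h \<notin> DG 0" using degree_zero[of h 0 d] d(1) False by auto
      with incl False have hA: "h \<in> ?A" by auto
      have "kap d h (scl (pw d) s) = (\<Sum>x\<in>?A. (if x = h then 1 else 0) * kap d x (scl (pw d) s))" for s
      proof -
        have "(\<Sum>x\<in>?A. (if x = h then 1 else 0) * kap d x (scl (pw d) s)) =
           (\<Sum>x\<in>?A. if x = h then kap d h (scl (pw d) s) else 0)"
          by (intro sum.cong) auto
        also have "\<dots> = kap d h (scl (pw d) s)" using hA finA by (simp only: sum.delta if_True)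
        finally show ?thesis by simp
      qed
      then show ?thesis using hc by (intro conjI exI[of _ "\<lambda>x. if x = h then 1 else 0"] ballI)
    qed
  next
    case (a_inv h)
    from conjunct2[OF a_inv.IH] obtain c where c: "\<forall>s\<in>SH d. kap d h (scl (pw d) s) = (\<Sum>x\<in>?A. c x * kap d x (scl (pw d) s))" by (rule exE)
    have hc: "h \<in> carrier FA" by (rule conjunct1[OF a_inv.IH])
    have "\<forall>s\<in>SH d. kap d (\<ominus>\<^bsub>FA\<^esub> h) (scl (pw d) s) = (\<Sum>x\<in>?A. (- c x) * kap d x (scl (pw d) s))"
      using c by (simp add: FA_minus(2)[OF hc] sum_negf)
    then show ?case using FA_minus(1)[OF hc] by (intro conjI exI[of _ "\<lambda>x. - c x"])
  next
    case (eng_add g h)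
    from conjunct2[OF eng_add.IH(1)] obtain b where
      b: "\<forall>s\<in>SH d. kap d g (scl (pw d) s) = (\<Sum>x\<in>?A. b x * kap d x (scl (pw d) s))" by (rule exE)
    from conjunct2[OF eng_add.IH(2)] obtain c where
      c: "\<forall>s\<in>SH d. kap d h (scl (pw d) s) = (\<Sum>x\<in>?A. c x * kap d x (scl (pw d) s))" by (rule exE)
    have gh: "g \<in> carrier FA" "h \<in> carrier FA" by (rule conjunct1[OF eng_add.IH(1)], rule conjunct1[OF eng_add.IH(2)])
    have "\<forall>s\<in>SH d. kap d (g \<oplus>\<^bsub>FA\<^esub> h) (scl (pw d) s) = (\<Sum>x\<in>?A. (b x + c x) * kap d x (scl (pw d) s))"
      using b c by (simp add: FA_add(2)[OF gh] distrib_right sum.distrib)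
    then show ?case using FA_add(1)[OF gh] by (intro conjI exI[of _ "\<lambda>x. b x + c x"])
  next
    case (eng_mult g h)
    from conjunct2[OF eng_mult.IH(1)] obtain b where
      b: "\<forall>s\<in>SH d. kap d g (scl (pw d) s) = (\<Sum>x\<in>?A. b x * kap d x (scl (pw d) s))" by (rule exE)
    from conjunct2[OF eng_mult.IH(2)] obtain c where
      c: "\<forall>s\<in>SH d. kap d h (scl (pw d) s) = (\<Sum>x\<in>?A. c x * kap d x (scl (pw d) s))" by (rule exE)
    have gh: "g \<in> carrier FA" "h \<in> carrier FA" by (rule conjunct1[OF eng_mult.IH(1)], rule conjunct1[OF eng_mult.IH(2)])
    have "\<forall>s\<in>SH d. kap d (g \<otimes>\<^bsub>FA\<^esub> h) (scl (pw d) s) =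
        (\<Sum>x\<in>?A. (kap 0 g 0 * c x + kap 0 h 0 ^ pw d * b x) * kap d x (scl (pw d) s))"
      using b c by (simp add: kap_mult_at_scl[OF d(1) _ gh] distrib_right sum.distrib sum_distrib_left mult.assoc)
    then show ?case using FA_mult(1)[OF gh]
      by (intro conjI exI[of _ "\<lambda>x. kap 0 g 0 * c x + kap 0 h 0 ^ pw d * b x"])
  qed
  fix s0 assume s0: "s0 \<in> SH d"
  \<comment> \<open>The monomials of \<open>SH d\<close> give elements of \<open>GR e\<close>
    because \<open>d \<le> e\<close>; their coefficient vectors are the unit vectors.\<close>
  let ?m = "mvps_monom (scl (pw d) s0) :: 'k mvps"
  have mS: "?m \<in> useries (pw d)" using s0 SH_MS by (intro scl_series[OF d(1)]) auto
  have "hmg d ?m \<in> (\<Union>i\<le>e. DG i)" using hmg_degree[OF mS] d(2) by blast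
  then have "hmg d ?m \<in> generate_ring FA (DG 0 \<union> A)"
    unfolding A(3) frobenius_G_def by (rule generate_ring.incl)
  from conjunct2[OF main[OF this]] obtain c where
    c: "\<forall>s\<in>SH d. kap d (hmg d ?m) (scl (pw d) s) = (\<Sum>x\<in>?A. c x * kap d x (scl (pw d) s))" by (rule exE)
  have "scl (pw d) s = scl (pw d) s0 \<longleftrightarrow> s = s0" if "s \<in> SH d" for s
  proof (rule inj_on_eq_iff[OF scl_inj[OF pw_ge_2[OF d(1)]]])
    show "s \<in> PP" "s0 \<in> PP" using that s0 SH_MS by (auto simp: MS_def)
  qed
  then have mv: "?m (scl (pw d) s) = (if s = s0 then 1 else 0)" if "s \<in> SH d" for s
    using that by (simp add: mvps_monom_def)
  have km: "kap d (hmg d ?m) = ?m" by (simp only: kap_hmg[OF mS] if_True simp_thms)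
  show "\<exists>c. \<forall>s\<in>SH d. (if s = s0 then 1 else 0) = (\<Sum>x\<in>?A. c x * kap d x (scl (pw d) s))"
  proof (intro exI ballI)
    fix s assume s: "s \<in> SH d"
    show "(if s = s0 then 1 else 0) = (\<Sum>x\<in>?A. c x * kap d x (scl (pw d) s))"
      using bspec[OF c s] unfolding km mv[OF s] .
  qed
qed

lemma sum_card_SH: "(\<Sum>d\<in>{1..e}. card (SH d)) = e * card QQ + (if e = 0 then 0 else 1)"
proof (induction e)
  case (Suc e)
  then show ?case by (cases "e = 0") (simp_all add: SH_def card_MS)
qed simp

text \<open>A homogeneous element has at most one nonzero component, so the bounds for the degrees
  \<open>1\<close> to \<open>e\<close> add up. The additional generator is that of \<open>mm\<close>
  in degree one.\<close>

lemma card_generators_ge: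
  assumes A: "finite A" "A \<subseteq> (\<Union>d. DG d)" "generate_ring FA (DG 0 \<union> A) = GR e"
  shows "e * card QQ + (if e = 0 then 0 else 1) \<le> card A"
proof -
  let ?A = "\<lambda>d. {\<Phi> \<in> A. \<Phi> d \<noteq> Zr}"
  have "e * card QQ + (if e = 0 then 0 else 1) = (\<Sum>d\<in>{1..e}. card (SH d))"
    by (rule sum_card_SH[symmetric])
  also have "\<dots> \<le> (\<Sum>d\<in>{1..e}. card (?A d))"
    by (rule sum_mono) (use card_SH_le[OF A] in auto)
  also have "\<dots> = card (\<Union>d\<in>{1..e}. ?A d)"
  proof (rule card_UN_disjoint[symmetric])
    show "\<forall>i\<in>{1..e}. \<forall>j\<in>{1..e}. i \<noteq> j \<longrightarrow> ?A i \<inter> ?A j = {}"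
    proof (intro ballI impI, rule ccontr)
      fix i j :: nat assume ij: "i \<noteq> j" and "?A i \<inter> ?A j \<noteq> {}"
      then obtain \<Phi> where "\<Phi> \<in> A" "\<Phi> i \<noteq> Zr" "\<Phi> j \<noteq> Zr" by auto
      moreover from this(1) A(2) obtain d where "\<Phi> \<in> DG d" by auto
      ultimately have "i = d" "j = d" using degree_zero by auto
      with ij show False by simp
    qed
  qed (use A(1) in auto)
  also have "\<dots> \<le> card A" by (rule card_mono[OF A(1)]) auto
  finally show ?thesis .
qed

section \<open>Generators that attain the bound\<close>

definition gens :: "nat \<Rightarrow> (nat \<Rightarrow> 'e \<Rightarrow> 'e) set" where
  "gens e = (\<Union>d\<in>{1..e}. (\<lambda>s. hmg d (mvps_monom (scl (pw d) s))) ` SH d)"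

lemma gens_degree: "gens e \<subseteq> (\<Union>d\<in>{1..e}. DG d)"
  unfolding gens_def
proof (rule UN_mono[OF order_refl], rule image_subsetI)
  fix d s assume "d \<in> {1..e}" "s \<in> SH d"
  then show "hmg d (mvps_monom (scl (pw d) s)) \<in> DG d"
    using SH_MS by (intro hmg_degree scl_series) auto
qed

lemma card_gens: "finite (gens e)" "card (gens e) \<le> e * card QQ + (if e = 0 then 0 else 1)"
proof -
  show "finite (gens e)" unfolding gens_def by (intro finite_UN_I finite_imageI SH_finite) simp
  have "card (gens e) \<le> (\<Sum>d\<in>{1..e}. card ((\<lambda>s. hmg d (mvps_monom (scl (pw d) s))) ` SH d))"
    unfolding gens_def by (rule card_UN_le) simp
  also have "\<dots> \<le> (\<Sum>d\<in>{1..e}. card (SH d))"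
    by (intro sum_mono card_image_le SH_finite)
  finally show "card (gens e) \<le> e * card QQ + (if e = 0 then 0 else 1)" by (simp only: sum_card_SH)
qed

text \<open>Beyond degree one only \<open>mm\<close> is absent from the generators, and there it is
  a product, since \<open>(p - 1) + p * (p^d - 1) = p^(d+1) - 1\<close>.\<close>

lemma monom_in_generated:
  assumes "1 \<le> d" "d \<le> e" "s \<in> MS"
  shows "hmg d (mvps_monom (scl (pw d) s)) \<in> generate_ring FA (DG 0 \<union> gens e)"
  using assms
proof (induction d arbitrary: s)
  case (Suc d)
  show ?case
  proof (cases "s \<in> SH (Suc d)")
    case True
    then have "hmg (Suc d) (mvps_monom (scl (pw (Suc d)) s)) \<in> gens e"
      unfolding gens_def using Suc.prems(1,2) by (intro UN_I[of "Suc d"] imageI) auto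
    then show ?thesis by (intro generate_ring.incl UnI2)
  next
    case False
    then have d1: "d \<ge> 1" and s: "s = mm" using Suc.prems(3) by (auto simp: SH_def QQ_def split: if_splits)
    let ?a = "mvps_monom (scl (pw 1) mm) :: 'k mvps" and ?b = "mvps_monom (scl (pw d) mm) :: 'k mvps"
    have e1: "1 \<le> e" using Suc.prems(2) by simp
    have a: "hmg 1 ?a \<in> generate_ring FA (DG 0 \<union> gens e)"
    proof (rule generate_ring.incl, rule UnI2)
      show "hmg 1 ?a \<in> gens e"
        unfolding gens_def using e1 mm_MS by (intro UN_I[of 1] imageI) (auto simp: SH_def)
    qed
    have b: "hmg d ?b \<in> generate_ring FA (DG 0 \<union> gens e)"
      using Suc.IH[OF d1 _ mm_MS] Suc.prems(2) by simp
    have au: "?a \<in> useries (pw 1)" and bu: "?b \<in> useries (pw d)"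
      using scl_series[OF order_refl mm_MS] scl_series[OF d1 mm_MS] .
    have sum: "scl (pw 1) mm + (\<lambda>i. pw 1 * scl (pw d) mm i) = scl (pw (Suc d)) mm"
    proof
      fix i
      have "p - 1 + p * (p ^ d - 1) = p * p ^ d - 1"
        using pw_pos[of d] pw_pos[of 1] by (simp add: diff_mult_distrib2)
      then show "(scl (pw 1) mm + (\<lambda>i. pw 1 * scl (pw d) mm i)) i = scl (pw (Suc d)) mm i"
        by (simp add: scl_def mm_def)
    qed
    have ax: "scl (pw 1) mm \<in> exps n" "(\<lambda>i. pw 1 * scl (pw d) mm i) \<in> exps n"
    proof -
      have "mm \<in> exps n" using mm_PP CC_exps by (auto simp: PP_def)
      then show "scl (pw 1) mm \<in> exps n" "(\<lambda>i. pw 1 * scl (pw d) mm i) \<in> exps n"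
        by (auto simp: scl_def exps_def)
    qed
    have "pmul ?a (pfrob (pw 1) ?b) = mvps_monom (scl (pw (Suc d)) mm)"
      unfolding pfrob_monom[OF pw_pos] unfolding mvps_monom_eq pmul_pterm_pterm[OF ax] sum by simp
    moreover have "trunc (pw (Suc d)) (mvps_monom (scl (pw (Suc d)) mm)) = mvps_monom (scl (pw (Suc d)) mm)"
      using scl_series[OF Suc.prems(1) mm_MS] by (auto simp: trunc_def useries_def fun_eq_iff)
    ultimately have "hmg 1 ?a \<otimes>\<^bsub>FA\<^esub> hmg d ?b = hmg (Suc d) (mvps_monom (scl (pw (Suc d)) mm))"
      using hmg_mult[OF au bu] by (simp only: plus_1_eq_Suc)
    with generate_ring.eng_mult[OF a b] show ?thesis by (simp only: s)
  qed
qed simp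

text \<open>A series can have infinitely many terms, so the induction runs over the finitely many
  patterns: the terms above one scaled pattern form a degree zero element times its monomial, by
  \<open>TT_diff_scl\<close>.\<close>

lemma series_in_generated:
  assumes d: "1 \<le> d" "d \<le> e" and W: "finite W" "W \<subseteq> MS"
  shows "u \<in> useries (pw d) \<Longrightarrow> \<forall>c. u c \<noteq> 0 \<longrightarrow> (\<exists>s\<in>W. scl (pw d) s \<le> c) \<Longrightarrow>
    hmg d u \<in> generate_ring FA (DG 0 \<union> gens e)"
  using W
proof (induction W arbitrary: u rule: finite_induct)
  case empty
  then have u0: "u = 0" by (auto simp: fun_eq_iff)
  \<comment> \<open>Zero is homogeneous of degree zero as well.\<close>
  have "hmg d u = hmg 0 0" unfolding u0 by (rule ext) (simp add: hmg_def mk_zero)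
  with hmg_degree[OF useries_zero, of 0] have "hmg d u \<in> DG 0" by simp
  then show ?case by (intro generate_ring.incl UnI1)
next
  case (insert s W)
  let ?x = "scl (pw d) s"
  have s: "s \<in> MS" using insert.prems by simp
  then have sP: "s \<in> PP" by (simp add: MS_def)
  define u1 where "u1 = (\<lambda>c. if ?x \<le> c then u c else 0)"
  define u2 where "u2 = (\<lambda>c. if ?x \<le> c then 0 else u c)"
  define r where "r = (\<lambda>c. u (c + ?x))"
  have u12: "u1 \<in> useries (pw d)" "u2 \<in> useries (pw d)"
    using insert.prems(1) by (auto simp: u1_def u2_def useries_def)
  have sum: "u1 + u2 = u" by (auto simp: u1_def u2_def fun_eq_iff)
  have h2: "hmg d u2 \<in> generate_ring FA (DG 0 \<union> gens e)"
  proof (rule insert.IH[OF u12(2)])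
    show "\<forall>c. u2 c \<noteq> 0 \<longrightarrow> (\<exists>s\<in>W. scl (pw d) s \<le> c)"
    proof (intro allI impI)
      fix c assume c: "u2 c \<noteq> 0"
      then have "u c \<noteq> 0" "\<not> ?x \<le> c" by (auto simp: u2_def split: if_splits)
      with insert.prems(2) show "\<exists>s\<in>W. scl (pw d) s \<le> c" by auto
    qed
    show "W \<subseteq> MS" using insert.prems(3) by simp
  qed
  have rS: "r \<in> useries (pw 0)"
    unfolding useries_def power_0 TT_1
  proof (intro CollectI allI impI)
    fix c assume "r c \<noteq> 0"
    then have "c + ?x \<in> TT (pw d)" using insert.prems(1) by (simp add: r_def useries_def)
    moreover have "?x \<le> c + ?x" by (simp add: le_fun_def)
    ultimately have "c + ?x - ?x \<in> NN" by (rule TT_diff_scl[OF pw_ge_2[OF d(1)] _ sP])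
    moreover have "c + ?x - ?x = c" by (simp add: fun_eq_iff)
    ultimately show "c \<in> NN" by simp
  qed
  have xx: "?x \<in> exps n" using scl_MS_TT[OF pw_ge_2[OF d(1)] s] by (intro subsetD[OF CC_exps] subsetD[OF TT_CC])
  have "trunc (pw d) (pmul r (mvps_monom ?x)) = u1"
  proof
    fix c
    show "trunc (pw d) (pmul r (mvps_monom ?x)) c = u1 c"
    proof (cases "c \<in> TT (pw d)")
      case True
      then have cx: "c \<in> exps n" by (intro subsetD[OF CC_exps] subsetD[OF TT_CC])
      have "pmul r (mvps_monom ?x) c = (if ?x \<le> c then r (c - ?x) else 0)"
        by (subst pmul_commute) (simp add: mvps_monom_eq pmul_pterm[OF cx])
      moreover have "c - ?x + ?x = c" if "?x \<le> c"
        by (rule ext) (use le_funD[OF that] in simp)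
      ultimately show ?thesis using True by (simp add: trunc_def u1_def r_def)
    next
      case False
      then show ?thesis using u12(1) by (auto simp: trunc_def useries_def)
    qed
  qed
  then have "hmg 0 r \<otimes>\<^bsub>FA\<^esub> hmg d (mvps_monom ?x) = hmg d u1"
    using hmg_mult[OF rS scl_series[OF d(1) s]] by (simp only: add_0_left power_0 pfrob_one)
  moreover have "hmg 0 r \<in> generate_ring FA (DG 0 \<union> gens e)"
    by (intro generate_ring.incl UnI1 hmg_degree[OF rS])
  ultimately have h1: "hmg d u1 \<in> generate_ring FA (DG 0 \<union> gens e)"
    using generate_ring.eng_mult[OF _ monom_in_generated[OF d s], of "hmg 0 r"] by simp
  have "hmg d u1 \<oplus>\<^bsub>FA\<^esub> hmg d u2 = hmg d u"
  proof (rule FA_eqI)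
    note c1 = hmg_carrier[OF u12(1)] and c2 = hmg_carrier[OF u12(2)]
    show "hmg d u1 \<oplus>\<^bsub>FA\<^esub> hmg d u2 \<in> carrier FA" by (rule FA_add(1)[OF c1 c2])
    show "hmg d u \<in> carrier FA" by (rule hmg_carrier[OF insert.prems(1)])
    fix l
    show "kap l (hmg d u1 \<oplus>\<^bsub>FA\<^esub> hmg d u2) = kap l (hmg d u)"
      unfolding FA_add(2)[OF c1 c2] kap_hmg[OF u12(1)] kap_hmg[OF u12(2)] kap_hmg[OF insert.prems(1)]
      by (cases "l = d") (simp_all only: simp_thms if_True if_False sum add_0_left)
  qed
  with generate_ring.eng_add[OF h1 h2] show ?case by simp
qed

lemma generate_gens: "generate_ring FA (DG 0 \<union> gens e) = GR e"
proof
  have mono: "h \<in> generate_ring FA H'" if "h \<in> generate_ring FA H" "H \<subseteq> generate_ring FA H'" for h H H'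
    using that(1)
  proof (induction rule: generate_ring.induct)
    case (incl h)
    with that(2) show ?case by (rule subsetD)
  qed (auto intro: generate_ring.intros)
  show "generate_ring FA (DG 0 \<union> gens e) \<subseteq> GR e"
  proof
    fix h assume h: "h \<in> generate_ring FA (DG 0 \<union> gens e)"
    have "DG 0 \<union> gens e \<subseteq> (\<Union>d\<le>e. DG d)" using gens_degree[of e] by fastforce
    then have "DG 0 \<union> gens e \<subseteq> generate_ring FA (\<Union>d\<le>e. DG d)" by (auto intro: generate_ring.incl)
    from mono[OF h this] show "h \<in> GR e" by (simp only: frobenius_G_def)
  qed
  show "GR e \<subseteq> generate_ring FA (DG 0 \<union> gens e)"
  proof
    fix h assume h: "h \<in> GR e"
    have "\<Phi> \<in> generate_ring FA (DG 0 \<union> gens e)" if F: "\<Phi> \<in> DG d" and d: "d \<le> e" for \<Phi> d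
    proof (cases "d = 0")
      case True
      with F show ?thesis by (intro generate_ring.incl UnI1) simp
    next
      case False
      then have d1: "1 \<le> d" by simp
      have "hmg d (kap d \<Phi>) \<in> generate_ring FA (DG 0 \<union> gens e)"
      proof (rule series_in_generated[OF d1 d finite_MS order_refl kap_useries], intro allI impI)
        fix c assume "kap d \<Phi> c \<noteq> 0"
        then have "c \<in> TT (pw d)" using kap_useries[of d \<Phi>] by (simp add: useries_def)
        from TT_ge_MS[OF pw_ge_2[OF d1] this] show "\<exists>s\<in>MS. scl (pw d) s \<le> c" .
      qed
      then show ?thesis unfolding degree_hmg[OF F, symmetric] .
    qed
    then have "(\<Union>d\<le>e. DG d) \<subseteq> generate_ring FA (DG 0 \<union> gens e)" by blast
    from mono[OF h[unfolded frobenius_G_def] this] show "h \<in> generate_ring FA (DG 0 \<union> gens e)" .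
  qed
qed

lemma frobenius_k_eq: "frobenius_k p RR E e = enat (e * card QQ + (if e = 0 then 0 else 1))"
proof (rule antisym)
  have "gens e \<in> {A. finite A \<and> A \<subseteq> (\<Union>d. DG d) \<and> generate_ring FA (DG 0 \<union> A) = GR e}"
    using card_gens(1)[of e] gens_degree[of e] generate_gens[of e] by blast
  then have "frobenius_k p RR E e \<le> enat (card (gens e))"
    unfolding frobenius_k_def by (rule INF_lower)
  also have "\<dots> \<le> enat (e * card QQ + (if e = 0 then 0 else 1))"
    using card_gens(2)[of e] by (simp only: enat_ord_simps)
  finally show "frobenius_k p RR E e \<le> enat (e * card QQ + (if e = 0 then 0 else 1))" .
  show "enat (e * card QQ + (if e = 0 then 0 else 1)) \<le> frobenius_k p RR E e"
    unfolding frobenius_k_def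
  proof (rule INF_greatest)
    fix A assume "A \<in> {A. finite A \<and> A \<subseteq> (\<Union>d. DG d) \<and> generate_ring FA (DG 0 \<union> A) = GR e}"
    then have "finite A" "A \<subseteq> (\<Union>d. DG d)" "generate_ring FA (DG 0 \<union> A) = GR e" by simp_all
    from card_generators_ge[OF this]
    show "enat (e * card QQ + (if e = 0 then 0 else 1)) \<le> enat (card A)" by (simp only: enat_ord_simps)
  qed
qed

lemma complexity_eq:
  "complexity p RR E 0 = 0"
  "complexity p RR E 1 = enat (card QQ) + 1"
  "e \<ge> 2 \<Longrightarrow> complexity p RR E e = enat (card QQ)"
proof -
  show "complexity p RR E 0 = 0" by (simp add: complexity_def frobenius_k_eq zero_enat_def)
  show "complexity p RR E 1 = enat (card QQ) + 1" by (simp add: complexity_def frobenius_k_eq one_enat_def)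
  assume e: "e \<ge> 2"
  define l where "l = e - 2"
  with e have l: "e = Suc (Suc l)" by simp
  show "complexity p RR E e = enat (card QQ)" by (simp add: complexity_def frobenius_k_eq l)
qed

end

theorem theorem3p10:
  fixes p n :: nat
    and I :: "'k::field mvps set"
    and E :: "('k mvps set, 'e) module"
  assumes "Factorial_Ring.prime p" and "CHAR('k) = p"
    and "squarefree_monomial_ideal n I"
    and "I \<noteq> carrier (mvps_ring n)"
    and "injective_hull (mvps_ring n Quot I) (residue_field_module (mvps_ring n Quot I)) E"
  shows "complexity p (mvps_ring n Quot I) E 0 = 0 \<and>
    complexity p (mvps_ring n Quot I) E 1 = min_num_gens (mvps_ring n) (J_ideal n I p) + 1 \<and>
    (\<forall>e\<ge>2. complexity p (mvps_ring n Quot I) E e = min_num_gens (mvps_ring n) (J_ideal n I p))"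
proof -
  obtain FF where FF: "antichain n FF" and I: "I = MI n (cov n FF)"
    using squarefree_antichain[OF assms(3,4)] by (elim exE conjE)
  have p: "Factorial_Ring.prime CHAR('k)" using assms(1,2) by simp
  interpret F: frobenius_hull n FF E p
    using FF assms(5) p assms(2)
    unfolding I frobenius_hull_def hull_def hull_axioms_def frobenius_hull_axioms_def by simp
  have J: "J_ideal n I p = MI n (upset n (F.scl p ` F.QQ))"
    unfolding I assms(2)[symmetric] by (rule F.J_ideal_eq[OF p])
  have "min_num_gens (mvps_ring n) (J_ideal n I p) = enat (card F.QQ)"
    unfolding J by (rule F.min_num_gens_J[OF prime_ge_2_nat[OF assms(1)]])
  then show ?thesis
    unfolding I using F.complexity_eq by simp
qed

end
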